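(* $\mathsf{RCA}_0+\mathsf{AHT}\vdash B\Sigma^0_3$.
   Context: $\mathsf{RCA}_0$ is the usual base system of reverse mathematics in second-order arithmetic; $\mathbf{N}$ denotes its first-order universe, and all principles below are statements in the language of second-order arithmetic. A map into $k$ means a map into $\{0,\dots,k-1\}$. For a positive integer $n=2^{t_1}+\dots+2^{t_p}$ with $t_1<\dots<t_p$, put $\lambda(n)=t_1$ and $\mu(n)=t_p$. A set $X$ of positive integers satisfies the Apartness Condition if for all $x,x'\in X$ with $x<x'$ we have $\mu(x)<\lambda(x')$. For an infinite set $H=\{h_1<h_2<h_3<\dots\}$, $AS(H)$ denotes the set of all finite sums of distinct adjacent elements of $H$, i.e. all sums $h_i+h_{i+1}+\dots+h_j$ with $i\le j$ (including single elements, $i=j$). $\mathsf{AHT}_k$ (Adjacent Hindman's Theorem for $k$ colors): for every $c:\mathbf{N}\to k$ there exists an infinite set $H$ of positive integers satisfying the Apartness Condition such that all elements of $AS(H)$ have the same $c$-color. $\mathsf{AHT}$ denotes the single sentence $\forall k\,\mathsf{AHT}_k$. $B\Sigma^0_3$ is the collection (bounding) scheme for $\Sigma^0_3$ formulas $\varphi(x,y)$ (with number and set parameters): for every $n$, if $\forall x<n\,\exists y\,\varphi(x,y)$ then $\exists b\,\forall x<n\,\exists y<b\,\varphi(x,y)$. *)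

theory Defs
  imports Main
begin

section \<open>The language of second-order arithmetic\<close>

text \<open>
  Variables are de Bruijn indices. Number variables and set variables are indexed separately:
  a number quantifier does not affect set indices, and vice versa. As in Simpson's presentation,
  equality is primitive for numbers only.
\<close>

datatype tm = Var nat | Zero | One | Add tm tm | Mul tm tm

datatype fm =
    Bot
  | Eq tm tm    (infix \<open>\<^bold>=\<close> 60)
  | Less tm tm  (infix \<open>\<^bold><\<close> 60)
  | Mem tm nat  (infix \<open>\<^bold>\<in>\<close> 60)
  | Imp fm fm   (infixr \<open>\<^bold>\<longrightarrow>\<close> 55)
  | AllN fm
  | AllS fm

abbreviation Neg :: "fm \<Rightarrow> fm" (\<open>\<^bold>\<not> _\<close> [58] 58) where
  "\<^bold>\<not> \<phi> \<equiv> \<phi> \<^bold>\<longrightarrow> Bot"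

abbreviation Con :: "fm \<Rightarrow> fm \<Rightarrow> fm" (infixr \<open>\<^bold>\<and>\<close> 57) where
  "\<phi> \<^bold>\<and> \<psi> \<equiv> \<^bold>\<not> (\<phi> \<^bold>\<longrightarrow> \<^bold>\<not> \<psi>)"

abbreviation Dis :: "fm \<Rightarrow> fm \<Rightarrow> fm" (infixr \<open>\<^bold>\<or>\<close> 56) where
  "\<phi> \<^bold>\<or> \<psi> \<equiv> \<^bold>\<not> \<phi> \<^bold>\<longrightarrow> \<psi>"

abbreviation Iff :: "fm \<Rightarrow> fm \<Rightarrow> fm" (infix \<open>\<^bold>\<longleftrightarrow>\<close> 54) where
  "\<phi> \<^bold>\<longleftrightarrow> \<psi> \<equiv> (\<phi> \<^bold>\<longrightarrow> \<psi>) \<^bold>\<and> (\<psi> \<^bold>\<longrightarrow> \<phi>)"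

abbreviation ExN :: "fm \<Rightarrow> fm" where
  "ExN \<phi> \<equiv> \<^bold>\<not> AllN (\<^bold>\<not> \<phi>)"

abbreviation ExS :: "fm \<Rightarrow> fm" where
  "ExS \<phi> \<equiv> \<^bold>\<not> AllS (\<^bold>\<not> \<phi>)"

abbreviation Le :: "tm \<Rightarrow> tm \<Rightarrow> fm" (infix \<open>\<^bold>\<le>\<close> 60) where
  "t \<^bold>\<le> u \<equiv> t \<^bold>< u \<^bold>\<or> t \<^bold>= u"

primrec subst_tm :: "(nat \<Rightarrow> tm) \<Rightarrow> tm \<Rightarrow> tm" where
  "subst_tm \<sigma> (Var i) = \<sigma> i"
| "subst_tm \<sigma> Zero = Zero"
| "subst_tm \<sigma> One = One"
| "subst_tm \<sigma> (Add t u) = Add (subst_tm \<sigma> t) (subst_tm \<sigma> u)"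
| "subst_tm \<sigma> (Mul t u) = Mul (subst_tm \<sigma> t) (subst_tm \<sigma> u)"

definition lift :: "tm \<Rightarrow> nat \<Rightarrow> tm" (infixl \<open>\<up>\<close> 90) where
  "t \<up> d = subst_tm (\<lambda>i. Var (i + d)) t"

text \<open>Simultaneous capture-avoiding substitution of terms for the free number variables and
  of set variables for the free set variables.\<close>

primrec subst :: "(nat \<Rightarrow> tm) \<Rightarrow> (nat \<Rightarrow> nat) \<Rightarrow> fm \<Rightarrow> fm" where
  "subst \<sigma> \<rho> Bot = Bot"
| "subst \<sigma> \<rho> (t \<^bold>= u) = (subst_tm \<sigma> t \<^bold>= subst_tm \<sigma> u)"
| "subst \<sigma> \<rho> (t \<^bold>< u) = (subst_tm \<sigma> t \<^bold>< subst_tm \<sigma> u)"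
| "subst \<sigma> \<rho> (t \<^bold>\<in> X) = (subst_tm \<sigma> t \<^bold>\<in> \<rho> X)"
| "subst \<sigma> \<rho> (\<phi> \<^bold>\<longrightarrow> \<psi>) = (subst \<sigma> \<rho> \<phi> \<^bold>\<longrightarrow> subst \<sigma> \<rho> \<psi>)"
| "subst \<sigma> \<rho> (AllN \<phi>) = AllN (subst (case_nat (Var 0) (\<lambda>i. \<sigma> i \<up> 1)) \<rho> \<phi>)"
| "subst \<sigma> \<rho> (AllS \<phi>) = AllS (subst \<sigma> (case_nat 0 (\<lambda>i. Suc (\<rho> i))) \<phi>)"

definition liftN :: "fm \<Rightarrow> fm" where
  "liftN = subst (\<lambda>i. Var (Suc i)) id"

definition liftS :: "fm \<Rightarrow> fm" where
  "liftS = subst Var Suc"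

definition instN :: "fm \<Rightarrow> tm \<Rightarrow> fm" where
  "instN \<phi> t = subst (case_nat t Var) id \<phi>"

definition instS :: "fm \<Rightarrow> nat \<Rightarrow> fm" where
  "instS \<phi> X = subst Var (case_nat X id) \<phi>"


section \<open>Provability: classical two-sorted natural deduction\<close>

text \<open>In the introduction rules for the quantifiers, lifting the hypotheses makes index 0 the
  eigenvariable.\<close>

inductive proves :: "fm set \<Rightarrow> fm \<Rightarrow> bool" (infix \<open>\<turnstile>\<close> 50) where
  Hyp: "\<phi> \<in> \<Gamma> \<Longrightarrow> \<Gamma> \<turnstile> \<phi>"
| ImpI: "insert \<phi> \<Gamma> \<turnstile> \<psi> \<Longrightarrow> \<Gamma> \<turnstile> \<phi> \<^bold>\<longrightarrow> \<psi>"
| ImpE: "\<Gamma> \<turnstile> \<phi> \<^bold>\<longrightarrow> \<psi> \<Longrightarrow> \<Gamma> \<turnstile> \<phi> \<Longrightarrow> \<Gamma> \<turnstile> \<psi>"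
| Classical: "insert (\<^bold>\<not> \<phi>) \<Gamma> \<turnstile> Bot \<Longrightarrow> \<Gamma> \<turnstile> \<phi>"
| AllNI: "liftN ` \<Gamma> \<turnstile> \<phi> \<Longrightarrow> \<Gamma> \<turnstile> AllN \<phi>"
| AllNE: "\<Gamma> \<turnstile> AllN \<phi> \<Longrightarrow> \<Gamma> \<turnstile> instN \<phi> t"
| AllSI: "liftS ` \<Gamma> \<turnstile> \<phi> \<Longrightarrow> \<Gamma> \<turnstile> AllS \<phi>"
| AllSE: "\<Gamma> \<turnstile> AllS \<phi> \<Longrightarrow> \<Gamma> \<turnstile> instS \<phi> X"
| EqI: "\<Gamma> \<turnstile> t \<^bold>= t"
| EqE: "\<Gamma> \<turnstile> t \<^bold>= u \<Longrightarrow> \<Gamma> \<turnstile> instN \<phi> t \<Longrightarrow> \<Gamma> \<turnstile> instN \<phi> u"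


section \<open>Universal closure\<close>

text \<open>A strict upper bound on the free number (set) variables.\<close>

primrec bound_tm :: "tm \<Rightarrow> nat" where
  "bound_tm (Var i) = Suc i"
| "bound_tm Zero = 0"
| "bound_tm One = 0"
| "bound_tm (Add t u) = max (bound_tm t) (bound_tm u)"
| "bound_tm (Mul t u) = max (bound_tm t) (bound_tm u)"

primrec boundN :: "fm \<Rightarrow> nat" where
  "boundN Bot = 0"
| "boundN (t \<^bold>= u) = max (bound_tm t) (bound_tm u)"
| "boundN (t \<^bold>< u) = max (bound_tm t) (bound_tm u)"
| "boundN (t \<^bold>\<in> X) = bound_tm t"
| "boundN (\<phi> \<^bold>\<longrightarrow> \<psi>) = max (boundN \<phi>) (boundN \<psi>)"
| "boundN (AllN \<phi>) = boundN \<phi> - 1"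
| "boundN (AllS \<phi>) = boundN \<phi>"

primrec boundS :: "fm \<Rightarrow> nat" where
  "boundS Bot = 0"
| "boundS (t \<^bold>= u) = 0"
| "boundS (t \<^bold>< u) = 0"
| "boundS (t \<^bold>\<in> X) = Suc X"
| "boundS (\<phi> \<^bold>\<longrightarrow> \<psi>) = max (boundS \<phi>) (boundS \<psi>)"
| "boundS (AllN \<phi>) = boundS \<phi>"
| "boundS (AllS \<phi>) = boundS \<phi> - 1"

definition univ_closure :: "fm \<Rightarrow> fm" where
  "univ_closure \<phi> = (AllS ^^ boundS \<phi>) ((AllN ^^ boundN \<phi>) \<phi>)"


section \<open>The arithmetical hierarchy\<close>

inductive_set Delta00 :: "fm set" where
  "Bot \<in> Delta00"
| "(t \<^bold>= u) \<in> Delta00"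
| "(t \<^bold>< u) \<in> Delta00"
| "(t \<^bold>\<in> X) \<in> Delta00"
| "\<phi> \<in> Delta00 \<Longrightarrow> \<psi> \<in> Delta00 \<Longrightarrow> (\<phi> \<^bold>\<longrightarrow> \<psi>) \<in> Delta00"
| "\<phi> \<in> Delta00 \<Longrightarrow> AllN (Var 0 \<^bold>< t \<up> 1 \<^bold>\<longrightarrow> \<phi>) \<in> Delta00"
| "\<phi> \<in> Delta00 \<Longrightarrow> ExN (Var 0 \<^bold>< t \<up> 1 \<^bold>\<and> \<phi>) \<in> Delta00"

fun Sigma0 :: "nat \<Rightarrow> fm set" and Pi0 :: "nat \<Rightarrow> fm set" where
  "Sigma0 0 = Delta00"
| "Sigma0 (Suc n) = ExN ` Pi0 n"
| "Pi0 0 = Delta00"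
| "Pi0 (Suc n) = AllN ` Sigma0 n"


section \<open>The system RCA and the bounding scheme\<close>

text \<open>
  In a scheme over formulas $\varphi(x_0,\dots,x_{m-1})$ the indices $0,\dots,m-1$ of $\varphi$ are the
  distinguished variables and all higher ones are parameters. The formula \<open>app \<phi> ts d\<close> is
  $\varphi(ts)$ for use below $d$ number quantifiers: these bind indices $0,\dots,d-1$, so the
  parameters are renamed to start at index $d$.
\<close>

definition app :: "fm \<Rightarrow> tm list \<Rightarrow> nat \<Rightarrow> fm" where
  "app \<phi> ts d = subst (\<lambda>i. if i < length ts then ts ! i else Var (i - length ts + d)) id \<phi>"

definition basic_axioms :: "fm set" where
  "basic_axioms = (let m = Var 1; n = Var 0 in univ_closure `
    {\<^bold>\<not> Add n One \<^bold>= Zero,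
     Add m One \<^bold>= Add n One \<^bold>\<longrightarrow> m \<^bold>= n,
     Add m Zero \<^bold>= m,
     Add m (Add n One) \<^bold>= Add (Add m n) One,
     Mul m Zero \<^bold>= Zero,
     Mul m (Add n One) \<^bold>= Add (Mul m n) m,
     \<^bold>\<not> m \<^bold>< Zero,
     m \<^bold>< Add n One \<^bold>\<longleftrightarrow> m \<^bold>< n \<^bold>\<or> m \<^bold>= n})"

definition induction_axiom :: "fm \<Rightarrow> fm" where
  "induction_axiom \<phi> = univ_closure
    (app \<phi> [Zero] 0 \<^bold>\<and> AllN (app \<phi> [Var 0] 1 \<^bold>\<longrightarrow> app \<phi> [Add (Var 0) One] 1)
      \<^bold>\<longrightarrow> AllN (app \<phi> [Var 0] 1))"

text \<open>Lifting \<open>\<phi>\<close> ensures that the set asserted to exist is not a parameter of \<open>\<phi>\<close>.\<close>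

definition comprehension_axiom :: "fm \<Rightarrow> fm \<Rightarrow> fm" where
  "comprehension_axiom \<phi> \<psi> = univ_closure
    (AllN (\<phi> \<^bold>\<longleftrightarrow> \<psi>) \<^bold>\<longrightarrow> ExS (AllN (Var 0 \<^bold>\<in> 0 \<^bold>\<longleftrightarrow> liftS \<phi>)))"

definition RCA0 :: "fm set" where
  "RCA0 = basic_axioms \<union> induction_axiom ` Sigma0 1
    \<union> {comprehension_axiom \<phi> \<psi> | \<phi> \<psi>. \<phi> \<in> Sigma0 1 \<and> \<psi> \<in> Pi0 1}"

text \<open>Index 0 of \<open>\<phi>\<close> is $y$ and index 1 is $x$; the bound $n$ is the outermost quantifier.\<close>

definition bounding_axiom :: "fm \<Rightarrow> fm" where
  "bounding_axiom \<phi> = univ_closure (AllN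
    (AllN (Var 0 \<^bold>< Var 1 \<^bold>\<longrightarrow> ExN (app \<phi> [Var 0, Var 1] 3))
      \<^bold>\<longrightarrow> ExN (AllN (Var 0 \<^bold>< Var 2 \<^bold>\<longrightarrow> ExN (Var 0 \<^bold>< Var 2 \<^bold>\<and> app \<phi> [Var 0, Var 1] 4)))))"

definition BSigma0 :: "nat \<Rightarrow> fm set" where
  "BSigma0 n = bounding_axiom ` Sigma0 n"


section \<open>Functions and finite sequences in second-order arithmetic\<close>

text \<open>Functions are sets of pairs, with the pairing $(i,j) = (i+j)^2+i$.\<close>

definition pair :: "tm \<Rightarrow> tm \<Rightarrow> tm" where
  "pair i j = Add (Mul (Add i j) (Add i j)) i"

definition maps_into :: "nat \<Rightarrow> tm \<Rightarrow> fm" where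
  "maps_into c k =
    AllN (Var 0 \<^bold>\<in> c \<^bold>\<longrightarrow> ExN (ExN (Var 0 \<^bold>< k \<up> 3 \<^bold>\<and> Var 2 \<^bold>= pair (Var 1) (Var 0)))) \<^bold>\<and>
    AllN (ExN (pair (Var 1) (Var 0) \<^bold>\<in> c)) \<^bold>\<and>
    AllN (AllN (AllN (pair (Var 2) (Var 1) \<^bold>\<in> c \<^bold>\<and> pair (Var 2) (Var 0) \<^bold>\<in> c \<^bold>\<longrightarrow> Var 1 \<^bold>= Var 0)))"

text \<open>Finite sequences are coded by Goedel's beta function: \<open>beta a b i y\<close> says that $y$ is the
  remainder of $a$ modulo $1+(i+1)b$, i.e. the entry at position $i$ of the sequence coded
  by $(a,b)$. Positions count from 0.\<close>

definition beta :: "tm \<Rightarrow> tm \<Rightarrow> tm \<Rightarrow> tm \<Rightarrow> fm" where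
  "beta a b i y = (let m = Add One (Mul (Add i One) b) in
    y \<^bold>< m \<^bold>\<and> ExN (a \<up> 1 \<^bold>= Add (Mul (Var 0) (m \<up> 1)) (y \<up> 1)))"

text \<open>$y = 2^t$\<close>

definition pow2 :: "tm \<Rightarrow> tm \<Rightarrow> fm" where
  "pow2 t y = ExN (ExN (
    beta (Var 1) (Var 0) Zero One \<^bold>\<and>
    AllN (Var 0 \<^bold>< t \<up> 3 \<^bold>\<longrightarrow>
      AllN (beta (Var 3) (Var 2) (Var 1) (Var 0) \<^bold>\<longrightarrow>
        beta (Var 3) (Var 2) (Add (Var 1) One) (Add (Var 0) (Var 0)))) \<^bold>\<and>
    beta (Var 1) (Var 0) (t \<up> 2) (y \<up> 2)))"

text \<open>$z = s_i + \dots + s_j$ for the sequence $s$ coded by $(a,b)$; the witnesses code the partial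
  sums, shifted by one.\<close>

definition seq_sum :: "tm \<Rightarrow> tm \<Rightarrow> tm \<Rightarrow> tm \<Rightarrow> tm \<Rightarrow> fm" where
  "seq_sum a b i j z = ExN (ExN (
    beta (Var 1) (Var 0) (i \<up> 2) Zero \<^bold>\<and>
    AllN (i \<up> 3 \<^bold>\<le> Var 0 \<^bold>\<and> Var 0 \<^bold>\<le> j \<up> 3 \<^bold>\<longrightarrow>
      AllN (AllN (beta (Var 4) (Var 3) (Var 2) (Var 1) \<^bold>\<and> beta (a \<up> 5) (b \<up> 5) (Var 2) (Var 0) \<^bold>\<longrightarrow>
        beta (Var 4) (Var 3) (Add (Var 2) One) (Add (Var 1) (Var 0))))) \<^bold>\<and>
    beta (Var 1) (Var 0) (Add (j \<up> 2) One) (z \<up> 2)))"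

text \<open>$s_0 < s_1 < \dots < s_q$\<close>

definition seq_incr :: "tm \<Rightarrow> tm \<Rightarrow> tm \<Rightarrow> fm" where
  "seq_incr a b q = AllN (Var 0 \<^bold>< q \<up> 1 \<^bold>\<longrightarrow>
    AllN (AllN (beta (a \<up> 3) (b \<up> 3) (Var 2) (Var 1) \<^bold>\<and>
      beta (a \<up> 3) (b \<up> 3) (Add (Var 2) One) (Var 0) \<^bold>\<longrightarrow> Var 1 \<^bold>< Var 0)))"


section \<open>Adjacent Hindman's Theorem\<close>

text \<open>$n = 2^{t_0} + \dots + 2^{t_q}$ with $t_0 < \dots < t_q$, where $(a,b)$ codes $t$; the witnesses
  code the sequence of the powers.\<close>

definition binary_exponents :: "tm \<Rightarrow> tm \<Rightarrow> tm \<Rightarrow> tm \<Rightarrow> fm" where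
  "binary_exponents n a b q = (seq_incr a b q \<^bold>\<and>
    ExN (ExN (
      AllN (Var 0 \<^bold>\<le> q \<up> 3 \<^bold>\<longrightarrow>
        AllN (AllN (beta (a \<up> 5) (b \<up> 5) (Var 2) (Var 1) \<^bold>\<and>
          beta (Var 4) (Var 3) (Var 2) (Var 0) \<^bold>\<longrightarrow> pow2 (Var 1) (Var 0)))) \<^bold>\<and>
      seq_sum (Var 1) (Var 0) Zero (q \<up> 2) (n \<up> 2))))"

text \<open>$\lambda(n) = t$\<close>

definition lambda_eq :: "tm \<Rightarrow> tm \<Rightarrow> fm" where
  "lambda_eq n t = ExN (ExN (ExN (
    binary_exponents (n \<up> 3) (Var 2) (Var 1) (Var 0) \<^bold>\<and> beta (Var 2) (Var 1) Zero (t \<up> 3))))"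

text \<open>$\mu(n) = t$\<close>

definition mu_eq :: "tm \<Rightarrow> tm \<Rightarrow> fm" where
  "mu_eq n t = ExN (ExN (ExN (
    binary_exponents (n \<up> 3) (Var 2) (Var 1) (Var 0) \<^bold>\<and> beta (Var 2) (Var 1) (Var 0) (t \<up> 3))))"

definition apart :: "nat \<Rightarrow> fm" where
  "apart X = AllN (AllN (Var 1 \<^bold>\<in> X \<^bold>\<and> Var 0 \<^bold>\<in> X \<^bold>\<and> Var 1 \<^bold>< Var 0 \<^bold>\<longrightarrow>
    ExN (ExN (mu_eq (Var 3) (Var 1) \<^bold>\<and> lambda_eq (Var 2) (Var 0) \<^bold>\<and> Var 1 \<^bold>< Var 0))))"

text \<open>The sequence $h_0 < \dots < h_j$ coded by $(a,b)$ enumerates an initial segment of $H$,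
  i.e. $H \cap [0,h_j] = \{h_0,\dots,h_j\}$.\<close>

definition enumerates :: "nat \<Rightarrow> tm \<Rightarrow> tm \<Rightarrow> tm \<Rightarrow> fm" where
  "enumerates H a b j = (seq_incr a b j \<^bold>\<and>
    AllN (Var 0 \<^bold>\<in> H \<^bold>\<and> ExN (beta (a \<up> 2) (b \<up> 2) (j \<up> 2) (Var 0) \<^bold>\<and> Var 1 \<^bold>\<le> Var 0) \<^bold>\<longleftrightarrow>
      ExN (Var 0 \<^bold>\<le> j \<up> 2 \<^bold>\<and> beta (a \<up> 2) (b \<up> 2) (Var 0) (Var 1))))"

text \<open>$z \in AS(H)$\<close>

definition mem_AS :: "tm \<Rightarrow> nat \<Rightarrow> fm" where
  "mem_AS z H = ExN (ExN (ExN (ExN (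
    Var 1 \<^bold>\<le> Var 0 \<^bold>\<and> enumerates H (Var 3) (Var 2) (Var 0) \<^bold>\<and>
    seq_sum (Var 3) (Var 2) (Var 1) (Var 0) (z \<up> 4)))))"

definition unbounded :: "nat \<Rightarrow> fm" where
  "unbounded X = AllN (ExN (Var 1 \<^bold>< Var 0 \<^bold>\<and> Var 0 \<^bold>\<in> X))"

text \<open>The colouring is set variable 0 up to the point where \<open>H\<close> is introduced, and set variable 1 after it.\<close>

definition AHT_colours :: "tm \<Rightarrow> fm" where
  "AHT_colours k = AllS (maps_into 0 k \<^bold>\<longrightarrow>
    ExS (unbounded 0 \<^bold>\<and> \<^bold>\<not> Zero \<^bold>\<in> 0 \<^bold>\<and> apart 0 \<^bold>\<and>
      ExN (AllN (mem_AS (Var 0) 0 \<^bold>\<longrightarrow> pair (Var 0) (Var 1) \<^bold>\<in> 1))))"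

definition AHT :: fm where
  "AHT = AllN (AHT_colours (Var 0))"

end

theory Submission
  imports Defs "HOL-Library.Countable"
begin

text \<open>
  By completeness it suffices to show that every model of the hypotheses satisfies bounding.
  Suppose that for all $x < n$ there is a $y$ with $\theta(x,y)$, where $\theta(x,y)$ is
  $\forall u\, \exists v\, R(x,y,u,v)$. For $r,t$ call $y$ good for $x$ if
  $\forall u \le r\, \exists v \le t\, R(x,y',u,v)$ for some $y' \le y$. Let $f(r,t) < n$ be an $i$
  whose least good $y$ is largest, and colour a number $z$ by $f(L(z),z)$, where $L(z)$ is the
  largest power of two dividing $z$. If $h_1 < h_2 < \dots$ satisfies the Apartness Condition,
  $L$ does not change when $h_{i+1} + \dots + h_j$ is added to $h_i$; so for a homogeneous
  solution of colour $i$ and for arbitrarily large $r$ (namely $r = L(h_k)$), $f(r,t) = i$ for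
  arbitrarily large $t$. Any $Y$ with $\theta(i,Y)$ is then a bound for all $x < n$ up to an
  application of $B\Pi^0_1$, which follows in the same way from a colouring $f(z)$.

  The partial sums and enumerations in the definition of $AS(H)$ are coded by Goedel's beta
  function, which works in RCA because the moduli have explicit inverses modulo each other.
\<close>

section \<open>Substitution\<close>

text \<open>A sum $z = h_k + ... + h_j$ delivers this, as $L(z)$ depends on $h_k$ alone while $z$
  grows with $j$. No limit of $f$ has to exist; a colour that recurs cofinally is enough, because
  $f(r,t) = i$ means that any $y \<le> r$ that is good for $i$ is good for every $x < n$.

  The obstacle in the arithmetic is that only Sigma-1 induction is available. Induction formulas
  therefore have at most one unbounded existential quantifier in front of a bounded matrix: several
  witnesses are placed below one common bound \<open>z\<close>, and the entries of a sequence are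
  bounded by its code. The term model is embedded in an ordered integral domain so that subtraction,
  divisibility and congruences obey the usual algebra.\<close>

lemma subst_tm_comp: "subst_tm \<sigma> (subst_tm \<tau> t) = subst_tm (\<lambda>i. subst_tm \<sigma> (\<tau> i)) t"
  by (induction t) auto

lemma subst_tm_Var [simp]: "subst_tm Var t = t"
  by (induction t) auto

lemma subst_tm_lift:
  "subst_tm \<sigma> (t \<up> d) = subst_tm (\<lambda>i. \<sigma> (i + d)) t"
  "(subst_tm \<sigma> t) \<up> d = subst_tm (\<lambda>i. \<sigma> i \<up> d) t"
  by (simp_all add: lift_def subst_tm_comp)

text \<open>Under a binder both substitutions are lifted, and the composite of the lifted ones is
  the lift of the composite; the quantifier cases rest on this identity.\<close>

lemma subst_comp:
  "subst \<sigma> \<rho> (subst \<tau> \<pi> \<phi>) = subst (\<lambda>i. subst_tm \<sigma> (\<tau> i)) (\<lambda>X. \<rho> (\<pi> X)) \<phi>"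
proof (induction \<phi> arbitrary: \<sigma> \<rho> \<tau> \<pi>)
  case (AllN \<phi>)
  have "(\<lambda>i. subst_tm (case_nat (Var 0) (\<lambda>i. \<sigma> i \<up> 1)) (case_nat (Var 0) (\<lambda>i. \<tau> i \<up> 1) i))
      = case_nat (Var 0) (\<lambda>i. subst_tm \<sigma> (\<tau> i) \<up> 1)"
    by (auto simp: fun_eq_iff subst_tm_lift split: nat.split)
  then show ?case
    by (simp only: subst.simps AllN.IH)
next
  case (AllS \<phi>)
  have "(\<lambda>X. case_nat 0 (\<lambda>i. Suc (\<rho> i)) (case_nat 0 (\<lambda>i. Suc (\<pi> i)) X))
      = case_nat 0 (\<lambda>i. Suc (\<rho> (\<pi> i)))"
    by (auto simp: fun_eq_iff split: nat.split)
  then show ?case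
    by (simp only: subst.simps AllS.IH)
qed (auto simp: subst_tm_comp)

lemma subst_tm_cong: "(\<And>i. i < bound_tm t \<Longrightarrow> \<sigma> i = \<tau> i) \<Longrightarrow> subst_tm \<sigma> t = subst_tm \<tau> t"
  by (induction t) auto

lemma subst_cong:
  "(\<And>i. i < boundN \<phi> \<Longrightarrow> \<sigma> i = \<tau> i) \<Longrightarrow> (\<And>i. i < boundS \<phi> \<Longrightarrow> \<rho> i = \<pi> i) \<Longrightarrow>
    subst \<sigma> \<rho> \<phi> = subst \<tau> \<pi> \<phi>"
proof (induction \<phi> arbitrary: \<sigma> \<rho> \<tau> \<pi>)
  case (AllN \<phi>)
  have "subst (case_nat (Var 0) (\<lambda>i. \<sigma> i \<up> 1)) \<rho> \<phi> = subst (case_nat (Var 0) (\<lambda>i. \<tau> i \<up> 1)) \<pi> \<phi>"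
    by (rule AllN.IH) (use AllN.prems in \<open>auto split: nat.split\<close>)
  then show ?case by simp
next
  case (AllS \<phi>)
  have "subst \<sigma> (case_nat 0 (\<lambda>i. Suc (\<rho> i))) \<phi> = subst \<tau> (case_nat 0 (\<lambda>i. Suc (\<pi> i))) \<phi>"
    by (rule AllS.IH) (use AllS.prems in \<open>auto split: nat.split\<close>)
  then show ?case by simp
next
  case (Eq t u)
  then show ?case by (auto intro!: subst_tm_cong)
next
  case (Less t u)
  then show ?case by (auto intro!: subst_tm_cong)
next
  case (Mem t X)
  then show ?case by (auto intro!: subst_tm_cong)
next
  case (Imp \<phi> \<psi>)
  have "subst \<sigma> \<rho> \<phi> = subst \<tau> \<pi> \<phi>"
    by (rule Imp.IH) (use Imp.prems in auto)
  moreover have "subst \<sigma> \<rho> \<psi> = subst \<tau> \<pi> \<psi>"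
    by (rule Imp.IH) (use Imp.prems in auto)
  ultimately show ?case by simp
qed auto

lemma case_nat_Var [simp]: "case_nat (Var 0) (\<lambda>i. Var i \<up> Suc 0) = Var"
  by (auto simp: fun_eq_iff lift_def split: nat.split)

lemma case_nat_Suc [simp]: "case_nat 0 Suc = (\<lambda>i. i)"
  by (auto simp: fun_eq_iff split: nat.split)

lemma subst_Var [simp]: "subst Var (\<lambda>X. X) \<phi> = \<phi>"
  by (induction \<phi>) auto

lemma subst_id [simp]: "subst Var id \<phi> = \<phi>"
  by (simp add: id_def)

definition closed :: "fm \<Rightarrow> bool" where
  "closed \<phi> \<longleftrightarrow> boundN \<phi> = 0 \<and> boundS \<phi> = 0"

lemma subst_closed [simp]: "closed \<phi> \<Longrightarrow> subst \<sigma> \<rho> \<phi> = \<phi>"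
  by (metis closed_def less_nat_zero_code subst_cong subst_id)

lemma bound_funpow [simp]:
  "boundN ((AllN ^^ n) \<phi>) = boundN \<phi> - n" "boundN ((AllS ^^ n) \<phi>) = boundN \<phi>"
  "boundS ((AllN ^^ n) \<phi>) = boundS \<phi>" "boundS ((AllS ^^ n) \<phi>) = boundS \<phi> - n"
  by (induction n) auto

lemma closed_univ_closure [simp]: "closed (univ_closure \<phi>)"
  by (simp add: closed_def univ_closure_def)

lemma closed_RCA0: "\<phi> \<in> RCA0 \<Longrightarrow> closed \<phi>"
  by (auto simp: RCA0_def basic_axioms_def induction_axiom_def comprehension_axiom_def Let_def)

lemma lift_simps [simp]: "bound_tm (Var i \<up> d) = i + d + 1" "Zero \<up> d = Zero" "One \<up> d = One"
  "Add t u \<up> d = Add (t \<up> d) (u \<up> d)" "Mul t u \<up> d = Mul (t \<up> d) (u \<up> d)"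
  by (simp_all add: lift_def)

lemma closed_AHT: "closed AHT"
  by (simp add: closed_def AHT_def AHT_colours_def mem_AS_def enumerates_def unbounded_def apart_def
      maps_into_def pair_def mu_eq_def lambda_eq_def binary_exponents_def seq_incr_def seq_sum_def
      beta_def pow2_def Let_def lift_def)

section \<open>Semantics and soundness\<close>

primrec eval :: "(nat \<Rightarrow> 'a) \<Rightarrow> tm \<Rightarrow> 'a::{zero,one,plus,times}" where
  "eval e (Var i) = e i"
| "eval e Zero = 0"
| "eval e One = 1"
| "eval e (Add t u) = eval e t + eval e u"
| "eval e (Mul t u) = eval e t * eval e u"

text \<open>Quantifiers range over explicit sets, so that the same clauses serve the standard model,
  the term model and the nonnegative part of an ordered ring.\<close>

primrec sat :: "'a set \<Rightarrow> 'a set set \<Rightarrow> (nat \<Rightarrow> 'a::{zero,one,plus,times,ord}) \<Rightarrow> (nat \<Rightarrow> 'a set) \<Rightarrow> fm \<Rightarrow> bool" where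
  "sat D S e s Bot = False"
| "sat D S e s (t \<^bold>= u) = (eval e t = eval e u)"
| "sat D S e s (t \<^bold>< u) = (eval e t < eval e u)"
| "sat D S e s (t \<^bold>\<in> X) = (eval e t \<in> s X)"
| "sat D S e s (\<phi> \<^bold>\<longrightarrow> \<psi>) = (sat D S e s \<phi> \<longrightarrow> sat D S e s \<psi>)"
| "sat D S e s (AllN \<phi>) = (\<forall>x\<in>D. sat D S (case_nat x e) s \<phi>)"
| "sat D S e s (AllS \<phi>) = (\<forall>X\<in>S. sat D S e (case_nat X s) \<phi>)"

lemma eval_subst_tm: "eval e (subst_tm \<sigma> t) = eval (\<lambda>i. eval e (\<sigma> i)) t"
  by (induction t) auto

lemma eval_lift [simp]: "eval e (t \<up> d) = eval (\<lambda>i. e (i + d)) t"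
  by (simp add: lift_def eval_subst_tm)

lemma sat_subst: "sat D S e s (subst \<sigma> \<rho> \<phi>) = sat D S (\<lambda>i. eval e (\<sigma> i)) (\<lambda>X. s (\<rho> X)) \<phi>"
proof (induction \<phi> arbitrary: e s \<sigma> \<rho>)
  case (AllN \<phi>)
  have "(\<lambda>i. eval (case_nat x e) (case_nat (Var 0) (\<lambda>i. \<sigma> i \<up> 1) i)) = case_nat x (\<lambda>i. eval e (\<sigma> i))" for x
    by (auto simp: fun_eq_iff split: nat.split)
  then show ?case by (simp only: subst.simps sat.simps AllN.IH)
next
  case (AllS \<phi>)
  have "(\<lambda>Y. case_nat X s (case_nat 0 (\<lambda>i. Suc (\<rho> i)) Y)) = case_nat X (\<lambda>Y. s (\<rho> Y))" for X
    by (auto simp: fun_eq_iff split: nat.split)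
  then show ?case by (simp only: subst.simps sat.simps AllS.IH)
qed (auto simp: eval_subst_tm)

lemma sat_liftN: "sat D S (case_nat x e) s (liftN \<phi>) = sat D S e s \<phi>"
  by (simp add: liftN_def sat_subst)

lemma sat_liftS: "sat D S e (case_nat X s) (liftS \<phi>) = sat D S e s \<phi>"
  by (simp add: liftS_def sat_subst)

lemma eval_case_nat: "(\<lambda>i. eval e (case_nat t Var i)) = case_nat (eval e t) e"
  by (auto simp: fun_eq_iff split: nat.split)

lemma case_nat_comp_id: "(\<lambda>Y. s (case_nat X id Y)) = case_nat (s X) s"
  by (auto simp: fun_eq_iff split: nat.split)

lemma sat_instN: "sat D S e s (instN \<phi> t) = sat D S (case_nat (eval e t) e) s \<phi>"
  by (simp add: instN_def sat_subst eval_case_nat)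

lemma sat_instS: "sat D S e s (instS \<phi> X) = sat D S e (case_nat (s X) s) \<phi>"
  by (simp add: instS_def sat_subst case_nat_comp_id)

text \<open>Serves the consistency of \<open>RCA0\<close>, where the structure is the standard one
  with all sets of numbers; hence both sorts range over \<open>UNIV\<close>.\<close>

lemma soundness:
  assumes "\<Gamma> \<turnstile> \<phi>" "\<forall>\<gamma>\<in>\<Gamma>. sat UNIV UNIV e s \<gamma>"
  shows "sat UNIV UNIV e s \<phi>"
  using assms
proof (induction arbitrary: e s)
  case (Classical \<phi> \<Gamma>)
  then show ?case by (metis insert_iff sat.simps(1,5))
qed (auto simp: sat_liftN sat_liftS sat_instN sat_instS)

definition valid :: "'a::{zero,one,plus,times,ord} set \<Rightarrow> 'a set set \<Rightarrow> fm \<Rightarrow> bool" where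
  "valid D S \<phi> \<longleftrightarrow> (\<forall>e s. range e \<subseteq> D \<and> range s \<subseteq> S \<longrightarrow> sat D S e s \<phi>)"

lemma valid_sat: "valid D S \<phi> \<Longrightarrow> range e \<subseteq> D \<Longrightarrow> range s \<subseteq> S \<Longrightarrow> sat D S e s \<phi>"
  by (simp add: valid_def)

lemma valid_AllN [simp]: "valid D S (AllN \<phi>) \<longleftrightarrow> valid D S \<phi>"
proof
  assume *: "valid D S (AllN \<phi>)"
  show "valid D S \<phi>"
    unfolding valid_def
  proof (intro allI impI)
    fix e :: "nat \<Rightarrow> 'a" and s :: "nat \<Rightarrow> 'a set"
    assume es: "range e \<subseteq> D \<and> range s \<subseteq> S"
    then have "range (\<lambda>i. e (Suc i)) \<subseteq> D" "e 0 \<in> D" by auto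
    with es * have "sat D S (case_nat (e 0) (\<lambda>i. e (Suc i))) s \<phi>" by (auto simp: valid_def)
    also have "case_nat (e 0) (\<lambda>i. e (Suc i)) = e" by (auto simp: fun_eq_iff split: nat.split)
    finally show "sat D S e s \<phi>" .
  qed
next
  assume *: "valid D S \<phi>"
  have "range (case_nat x e) \<subseteq> D" if "x \<in> D" "range e \<subseteq> D" for x and e :: "nat \<Rightarrow> 'a"
    using that by (auto simp: image_subset_iff split: nat.split)
  with * show "valid D S (AllN \<phi>)" by (auto simp: valid_def)
qed

lemma valid_AllS [simp]: "valid D S (AllS \<phi>) \<longleftrightarrow> valid D S \<phi>"
proof
  assume *: "valid D S (AllS \<phi>)"
  show "valid D S \<phi>"
    unfolding valid_def
  proof (intro allI impI)
    fix e :: "nat \<Rightarrow> 'a" and s :: "nat \<Rightarrow> 'a set"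
    assume es: "range e \<subseteq> D \<and> range s \<subseteq> S"
    then have "range (\<lambda>i. s (Suc i)) \<subseteq> S" "s 0 \<in> S" by auto
    with es * have "sat D S e (case_nat (s 0) (\<lambda>i. s (Suc i))) \<phi>" by (auto simp: valid_def)
    also have "case_nat (s 0) (\<lambda>i. s (Suc i)) = s" by (auto simp: fun_eq_iff split: nat.split)
    finally show "sat D S e s \<phi>" .
  qed
next
  assume *: "valid D S \<phi>"
  have "range (case_nat x s) \<subseteq> S" if "x \<in> S" "range s \<subseteq> S" for x and s :: "nat \<Rightarrow> 'a set"
    using that by (auto simp: image_subset_iff split: nat.split)
  with * show "valid D S (AllS \<phi>)" by (auto simp: valid_def)
qed

text \<open>Validity already ranges over all environments, so each axiom can be handled through its
  open matrix.\<close>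

lemma valid_univ_closure [simp]: "valid D S (univ_closure \<phi>) \<longleftrightarrow> valid D S \<phi>"
proof -
  have "valid D S ((AllN ^^ n) \<psi>) \<longleftrightarrow> valid D S \<psi>" for n \<psi> by (induction n) auto
  moreover have "valid D S ((AllS ^^ n) \<psi>) \<longleftrightarrow> valid D S \<psi>" for n \<psi> by (induction n) auto
  ultimately show ?thesis by (simp add: univ_closure_def)
qed

lemma sat_app:
  "sat D S e s (app \<phi> ts d) = sat D S (\<lambda>i. if i < length ts then eval e (ts ! i) else e (i - length ts + d)) s \<phi>"
  by (auto simp: app_def sat_subst intro!: arg_cong[where f="\<lambda>e. sat D S e s \<phi>"])

lemma sat_app1:
  "sat D S e s (app \<phi> [t] d) = sat D S (case_nat (eval e t) (\<lambda>i. e (i + d))) s \<phi>"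
  by (auto simp: sat_app intro!: arg_cong[where f="\<lambda>e. sat D S e s \<phi>"] split: nat.split)

lemma sat_app2:
  "sat D S e s (app \<phi> [t, u] d) = sat D S (case_nat (eval e t) (case_nat (eval e u) (\<lambda>i. e (i + d)))) s \<phi>"
  by (auto simp: sat_app less_Suc_eq intro!: arg_cong[where f="\<lambda>e. sat D S e s \<phi>"] split: nat.split)

text \<open>The second sort contains every set of numbers, so induction and comprehension hold for
  arbitrary predicates.\<close>

lemma valid_standard: "\<phi> \<in> RCA0 \<Longrightarrow> valid (UNIV :: nat set) UNIV \<phi>"
proof -
  assume "\<phi> \<in> RCA0"
  then consider "\<phi> \<in> basic_axioms" | \<psi> where "\<phi> = induction_axiom \<psi>"
    | \<psi> \<theta> where "\<phi> = comprehension_axiom \<psi> \<theta>"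
    by (auto simp: RCA0_def)
  then show ?thesis
  proof cases
    case 1
    then show ?thesis by (auto simp: basic_axioms_def Let_def) (auto simp: valid_def)
  next
    case 2
    have "P x" if "P 0" "\<forall>x. P x \<longrightarrow> P (x + 1)" for P and x :: nat
      using that by (induction x) auto
    then show ?thesis
      unfolding 2 induction_axiom_def valid_univ_closure
      by (auto simp: valid_def sat_app1)
  next
    case 3
    then show ?thesis unfolding 3 comprehension_axiom_def valid_univ_closure
      by (auto simp: valid_def sat_liftS intro!: exI[where x="{x. P x}" for P])
  qed
qed

section \<open>Completeness\<close>

lemma weaken: "\<Gamma> \<turnstile> \<phi> \<Longrightarrow> \<Gamma> \<subseteq> \<Delta> \<Longrightarrow> \<Delta> \<turnstile> \<phi>"
proof (induction arbitrary: \<Delta> rule: proves.induct)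
  case (ImpI \<phi> \<Gamma> \<psi>)
  then show ?case by (meson insert_mono proves.ImpI)
next
  case (Classical \<phi> \<Gamma>)
  then show ?case by (meson insert_mono proves.Classical)
next
  case (AllNI \<Gamma> \<phi>)
  then show ?case by (meson image_mono proves.AllNI)
next
  case (AllSI \<Gamma> \<phi>)
  then show ?case by (meson image_mono proves.AllSI)
next
  case (EqE \<Gamma> t u \<phi>)
  then show ?case by (meson proves.EqE)
qed (auto intro: proves.intros)

text \<open>Makes the union of a chain of consistent sets consistent, since a contradiction would
  already follow from one member.\<close>

lemma proves_finite: "\<Gamma> \<turnstile> \<phi> \<Longrightarrow> \<exists>\<Delta>. finite \<Delta> \<and> \<Delta> \<subseteq> \<Gamma> \<and> \<Delta> \<turnstile> \<phi>"
proof (induction rule: proves.induct)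
  case (Hyp \<phi> \<Gamma>)
  then show ?case by (intro exI[of _ "{\<phi>}"]) (auto intro: proves.Hyp)
next
  case (ImpI \<phi> \<Gamma> \<psi>)
  then obtain \<Delta> where "finite \<Delta>" "\<Delta> \<subseteq> insert \<phi> \<Gamma>" "\<Delta> \<turnstile> \<psi>" by auto
  then show ?case
    by (intro exI[of _ "\<Delta> - {\<phi>}"]) (auto intro!: proves.ImpI elim: weaken)
next
  case (ImpE \<Gamma> \<phi> \<psi>)
  then obtain \<Delta> \<Delta>' where "finite \<Delta>" "\<Delta> \<subseteq> \<Gamma>" "\<Delta> \<turnstile> \<phi> \<^bold>\<longrightarrow> \<psi>" "finite \<Delta>'" "\<Delta>' \<subseteq> \<Gamma>" "\<Delta>' \<turnstile> \<phi>" by auto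
  then show ?case
    by (intro exI[of _ "\<Delta> \<union> \<Delta>'"]) (auto intro: proves.ImpE weaken)
next
  case (Classical \<phi> \<Gamma>)
  then obtain \<Delta> where "finite \<Delta>" "\<Delta> \<subseteq> insert (\<^bold>\<not> \<phi>) \<Gamma>" "\<Delta> \<turnstile> Bot" by auto
  then show ?case
    by (intro exI[of _ "\<Delta> - {\<^bold>\<not> \<phi>}"]) (auto intro: proves.Classical[of \<phi>] elim: weaken)
next
  case (AllNI \<Gamma> \<phi>)
  then obtain \<Delta> where "finite \<Delta>" "\<Delta> \<subseteq> liftN ` \<Gamma>" "\<Delta> \<turnstile> \<phi>" by auto
  then show ?case by (metis finite_subset_image proves.AllNI)
next
  case (AllSI \<Gamma> \<phi>)
  then obtain \<Delta> where "finite \<Delta>" "\<Delta> \<subseteq> liftS ` \<Gamma>" "\<Delta> \<turnstile> \<phi>" by auto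
  then show ?case by (metis finite_subset_image proves.AllSI)
next
  case (EqE \<Gamma> t u \<phi>)
  then obtain \<Delta> \<Delta>' where "finite \<Delta>" "\<Delta> \<subseteq> \<Gamma>" "\<Delta> \<turnstile> t \<^bold>= u" "finite \<Delta>'" "\<Delta>' \<subseteq> \<Gamma>" "\<Delta>' \<turnstile> instN \<phi> t" by auto
  then show ?case
    by (intro exI[of _ "\<Delta> \<union> \<Delta>'"]) (auto intro: proves.EqE weaken)
qed (auto intro: proves.intros)

section \<open>Derivations under substitution\<close>

lemma subst_liftN: "subst (case_nat t \<sigma>) \<rho> (liftN \<phi>) = subst \<sigma> \<rho> \<phi>"
  by (simp add: liftN_def subst_comp)

lemma subst_liftS: "subst \<sigma> (case_nat X \<rho>) (liftS \<phi>) = subst \<sigma> \<rho> \<phi>"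
  by (simp add: liftS_def subst_comp)

lemma liftN_subst: "liftN (subst \<sigma> \<rho> \<phi>) = subst (\<lambda>i. \<sigma> i \<up> 1) \<rho> \<phi>"
  by (simp add: liftN_def subst_comp lift_def)

lemma liftS_subst: "liftS (subst \<sigma> \<rho> \<phi>) = subst \<sigma> (\<lambda>i. Suc (\<rho> i)) \<phi>"
  by (simp add: liftS_def subst_comp)

lemma instN_subst:
  "instN (subst (case_nat (Var 0) (\<lambda>i. \<sigma> i \<up> 1)) \<rho> \<phi>) t = subst (case_nat t \<sigma>) \<rho> \<phi>"
  by (auto simp: instN_def subst_comp subst_tm_lift intro!: subst_cong split: nat.split)

lemma instS_subst:
  "instS (subst \<sigma> (case_nat 0 (\<lambda>i. Suc (\<rho> i))) \<phi>) X = subst \<sigma> (case_nat X \<rho>) \<phi>"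
  by (auto simp: instS_def subst_comp intro!: subst_cong split: nat.split)

lemma subst_instN: "subst \<sigma> \<rho> (instN \<phi> t) = subst (case_nat (subst_tm \<sigma> t) \<sigma>) \<rho> \<phi>"
  by (auto simp: instN_def subst_comp intro!: subst_cong split: nat.split)

lemma subst_instS: "subst \<sigma> \<rho> (instS \<phi> X) = subst \<sigma> (case_nat (\<rho> X) \<rho>) \<phi>"
  by (auto simp: instS_def subst_comp intro!: subst_cong split: nat.split)

text \<open>The hypotheses are substituted too. With a suitable renaming this turns a variable that
  does not occur in them into the eigenvariable 0.\<close>

lemma proves_subst: "\<Gamma> \<turnstile> \<phi> \<Longrightarrow> subst \<sigma> \<rho> ` \<Gamma> \<turnstile> subst \<sigma> \<rho> \<phi>"
proof (induction arbitrary: \<sigma> \<rho> rule: proves.induct)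
  case (ImpI \<phi> \<Gamma> \<psi>)
  then show ?case by (auto intro!: proves.ImpI)
next
  case (ImpE \<Gamma> \<phi> \<psi>)
  then show ?case by (metis proves.ImpE subst.simps(5))
next
  case (Classical \<phi> \<Gamma>)
  then show ?case by (simp add: proves.Classical)
next
  case (AllNI \<Gamma> \<phi>)
  have "subst (case_nat (Var 0) (\<lambda>i. \<sigma> i \<up> 1)) \<rho> ` liftN ` \<Gamma> = liftN ` subst \<sigma> \<rho> ` \<Gamma>"
    by (auto simp: image_image subst_liftN liftN_subst)
  with AllNI show ?case by (metis proves.AllNI subst.simps(6))
next
  case (AllNE \<Gamma> \<phi> t)
  have "subst \<sigma> \<rho> ` \<Gamma> \<turnstile> instN (subst (case_nat (Var 0) (\<lambda>i. \<sigma> i \<up> 1)) \<rho> \<phi>) (subst_tm \<sigma> t)"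
    using AllNE by (intro proves.AllNE) auto
  then show ?case by (simp only: instN_subst subst_instN)
next
  case (AllSI \<Gamma> \<phi>)
  have "subst \<sigma> (case_nat 0 (\<lambda>i. Suc (\<rho> i))) ` liftS ` \<Gamma> = liftS ` subst \<sigma> \<rho> ` \<Gamma>"
    by (auto simp: image_image subst_liftS liftS_subst)
  with AllSI show ?case by (metis proves.AllSI subst.simps(7))
next
  case (AllSE \<Gamma> \<phi> X)
  have "subst \<sigma> \<rho> ` \<Gamma> \<turnstile> instS (subst \<sigma> (case_nat 0 (\<lambda>i. Suc (\<rho> i))) \<phi>) (\<rho> X)"
    using AllSE by (intro proves.AllSE) auto
  then show ?case by (simp only: instS_subst subst_instS)
next
  case (EqE \<Gamma> t u \<phi>)
  have "subst \<sigma> \<rho> ` \<Gamma> \<turnstile> instN (subst (case_nat (Var 0) (\<lambda>i. \<sigma> i \<up> 1)) \<rho> \<phi>) (subst_tm \<sigma> u)"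
    by (rule proves.EqE[of _ "subst_tm \<sigma> t"]) (use EqE in \<open>simp_all only: instN_subst subst_instN subst.simps\<close>)
  then show ?case by (simp only: instN_subst subst_instN)
qed (auto intro: proves.intros)

text \<open>The renaming \<open>\<sigma>\<close> moves \<open>c\<close> to 0 and shifts all other
  variables up. As \<open>c\<close> is fresh, the hypotheses are merely lifted and the instance at
  \<open>c\<close> becomes \<open>\<phi>\<close> itself, which is the premise of
  \<open>AllNI\<close>.\<close>

lemma generalizeN:
  assumes "\<Gamma> \<turnstile> instN \<phi> (Var c)" "\<forall>\<gamma>\<in>\<Gamma>. boundN \<gamma> \<le> c" "boundN \<phi> \<le> Suc c"
  shows "\<Gamma> \<turnstile> AllN \<phi>"
proof -
  define \<sigma> where "\<sigma> i = (if i = c then Var 0 else Var (Suc i))" for i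
  have "subst \<sigma> id \<gamma> = liftN \<gamma>" if "\<gamma> \<in> \<Gamma>" for \<gamma>
    unfolding liftN_def by (rule subst_cong) (use that assms in \<open>auto simp: \<sigma>_def\<close>)
  then have "subst \<sigma> id ` \<Gamma> = liftN ` \<Gamma>" by (auto simp: image_iff)
  moreover have "subst \<sigma> id (instN \<phi> (Var c)) = subst Var id \<phi>"
    unfolding subst_instN by (rule subst_cong) (use assms in \<open>auto simp: \<sigma>_def split: nat.split\<close>)
  ultimately have "liftN ` \<Gamma> \<turnstile> \<phi>"
    using proves_subst[OF assms(1), of \<sigma> id] by simp
  then show ?thesis by (rule AllNI)
qed

lemma generalizeS:
  assumes "\<Gamma> \<turnstile> instS \<phi> c" "\<forall>\<gamma>\<in>\<Gamma>. boundS \<gamma> \<le> c" "boundS \<phi> \<le> Suc c"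
  shows "\<Gamma> \<turnstile> AllS \<phi>"
proof -
  define \<rho> where "\<rho> i = (if i = c then 0 else Suc i)" for i
  have "subst Var \<rho> \<gamma> = liftS \<gamma>" if "\<gamma> \<in> \<Gamma>" for \<gamma>
    unfolding liftS_def by (rule subst_cong) (use that assms in \<open>auto simp: \<rho>_def\<close>)
  then have "subst Var \<rho> ` \<Gamma> = liftS ` \<Gamma>" by (auto simp: image_iff)
  moreover have "subst Var \<rho> (instS \<phi> c) = subst Var id \<phi>"
    unfolding subst_instS by (rule subst_cong) (use assms in \<open>auto simp: \<rho>_def split: nat.split\<close>)
  ultimately have "liftS ` \<Gamma> \<turnstile> \<phi>"
    using proves_subst[OF assms(1), of Var \<rho>] by simp
  then show ?thesis by (rule AllSI)
qed

section \<open>Consistent sets and Henkin axioms\<close>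

definition consistent :: "fm set \<Rightarrow> bool" where
  "consistent \<Gamma> \<longleftrightarrow> \<not> \<Gamma> \<turnstile> Bot"

lemma ex_falso: "\<Gamma> \<turnstile> Bot \<Longrightarrow> \<Gamma> \<turnstile> \<phi>"
  by (meson Classical subset_insertI weaken)

text \<open>A set that refutes the implication proves its premise by classical logic, hence by
  assumption its conclusion, hence the implication itself. For a Henkin axiom the assumption is
  generalization over a fresh variable.\<close>

lemma consistent_insert_Imp:
  assumes "consistent \<Gamma>" "\<Gamma> \<turnstile> \<phi> \<Longrightarrow> \<Gamma> \<turnstile> \<psi>"
  shows "consistent (insert (\<phi> \<^bold>\<longrightarrow> \<psi>) \<Gamma>)"
  unfolding consistent_def
proof
  assume "insert (\<phi> \<^bold>\<longrightarrow> \<psi>) \<Gamma> \<turnstile> Bot"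
  then have neg: "\<Gamma> \<turnstile> \<^bold>\<not> (\<phi> \<^bold>\<longrightarrow> \<psi>)" by (rule ImpI)
  have "insert \<phi> (insert (\<^bold>\<not> \<phi>) \<Gamma>) \<turnstile> \<psi>"
    by (rule ex_falso, rule ImpE[of _ \<phi>]) (auto intro: Hyp)
  then have "insert (\<^bold>\<not> \<phi>) \<Gamma> \<turnstile> Bot"
    by (meson ImpE ImpI neg subset_insertI weaken)
  with assms(2) have "\<Gamma> \<turnstile> \<psi>" using Classical by blast
  then have "\<Gamma> \<turnstile> \<phi> \<^bold>\<longrightarrow> \<psi>" by (meson ImpI subset_insertI weaken)
  with neg assms(1) show False by (meson ImpE consistent_def)
qed

lemma consistent_Union_chain:
  assumes "\<And>\<Gamma>. \<Gamma> \<in> C \<Longrightarrow> consistent \<Gamma>" "subset.chain UNIV C" "C \<noteq> {}"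
  shows "consistent (\<Union>C)"
  unfolding consistent_def
proof
  assume "\<Union>C \<turnstile> Bot"
  then obtain \<Delta> where \<Delta>: "finite \<Delta>" "\<Delta> \<subseteq> \<Union>C" "\<Delta> \<turnstile> Bot" using proves_finite by blast
  then obtain \<Gamma> where "\<Gamma> \<in> C" "\<Delta> \<subseteq> \<Gamma>"
    using finite_subset_Union_chain[OF \<Delta>(1,2) assms(3,2)] by blast
  then show False using assms(1) \<Delta>(3) by (meson consistent_def weaken)
qed

instance tm :: countable by countable_datatype
instance fm :: countable by countable_datatype

text \<open>Free variables serve as Henkin constants, since closed hypotheses leave all indices
  fresh. The sum exceeds the variables of the formulas enumerated so far, the summand
  \<open>n\<close> makes the indices strictly increasing, and one index serves both sorts.\<close>

definition henkin_var :: "nat \<Rightarrow> nat" where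
  "henkin_var n = n + (\<Sum>j\<le>n. boundN (from_nat j) + boundS (from_nat j))"

text \<open>Each implication makes the chosen variable a counterexample to the universal formula, if
  there is one.\<close>

definition henkin_axioms :: "nat \<Rightarrow> fm set" where
  "henkin_axioms n = (\<Union>j<n. {instN (from_nat j) (Var (henkin_var j)) \<^bold>\<longrightarrow> AllN (from_nat j),
    instS (from_nat j) (henkin_var j) \<^bold>\<longrightarrow> AllS (from_nat j)})"

lemma henkin_var_ge: "j \<le> n \<Longrightarrow> boundN (from_nat j) + boundS (from_nat j) \<le> henkin_var n"
  unfolding henkin_var_def by (meson atMost_iff finite_atMost le_add2 le_trans member_le_sum zero_le)

lemma henkin_var_less: "j < n \<Longrightarrow> henkin_var j < henkin_var n"
  unfolding henkin_var_def by (intro add_less_le_mono sum_mono2) auto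

lemma bound_tm_subst:
  "(\<And>i. i < bound_tm t \<Longrightarrow> bound_tm (\<sigma> i) \<le> n) \<Longrightarrow> bound_tm (subst_tm \<sigma> t) \<le> n"
  by (induction t) auto

lemma bound_lift1: "bound_tm t \<le> n \<Longrightarrow> bound_tm (t \<up> 1) \<le> Suc n"
  unfolding lift_def by (rule bound_tm_subst) auto

lemma boundN_subst:
  "(\<And>i. i < boundN \<phi> \<Longrightarrow> bound_tm (\<sigma> i) \<le> n) \<Longrightarrow> boundN (subst \<sigma> \<rho> \<phi>) \<le> n"
proof (induction \<phi> arbitrary: \<sigma> \<rho> n)
  case (AllN \<phi>)
  have "boundN (subst (case_nat (Var 0) (\<lambda>i. \<sigma> i \<up> 1)) \<rho> \<phi>) \<le> Suc n"
  proof (rule AllN.IH)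
    fix i assume "i < boundN \<phi>"
    with AllN.prems show "bound_tm (case_nat (Var 0) (\<lambda>i. \<sigma> i \<up> 1) i) \<le> Suc n"
      using bound_lift1 by (cases i) (auto simp del: One_nat_def)
  qed
  then show ?case by simp
qed (auto intro!: bound_tm_subst)

lemma boundS_subst:
  "(\<And>i. i < boundS \<phi> \<Longrightarrow> \<rho> i < n) \<Longrightarrow> boundS (subst \<sigma> \<rho> \<phi>) \<le> n"
proof (induction \<phi> arbitrary: \<sigma> \<rho> n)
  case (AllS \<phi>)
  have "boundS (subst \<sigma> (case_nat 0 (\<lambda>i. Suc (\<rho> i))) \<phi>) \<le> Suc n"
    by (rule AllS.IH) (use AllS.prems in \<open>auto split: nat.split\<close>)
  then show ?case by simp
qed (auto simp: Suc_le_eq)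

lemma bound_instN: "boundN \<phi> \<le> c \<Longrightarrow> boundS \<phi> \<le> c \<Longrightarrow>
    boundN (instN \<phi> (Var c)) \<le> Suc c \<and> boundS (instN \<phi> (Var c)) \<le> Suc c"
  unfolding instN_def by (intro conjI boundN_subst boundS_subst) (auto split: nat.split)

lemma bound_instS: "boundN \<phi> \<le> c \<Longrightarrow> boundS \<phi> \<le> c \<Longrightarrow>
    boundN (instS \<phi> c) \<le> Suc c \<and> boundS (instS \<phi> c) \<le> Suc c"
  unfolding instS_def by (intro conjI boundN_subst boundS_subst) (auto split: nat.split)

lemma henkin_axioms_bound:
  assumes "\<gamma> \<in> henkin_axioms n"
  shows "boundN \<gamma> \<le> henkin_var n \<and> boundS \<gamma> \<le> henkin_var n"
proof -
  obtain j where j: "j < n" and \<gamma>: "\<gamma> = (instN (from_nat j) (Var (henkin_var j)) \<^bold>\<longrightarrow> AllN (from_nat j))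
      \<or> \<gamma> = (instS (from_nat j) (henkin_var j) \<^bold>\<longrightarrow> AllS (from_nat j))"
    using assms by (auto simp: henkin_axioms_def)
  have "boundN (from_nat j) \<le> henkin_var j" "boundS (from_nat j) \<le> henkin_var j"
    using henkin_var_ge[of j j] by auto
  with henkin_var_less[OF j] bound_instN[of "from_nat j" "henkin_var j"] bound_instS[of "from_nat j" "henkin_var j"]
  show ?thesis using \<gamma> by auto
qed

text \<open>Earlier axioms mention only variables below \<open>henkin_var n\<close>, so this index
  is fresh in both sorts when the axioms for the next formula are added.\<close>

lemma consistent_henkin_axioms:
  assumes "consistent \<Gamma>" "\<forall>\<gamma>\<in>\<Gamma>. closed \<gamma>"
  shows "consistent (\<Gamma> \<union> henkin_axioms n)"
proof (induction n)
  case 0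
  then show ?case using assms by (simp add: henkin_axioms_def)
next
  case (Suc n)
  let ?\<Delta> = "\<Gamma> \<union> henkin_axioms n" and ?\<phi> = "from_nat n :: fm" and ?c = "henkin_var n"
  let ?h = "instN ?\<phi> (Var ?c) \<^bold>\<longrightarrow> AllN ?\<phi>" and ?k = "instS ?\<phi> ?c \<^bold>\<longrightarrow> AllS ?\<phi>"
  have c: "boundN ?\<phi> \<le> ?c" "boundS ?\<phi> \<le> ?c" using henkin_var_ge[of n n] by auto
  have bd: "\<forall>\<gamma>\<in>?\<Delta>. boundN \<gamma> \<le> ?c \<and> boundS \<gamma> \<le> ?c"
    using assms(2) henkin_axioms_bound by (auto simp: closed_def)
  have 1: "consistent (insert ?h ?\<Delta>)"
    by (rule consistent_insert_Imp[OF Suc], rule generalizeN[of _ _ ?c]) (use c bd in auto)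
  \<comment> \<open>The number axiom is now among the hypotheses. Its set variables are those of the
    formula itself, so \<open>?c\<close> is still fresh as a set index.\<close>
  have "boundS ?h \<le> ?c"
    unfolding instN_def using c by (auto intro!: boundS_subst)
  then have "consistent (insert ?k (insert ?h ?\<Delta>))"
    using bd c by (intro consistent_insert_Imp[OF 1], intro generalizeS[of _ _ ?c]) auto
  also have "insert ?k (insert ?h ?\<Delta>) = \<Gamma> \<union> henkin_axioms (Suc n)"
    by (auto simp: henkin_axioms_def lessThan_Suc)
  finally show ?case .
qed

text \<open>The last two clauses let universal formulas be decided by their instances at terms and
  set variables, as the truth lemma requires.\<close>

definition henkin :: "fm set \<Rightarrow> bool" where
  "henkin T \<longleftrightarrow> (\<forall>\<phi>. T \<turnstile> \<phi> \<longrightarrow> \<phi> \<in> T) \<and> Bot \<notin> T \<and> (\<forall>\<phi>. \<phi> \<in> T \<or> \<^bold>\<not> \<phi> \<in> T) \<and>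
    (\<forall>\<phi>. (\<forall>t. instN \<phi> t \<in> T) \<longrightarrow> AllN \<phi> \<in> T) \<and> (\<forall>\<phi>. (\<forall>X. instS \<phi> X \<in> T) \<longrightarrow> AllS \<phi> \<in> T)"

theorem henkin_extension:
  assumes "consistent \<Gamma>" "\<forall>\<gamma>\<in>\<Gamma>. closed \<gamma>"
  shows "\<exists>T. henkin T \<and> \<Gamma> \<subseteq> T"
proof -
  let ?H = "\<Union>n. \<Gamma> \<union> henkin_axioms n"
  have mono: "henkin_axioms m \<subseteq> henkin_axioms n" if "m \<le> n" for m n
    using that by (fastforce simp: henkin_axioms_def)
  have "consistent ?H"
  proof (rule consistent_Union_chain)
    show "subset.chain UNIV (range (\<lambda>n. \<Gamma> \<union> henkin_axioms n))"
      unfolding subset_chain_def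
    proof (intro conjI ballI)
      fix X Y assume "X \<in> range (\<lambda>n. \<Gamma> \<union> henkin_axioms n)" "Y \<in> range (\<lambda>n. \<Gamma> \<union> henkin_axioms n)"
      then obtain m n where "X = \<Gamma> \<union> henkin_axioms m" "Y = \<Gamma> \<union> henkin_axioms n" by auto
      then show "X \<subseteq> Y \<or> Y \<subseteq> X" using mono[of m n] mono[of n m] by (cases "m \<le> n") auto
    qed simp
  qed (use consistent_henkin_axioms[OF assms] in auto)
  define A where "A = {\<Delta>. ?H \<subseteq> \<Delta> \<and> consistent \<Delta>}"
  have "\<exists>T\<in>A. \<forall>\<Delta>\<in>A. T \<subseteq> \<Delta> \<longrightarrow> \<Delta> = T"
  proof (rule subset_Zorn_nonempty)
    show "A \<noteq> {}" using \<open>consistent ?H\<close> by (auto simp: A_def)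
    fix C assume C: "C \<noteq> {}" "subset.chain A C"
    then have "C \<subseteq> A" by (auto simp: subset.chain_def)
    then have "consistent (\<Union>C)"
      using C by (intro consistent_Union_chain) (auto simp: A_def subset.chain_def)
    moreover obtain \<Delta> where "\<Delta> \<in> C" using C(1) by blast
    then have "?H \<subseteq> \<Delta>" "\<Delta> \<subseteq> \<Union>C"
      using \<open>C \<subseteq> A\<close> unfolding A_def by blast+
    then have "?H \<subseteq> \<Union>C" by (rule subset_trans)
    ultimately show "\<Union>C \<in> A" unfolding A_def by (intro CollectI conjI)
  qed
  then obtain T where "T \<in> A" and T_max: "\<And>\<Delta>. \<Delta> \<in> A \<Longrightarrow> T \<subseteq> \<Delta> \<Longrightarrow> \<Delta> = T" by metis
  then have T: "?H \<subseteq> T" "consistent T" by (simp_all only: A_def mem_Collect_eq)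
  have max: "\<Delta> = T" if "T \<subseteq> \<Delta>" "consistent \<Delta>" for \<Delta>
    using that T(1) by (intro T_max) (simp_all only: A_def mem_Collect_eq subset_trans)
  have neg: "\<^bold>\<not> \<phi> \<in> T" if "\<phi> \<notin> T" for \<phi>
  proof (rule ccontr)
    assume "\<^bold>\<not> \<phi> \<notin> T"
    then have "\<not> consistent (insert (\<^bold>\<not> \<phi>) T)" "\<not> consistent (insert \<phi> T)"
      using max that by blast+
    then have "T \<turnstile> \<phi>" "T \<turnstile> \<^bold>\<not> \<phi>" by (auto simp: consistent_def intro: Classical ImpI)
    then show False using T(2) by (meson ImpE consistent_def)
  qed
  have ded: "\<phi> \<in> T" if "T \<turnstile> \<phi>" for \<phi>
    using that neg T(2) by (meson ImpE Hyp consistent_def)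
  \<comment> \<open>Among the instances is the one at the Henkin variable of \<open>\<phi>\<close>,
    to which the corresponding axiom applies.\<close>
  have hN: "AllN \<phi> \<in> T" if "\<forall>t. instN \<phi> t \<in> T" for \<phi>
  proof -
    obtain j where "\<phi> = from_nat j" by (metis from_nat_to_nat)
    moreover have "(instN (from_nat j) (Var (henkin_var j)) \<^bold>\<longrightarrow> AllN (from_nat j)) \<in> henkin_axioms (Suc j)"
      by (auto simp: henkin_axioms_def)
    ultimately show ?thesis using that T(1) ded by (meson ImpE Hyp UN_I UNIV_I UnI2 subsetD)
  qed
  have hS: "AllS \<phi> \<in> T" if "\<forall>t. instS \<phi> t \<in> T" for \<phi>
  proof -
    obtain j where "\<phi> = from_nat j" by (metis from_nat_to_nat)
    moreover have "(instS (from_nat j) (henkin_var j) \<^bold>\<longrightarrow> AllS (from_nat j)) \<in> henkin_axioms (Suc j)"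
      by (auto simp: henkin_axioms_def)
    ultimately show ?thesis using that T(1) ded by (meson ImpE Hyp UN_I UNIV_I UnI2 subsetD)
  qed
  have "henkin T"
    unfolding henkin_def using ded neg hN hS T(2) by (meson Hyp consistent_def)
  with T(1) show ?thesis by auto
qed

section \<open>Models of RCA and their bounded predicates\<close>

lemma subst_tm_lift1:
  "subst_tm (case_nat (Var 0) (\<lambda>i. \<sigma> i \<up> Suc 0)) (t \<up> Suc 0) = subst_tm \<sigma> t \<up> Suc 0"
  by (simp add: subst_tm_lift)

lemma Delta00_subst: "\<phi> \<in> Delta00 \<Longrightarrow> subst \<sigma> \<rho> \<phi> \<in> Delta00"
proof (induction arbitrary: \<sigma> \<rho> rule: Delta00.induct)
  case (6 \<phi> t)
  show ?case
    using Delta00.intros(6)[OF "6.IH"[of "case_nat (Var 0) (\<lambda>i. \<sigma> i \<up> Suc 0)" \<rho>], of "subst_tm \<sigma> t"]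
    by (simp add: subst_tm_lift1)
next
  case (7 \<phi> t)
  show ?case
    using Delta00.intros(7)[OF "7.IH"[of "case_nat (Var 0) (\<lambda>i. \<sigma> i \<up> Suc 0)" \<rho>], of "subst_tm \<sigma> t"]
    by (simp add: subst_tm_lift1)
qed (auto intro: Delta00.intros)

locale model =
  fixes D :: "'a::{zero,one,plus,times,ord} set" and S :: "'a set set"
    and p :: "nat \<Rightarrow> 'a" and s :: "nat \<Rightarrow> 'a set"
  assumes range_p: "range p = D" and range_s: "range s = S"
    and zero_D: "0 \<in> D" and one_D: "1 \<in> D"
    and add_D: "x \<in> D \<Longrightarrow> y \<in> D \<Longrightarrow> x + y \<in> D"
    and mult_D: "x \<in> D \<Longrightarrow> y \<in> D \<Longrightarrow> x * y \<in> D"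
    and valid_RCA0: "\<phi> \<in> RCA0 \<Longrightarrow> valid D S \<phi>"
begin

text \<open>In an environment with \<open>m\<close> live variables, all later variables enumerate the domain and all
  set variables enumerate the sets of the model. As \<open>p\<close> and \<open>s\<close> are onto, every parameter is
  denoted by a variable, and binding a variable merely turns \<open>m\<close> into \<open>Suc m\<close>.\<close>

definition env :: "nat \<Rightarrow> (nat \<Rightarrow> 'a) \<Rightarrow> nat \<Rightarrow> 'a" where
  "env m e i = (if i < m then e i else p (i - m))"

definition Tm :: "nat \<Rightarrow> ((nat \<Rightarrow> 'a) \<Rightarrow> 'a) \<Rightarrow> bool" where
  "Tm m t \<longleftrightarrow> (\<exists>\<tau>. \<forall>e. range e \<subseteq> D \<longrightarrow> t e = eval (env m e) \<tau>)"

text \<open>Definability by a bounded formula with parameters, where the entries of \<open>e\<close>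
  below \<open>m\<close> are the live variables. Predicates of the metalanguage are shown bounded by
  introduction rules, without writing their formulas.\<close>

definition D0 :: "nat \<Rightarrow> ((nat \<Rightarrow> 'a) \<Rightarrow> bool) \<Rightarrow> bool" where
  "D0 m P \<longleftrightarrow> (\<exists>\<phi>\<in>Delta00. \<forall>e. range e \<subseteq> D \<longrightarrow> P e = sat D S (env m e) s \<phi>)"

definition S1 :: "nat \<Rightarrow> ((nat \<Rightarrow> 'a) \<Rightarrow> bool) \<Rightarrow> bool" where
  "S1 m P \<longleftrightarrow> (\<exists>\<phi>\<in>Sigma0 1. \<forall>e. range e \<subseteq> D \<longrightarrow> P e = sat D S (env m e) s \<phi>)"

lemma env_D: "range e \<subseteq> D \<Longrightarrow> range (env m e) \<subseteq> D"
  using range_p by (auto simp: env_def)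

lemma env_Suc: "env (Suc m) (case_nat x e) = case_nat x (env m e)"
  by (auto simp: env_def fun_eq_iff split: nat.split)

lemma case_nat_D: "x \<in> D \<Longrightarrow> range e \<subseteq> D \<Longrightarrow> range (case_nat x e) \<subseteq> D"
  by (auto simp: image_subset_iff split: nat.split)

lemma eval_D: "range e \<subseteq> D \<Longrightarrow> eval e \<tau> \<in> D"
  by (induction \<tau>) (auto simp: zero_D one_D add_D mult_D)

lemma Tm_D: "Tm m t \<Longrightarrow> range e \<subseteq> D \<Longrightarrow> t e \<in> D"
  using env_D eval_D by (auto simp: Tm_def)

lemma Tm_var: "i < m \<Longrightarrow> Tm m (\<lambda>e. e i)"
  unfolding Tm_def by (rule exI[of _ "Var i"]) (simp add: env_def)

lemma Tm_const: "c \<in> D \<Longrightarrow> Tm m (\<lambda>e. c)"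
proof -
  assume "c \<in> D"
  then obtain i where "c = p i" using range_p by auto
  then show ?thesis unfolding Tm_def by (intro exI[of _ "Var (m + i)"]) (simp add: env_def)
qed

lemma Tm_add: "Tm m t \<Longrightarrow> Tm m u \<Longrightarrow> Tm m (\<lambda>e. t e + u e)"
  unfolding Tm_def by (metis eval.simps(4))

lemma Tm_mult: "Tm m t \<Longrightarrow> Tm m u \<Longrightarrow> Tm m (\<lambda>e. t e * u e)"
  unfolding Tm_def by (metis eval.simps(5))

section \<open>Closure properties of bounded predicates\<close>

lemma D0_eq: "Tm m t \<Longrightarrow> Tm m u \<Longrightarrow> D0 m (\<lambda>e. t e = u e)"
  unfolding Tm_def D0_def by (metis sat.simps(2) Delta00.intros(2))

lemma D0_less: "Tm m t \<Longrightarrow> Tm m u \<Longrightarrow> D0 m (\<lambda>e. t e < u e)"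
  unfolding Tm_def D0_def by (metis sat.simps(3) Delta00.intros(3))

lemma D0_mem: "X \<in> S \<Longrightarrow> Tm m t \<Longrightarrow> D0 m (\<lambda>e. t e \<in> X)"
  unfolding Tm_def D0_def using range_s by (metis imageE sat.simps(4) Delta00.intros(4))

lemma D0_imp: "D0 m P \<Longrightarrow> D0 m Q \<Longrightarrow> D0 m (\<lambda>e. P e \<longrightarrow> Q e)"
  unfolding D0_def by (metis sat.simps(5) Delta00.intros(5))

lemma D0_False: "D0 m (\<lambda>e. False)"
  unfolding D0_def by (metis sat.simps(1) Delta00.intros(1))

lemma D0_not: "D0 m P \<Longrightarrow> D0 m (\<lambda>e. \<not> P e)"
  using D0_imp[OF _ D0_False] by auto

lemma D0_const: "D0 m (\<lambda>e. b)"
  using D0_False D0_not[OF D0_False] by (cases b) auto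

lemma D0_disj: "D0 m P \<Longrightarrow> D0 m Q \<Longrightarrow> D0 m (\<lambda>e. P e \<or> Q e)"
  using D0_imp[OF D0_not] by (auto simp: disj_imp)

lemma D0_conj: "D0 m P \<Longrightarrow> D0 m Q \<Longrightarrow> D0 m (\<lambda>e. P e \<and> Q e)"
  using D0_not[OF D0_imp[OF _ D0_not]] by auto

lemma D0_all:
  assumes "Tm m t" "D0 (Suc m) (\<lambda>e. P (e 0) (\<lambda>i. e (Suc i)))"
  shows "D0 m (\<lambda>e. \<forall>x\<in>D. x < t e \<longrightarrow> P x e)"
proof -
  obtain \<tau> where \<tau>: "\<And>e. range e \<subseteq> D \<Longrightarrow> t e = eval (env m e) \<tau>"
    using assms(1) by (auto simp: Tm_def)
  obtain \<phi> where \<phi>: "\<phi> \<in> Delta00"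
      "\<And>e. range e \<subseteq> D \<Longrightarrow> P (e 0) (\<lambda>i. e (Suc i)) = sat D S (env (Suc m) e) s \<phi>"
    using assms(2) unfolding D0_def by blast
  have "P x e = sat D S (case_nat x (env m e)) s \<phi>" if "range e \<subseteq> D" "x \<in> D" for x e
    using \<phi>(2)[OF case_nat_D[OF that(2,1)]] by (simp add: env_Suc)
  then show ?thesis
    unfolding D0_def using Delta00.intros(6)[OF \<phi>(1), of \<tau>] \<tau>
    by (auto intro!: bexI[of _ "AllN (Var 0 \<^bold>< \<tau> \<up> 1 \<^bold>\<longrightarrow> \<phi>)"])
qed

lemma D0_ex:
  assumes "Tm m t" "D0 (Suc m) (\<lambda>e. P (e 0) (\<lambda>i. e (Suc i)))"
  shows "D0 m (\<lambda>e. \<exists>x\<in>D. x < t e \<and> P x e)"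
  using D0_not[OF D0_all[OF assms(1) D0_not[OF assms(2)]]] by auto

text \<open>A dummy quantifier is prefixed, because \<open>Sigma0 1\<close> consists of formulas
  that begin with an existential quantifier.\<close>

lemma S1_D0: assumes "D0 m P" shows "S1 m P"
proof -
  obtain \<phi> where \<phi>: "\<phi> \<in> Delta00" "\<And>e. range e \<subseteq> D \<Longrightarrow> P e = sat D S (env m e) s \<phi>"
    using assms unfolding D0_def by blast
  have "ExN (liftN \<phi>) \<in> Sigma0 1"
    using \<phi>(1) by (auto simp: liftN_def Delta00_subst)
  then show ?thesis
    unfolding S1_def using zero_D \<phi>(2) by (intro bexI[of _ "ExN (liftN \<phi>)"]) (auto simp: sat_liftN)
qed

text \<open>The matrix has to be bounded: several unbounded witnesses must be gathered below a
  single one before this rule applies.\<close>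

lemma S1_ex:
  assumes "D0 (Suc m) (\<lambda>e. P (e 0) (\<lambda>i. e (Suc i)))"
  shows "S1 m (\<lambda>e. \<exists>x\<in>D. P x e)"
proof -
  obtain \<phi> where \<phi>: "\<phi> \<in> Delta00"
      "\<And>e. range e \<subseteq> D \<Longrightarrow> P (e 0) (\<lambda>i. e (Suc i)) = sat D S (env (Suc m) e) s \<phi>"
    using assms unfolding D0_def by blast
  have "P x e = sat D S (case_nat x (env m e)) s \<phi>" if "range e \<subseteq> D" "x \<in> D" for x e
    using \<phi>(2)[OF case_nat_D[OF that(2,1)]] by (simp add: env_Suc)
  then show ?thesis
    unfolding S1_def by (intro bexI[of _ "ExN \<phi>"]) (use \<phi>(1) in simp_all)
qed

lemmas D0I = Tm_var Tm_const Tm_add Tm_mult D0_eq D0_less D0_mem D0_imp D0_not D0_disj D0_conj D0_const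

lemma D0_sat:
  assumes "\<phi> \<in> Delta00" "\<And>i. Tm m (F i)" "\<And>X. r X \<in> S"
  shows "D0 m (\<lambda>e. sat D S (\<lambda>i. F i e) r \<phi>)"
proof -
  obtain \<sigma> where \<sigma>: "\<And>i e. range e \<subseteq> D \<Longrightarrow> F i e = eval (env m e) (\<sigma> i)"
  proof -
    have "\<forall>i. \<exists>\<tau>. \<forall>e. range e \<subseteq> D \<longrightarrow> F i e = eval (env m e) \<tau>"
      using assms(2) unfolding Tm_def by blast
    then obtain \<sigma> where "\<forall>i e. range e \<subseteq> D \<longrightarrow> F i e = eval (env m e) (\<sigma> i)" by metis
    then show ?thesis using that by blast
  qed
  obtain \<rho> where \<rho>: "\<And>X. r X = s (\<rho> X)"
  proof -
    have "\<forall>X. \<exists>Y. r X = s Y" using assms(3) range_s by blast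
    then show ?thesis using that by metis
  qed
  show ?thesis
    unfolding D0_def using assms(1)
    by (intro bexI[of _ "subst \<sigma> \<rho> \<phi>"]) (auto simp: sat_subst Delta00_subst \<sigma> \<rho>[abs_def])
qed

text \<open>Lets a notion be shown bounded once, for variables, and then be used for arbitrary
  terms. Indices from \<open>k\<close> on denote parameters and are replaced by the corresponding
  constants.\<close>

lemma D0_subst:
  assumes "D0 k P" "\<And>i. Tm m (F i)"
  shows "D0 m (\<lambda>e. P (\<lambda>i. F i e))"
proof -
  obtain \<phi> where \<phi>: "\<phi> \<in> Delta00" "\<And>e. range e \<subseteq> D \<Longrightarrow> P e = sat D S (env k e) s \<phi>"
    using assms(1) unfolding D0_def by blast
  have "p i \<in> D" for i using range_p by auto
  then have "D0 m (\<lambda>e. sat D S (\<lambda>i. (if i < k then F i else (\<lambda>e. p (i - k))) e) s \<phi>)"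
    using range_s assms(2) by (intro D0_sat \<phi>(1)) (auto intro: Tm_const)
  moreover have "(\<lambda>i. (if i < k then F i else (\<lambda>e. p (i - k))) e) = env k (\<lambda>i. F i e)" for e
    by (auto simp: env_def fun_eq_iff)
  moreover have "P (\<lambda>i. F i e) = sat D S (env k (\<lambda>i. F i e)) s \<phi>" if "range e \<subseteq> D" for e
    using Tm_D[OF assms(2) that] by (intro \<phi>(2)) auto
  ultimately show ?thesis
    by (simp add: D0_def)
qed

lemma D0_comp1: "D0 1 (\<lambda>e. P (e 0)) \<Longrightarrow> Tm m t \<Longrightarrow> D0 m (\<lambda>e. P (t e))"
  by (drule D0_subst[where F="\<lambda>_. t"])

lemma D0_comp2: "D0 2 (\<lambda>e. P (e 0) (e 1)) \<Longrightarrow> Tm m t \<Longrightarrow> Tm m u \<Longrightarrow> D0 m (\<lambda>e. P (t e) (u e))"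
  by (drule D0_subst[where F="\<lambda>i. if i = 0 then t else u" and m=m]) auto

lemma D0_comp3: "D0 3 (\<lambda>e. P (e 0) (e 1) (e 2)) \<Longrightarrow> Tm m t \<Longrightarrow> Tm m u \<Longrightarrow> Tm m v \<Longrightarrow>
    D0 m (\<lambda>e. P (t e) (u e) (v e))"
  by (drule D0_subst[where F="\<lambda>i. if i = 0 then t else if i = 1 then u else v" and m=m]) auto

lemma D0_comp4: "D0 4 (\<lambda>e. P (e 0) (e 1) (e 2) (e 3)) \<Longrightarrow> Tm m t \<Longrightarrow> Tm m u \<Longrightarrow> Tm m v \<Longrightarrow>
    Tm m w \<Longrightarrow> D0 m (\<lambda>e. P (t e) (u e) (v e) (w e))"
  by (drule D0_subst[where F="\<lambda>i. if i = 0 then t else if i = 1 then u else if i = 2 then v else w"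
      and m=m]) auto

section \<open>The axioms as statements about definable predicates\<close>

lemma env_1: "env (Suc 0) (\<lambda>_. x) = case_nat x p"
  by (auto simp: env_def fun_eq_iff split: nat.split)

lemma induction:
  assumes "S1 1 (\<lambda>e. P (e 0))" "P 0" "\<And>x. x \<in> D \<Longrightarrow> P x \<Longrightarrow> P (x + 1)" "x \<in> D"
  shows "P x"
proof -
  obtain \<phi> where \<phi>: "\<phi> \<in> Sigma0 1" "\<And>e. range e \<subseteq> D \<Longrightarrow> P (e 0) = sat D S (env 1 e) s \<phi>"
    using assms(1) unfolding S1_def by blast
  have P: "P x = sat D S (case_nat x p) s \<phi>" if "x \<in> D" for x
    using \<phi>(2)[of "\<lambda>_. x"] that by (auto simp: env_1)
  have "valid D S (induction_axiom \<phi>)"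
    using \<phi>(1) by (intro valid_RCA0) (simp add: RCA0_def)
  then have ax: "sat D S p s (app \<phi> [Zero] 0 \<^bold>\<and> AllN (app \<phi> [Var 0] 1 \<^bold>\<longrightarrow> app \<phi> [Add (Var 0) One] 1)
      \<^bold>\<longrightarrow> AllN (app \<phi> [Var 0] 1))"
    unfolding induction_axiom_def valid_univ_closure
    by (rule valid_sat) (simp_all add: range_p range_s)
  have "sat D S p s (app \<phi> [Zero] 0) = P 0"
    by (simp add: sat_app1 P[OF zero_D])
  moreover have "sat D S (case_nat x p) s (app \<phi> [Var 0] 1) = P x" if "x \<in> D" for x
    by (simp add: sat_app1 P[OF that])
  moreover have "sat D S (case_nat x p) s (app \<phi> [Add (Var 0) One] 1) = P (x + 1)" if "x \<in> D" for x
    by (simp add: sat_app1 P[OF add_D[OF that one_D]])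
  ultimately show ?thesis
    using ax assms(2-4) unfolding sat.simps by blast
qed

text \<open>With a dummy quantifier of either kind a bounded formula becomes both Sigma-1 and Pi-1,
  so the equivalence demanded by the axiom is trivial.\<close>

lemma comprehension:
  assumes "D0 1 (\<lambda>e. P (e 0))"
  shows "\<exists>X\<in>S. \<forall>x\<in>D. x \<in> X \<longleftrightarrow> P x"
proof -
  obtain \<phi> where \<phi>: "\<phi> \<in> Delta00" "\<And>e. range e \<subseteq> D \<Longrightarrow> P (e 0) = sat D S (env 1 e) s \<phi>"
    using assms(1) unfolding D0_def by blast
  have P: "P x = sat D S (case_nat x p) s \<phi>" if "x \<in> D" for x
    using \<phi>(2)[of "\<lambda>_. x"] that by (auto simp: env_1)
  have "liftN \<phi> \<in> Delta00" by (simp add: liftN_def Delta00_subst \<phi>(1))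
  then have "valid D S (comprehension_axiom (ExN (liftN \<phi>)) (AllN (liftN \<phi>)))"
    by (intro valid_RCA0) (auto simp: RCA0_def)
  then have "sat D S p s (AllN (ExN (liftN \<phi>) \<^bold>\<longleftrightarrow> AllN (liftN \<phi>)) \<^bold>\<longrightarrow>
      ExS (AllN (Var 0 \<^bold>\<in> 0 \<^bold>\<longleftrightarrow> liftS (ExN (liftN \<phi>)))))"
    unfolding comprehension_axiom_def valid_univ_closure
    by (rule valid_sat) (simp_all add: range_p range_s)
  then have "\<exists>X\<in>S. \<forall>x\<in>D. x \<in> X \<longleftrightarrow> sat D S (case_nat x p) s \<phi>"
    using zero_D by (auto simp: sat_liftN sat_liftS)
  then show ?thesis using P by blast
qed

lemma basic_axioms_hold:
  assumes "x \<in> D" "y \<in> D"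
  shows "x + 1 \<noteq> 0" "x + 1 = y + 1 \<Longrightarrow> x = y" "x + 0 = x" "x + (y + 1) = (x + y) + 1"
    "x * 0 = 0" "x * (y + 1) = x * y + x" "\<not> x < 0" "x < y + 1 \<longleftrightarrow> x < y \<or> x = y"
proof -
  have *: "sat D S (case_nat y (case_nat x p)) s \<phi>" if "univ_closure \<phi> \<in> basic_axioms" for \<phi>
  proof -
    have "valid D S \<phi>"
      using that valid_RCA0[of "univ_closure \<phi>"] by (simp add: RCA0_def)
    then show ?thesis
      using assms range_s range_p by (intro valid_sat case_nat_D) auto
  qed
  note ax = basic_axioms_def Let_def
  show "x + 1 = y + 1 \<Longrightarrow> x = y" using *[of "Add (Var 1) One \<^bold>= Add (Var 0) One \<^bold>\<longrightarrow> Var 1 \<^bold>= Var 0"]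
    by (simp add: ax)
  show "x + 0 = x" using *[of "Add (Var 1) Zero \<^bold>= Var 1"] by (simp add: ax)
  show "x + (y + 1) = (x + y) + 1"
    using *[of "Add (Var 1) (Add (Var 0) One) \<^bold>= Add (Add (Var 1) (Var 0)) One"] by (simp add: ax)
  show "x * 0 = 0" using *[of "Mul (Var 1) Zero \<^bold>= Zero"] by (simp add: ax)
  show "x * (y + 1) = x * y + x"
    using *[of "Mul (Var 1) (Add (Var 0) One) \<^bold>= Add (Mul (Var 1) (Var 0)) (Var 1)"] by (simp add: ax)
  show "\<not> x < 0" using *[of "\<^bold>\<not> Var 1 \<^bold>< Zero"] by (simp add: ax)
  show "x < y + 1 \<longleftrightarrow> x < y \<or> x = y"
    using *[of "Var 1 \<^bold>< Add (Var 0) One \<^bold>\<longleftrightarrow> Var 1 \<^bold>< Var 0 \<^bold>\<or> Var 1 \<^bold>= Var 0"] by (auto simp: ax)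
next
  have "valid D S (\<^bold>\<not> Add (Var 0) One \<^bold>= Zero)"
    using valid_RCA0[of "univ_closure (\<^bold>\<not> Add (Var 0) One \<^bold>= Zero)"]
    by (simp add: RCA0_def basic_axioms_def Let_def)
  then have "sat D S (case_nat x p) s (\<^bold>\<not> Add (Var 0) One \<^bold>= Zero)"
    using assms range_s range_p by (intro valid_sat case_nat_D) auto
  then show "x + 1 \<noteq> 0" by simp
qed

end

section \<open>The term model\<close>

text \<open>A type cannot depend on the hypotheses of a proof, so the countermodel is a global constant. It
  is well defined even if there is no counterexample, since RCA is consistent.\<close>

definition Th :: "fm set" where
  "Th = (SOME T. henkin T \<and> RCA0 \<subseteq> T \<and>
    ((\<exists>\<phi>\<in>BSigma0 3. \<not> RCA0 \<union> {AHT} \<turnstile> \<phi>) \<longrightarrow> AHT \<in> T \<and> (\<exists>\<phi>\<in>BSigma0 3. \<phi> \<notin> T)))"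

lemma consistent_RCA0: "consistent RCA0"
  unfolding consistent_def
proof
  assume "RCA0 \<turnstile> Bot"
  moreover have "sat UNIV UNIV e s \<gamma>" if "\<gamma> \<in> RCA0" for \<gamma> and e :: "nat \<Rightarrow> nat" and s
    using valid_standard[OF that] by (simp add: valid_def)
  ultimately show False using soundness by (metis sat.simps(1))
qed

lemma Th: "henkin Th" "RCA0 \<subseteq> Th"
  "\<phi> \<in> BSigma0 3 \<Longrightarrow> \<not> RCA0 \<union> {AHT} \<turnstile> \<phi> \<Longrightarrow> AHT \<in> Th \<and> (\<exists>\<psi>\<in>BSigma0 3. \<psi> \<notin> Th)"
proof -
  have "\<exists>T. henkin T \<and> RCA0 \<subseteq> T \<and>
    ((\<exists>\<phi>\<in>BSigma0 3. \<not> RCA0 \<union> {AHT} \<turnstile> \<phi>) \<longrightarrow> AHT \<in> T \<and> (\<exists>\<phi>\<in>BSigma0 3. \<phi> \<notin> T))"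
  proof (cases "\<exists>\<phi>\<in>BSigma0 3. \<not> RCA0 \<union> {AHT} \<turnstile> \<phi>")
    case False
    then show ?thesis using henkin_extension[OF consistent_RCA0] closed_RCA0 by blast
  next
    case True
    then obtain \<phi> where \<phi>: "\<phi> \<in> BSigma0 3" "\<not> RCA0 \<union> {AHT} \<turnstile> \<phi>" by blast
    then have "consistent (insert (\<^bold>\<not> \<phi>) (RCA0 \<union> {AHT}))"
      unfolding consistent_def using Classical by blast
    moreover have "closed (\<^bold>\<not> \<phi>)"
      using \<phi>(1) closed_univ_closure by (auto simp: BSigma0_def bounding_axiom_def closed_def)
    ultimately obtain T where T: "henkin T" "insert (\<^bold>\<not> \<phi>) (RCA0 \<union> {AHT}) \<subseteq> T"
      using henkin_extension[of "insert (\<^bold>\<not> \<phi>) (RCA0 \<union> {AHT})"] closed_RCA0 closed_AHT by blast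
    then have "\<phi> \<notin> T" unfolding henkin_def by (meson ImpE Hyp insert_subset)
    with T \<phi>(1) show ?thesis by (metis Un_insert_right insert_subset sup_bot_right)
  qed
  from someI_ex[OF this, folded Th_def]
  show "henkin Th" "RCA0 \<subseteq> Th"
    "\<phi> \<in> BSigma0 3 \<Longrightarrow> \<not> RCA0 \<union> {AHT} \<turnstile> \<phi> \<Longrightarrow> AHT \<in> Th \<and> (\<exists>\<psi>\<in>BSigma0 3. \<psi> \<notin> Th)"
    by blast+
qed

section \<open>The Henkin set as a truth predicate\<close>

lemma Th_deductive: "Th \<turnstile> \<phi> \<Longrightarrow> \<phi> \<in> Th"
  using Th(1) by (simp add: henkin_def)

lemma Th_Bot: "Bot \<notin> Th"
  using Th(1) by (simp add: henkin_def)

lemma Th_Imp: "\<phi> \<^bold>\<longrightarrow> \<psi> \<in> Th \<longleftrightarrow> (\<phi> \<in> Th \<longrightarrow> \<psi> \<in> Th)"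
proof -
  have "\<phi> \<in> Th \<or> \<^bold>\<not> \<phi> \<in> Th" using Th(1) by (simp add: henkin_def)
  moreover have "\<phi> \<^bold>\<longrightarrow> \<psi> \<in> Th" if "\<^bold>\<not> \<phi> \<in> Th"
    by (rule Th_deductive, rule ImpI, rule ex_falso, rule ImpE[of _ \<phi>]) (use that in \<open>auto intro: Hyp\<close>)
  moreover have "\<phi> \<^bold>\<longrightarrow> \<psi> \<in> Th" if "\<psi> \<in> Th"
    by (rule Th_deductive, rule ImpI, rule Hyp) (use that in simp)
  ultimately show ?thesis by (meson Hyp ImpE Th_deductive)
qed

lemma Th_AllN: "AllN \<phi> \<in> Th \<longleftrightarrow> (\<forall>t. instN \<phi> t \<in> Th)"
  using Th(1) unfolding henkin_def by (meson AllNE Hyp)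

lemma Th_AllS: "AllS \<phi> \<in> Th \<longleftrightarrow> (\<forall>X. instS \<phi> X \<in> Th)"
  using Th(1) unfolding henkin_def by (meson AllSE Hyp)

lemma Th_refl: "(t \<^bold>= t) \<in> Th"
  by (intro Th_deductive EqI)

lemma Th_subst: "(t \<^bold>= u) \<in> Th \<Longrightarrow> instN \<phi> t \<in> Th \<Longrightarrow> instN \<phi> u \<in> Th"
  by (meson EqE Hyp Th_deductive)

lemma instN_simps [simp]:
  "instN (t \<up> Suc 0 \<^bold>= u \<up> Suc 0) v = (t \<^bold>= u)"
  "instN (Var 0 \<^bold>= u \<up> Suc 0) v = (v \<^bold>= u)"
  "instN (t \<up> Suc 0 \<^bold>= Var 0) v = (t \<^bold>= v)"
  by (simp_all add: instN_def subst_tm_lift)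

lemma Th_sym: "(t \<^bold>= u) \<in> Th \<Longrightarrow> (u \<^bold>= t) \<in> Th"
  using Th_subst[of t u "Var 0 \<^bold>= t \<up> Suc 0"] Th_refl by simp

lemma Th_trans: "(t \<^bold>= u) \<in> Th \<Longrightarrow> (u \<^bold>= v) \<in> Th \<Longrightarrow> (t \<^bold>= v) \<in> Th"
  using Th_subst[of u v "t \<up> Suc 0 \<^bold>= Var 0"] by simp

lemma Th_Add: "(t \<^bold>= t') \<in> Th \<Longrightarrow> (u \<^bold>= u') \<in> Th \<Longrightarrow> (Add t u \<^bold>= Add t' u') \<in> Th"
  using Th_subst[of t t' "Add t u \<up> Suc 0 \<^bold>= Add (Var 0) (u \<up> Suc 0)"]
    Th_subst[of u u' "Add t u \<up> Suc 0 \<^bold>= Add (t' \<up> Suc 0) (Var 0)"] Th_refl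
  by (simp add: instN_def subst_tm_lift del: lift_simps)

lemma Th_Mul: "(t \<^bold>= t') \<in> Th \<Longrightarrow> (u \<^bold>= u') \<in> Th \<Longrightarrow> (Mul t u \<^bold>= Mul t' u') \<in> Th"
  using Th_subst[of t t' "Mul t u \<up> Suc 0 \<^bold>= Mul (Var 0) (u \<up> Suc 0)"]
    Th_subst[of u u' "Mul t u \<up> Suc 0 \<^bold>= Mul (t' \<up> Suc 0) (Var 0)"] Th_refl
  by (simp add: instN_def subst_tm_lift del: lift_simps)

lemma Th_Less: "(t \<^bold>= t') \<in> Th \<Longrightarrow> (u \<^bold>= u') \<in> Th \<Longrightarrow> (t \<^bold>< u) \<in> Th \<Longrightarrow> (t' \<^bold>< u') \<in> Th"
  using Th_subst[of t t' "Var 0 \<^bold>< u \<up> Suc 0"] Th_subst[of u u' "t' \<up> Suc 0 \<^bold>< Var 0"]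
  by (simp add: instN_def subst_tm_lift)

lemma Th_Mem: "(t \<^bold>= t') \<in> Th \<Longrightarrow> (t \<^bold>\<in> X) \<in> Th \<Longrightarrow> (t' \<^bold>\<in> X) \<in> Th"
  using Th_subst[of t t' "Var 0 \<^bold>\<in> X"] by (simp add: instN_def)

\<comment> \<open>Terms may contain variables, so the Henkin variables denote elements of the
  quotient.\<close>
quotient_type num = tm / "\<lambda>t u. (t \<^bold>= u) \<in> Th"
  by (rule equivpI) (auto intro!: reflpI sympI transpI intro: Th_refl Th_sym Th_trans)

instantiation num :: "{zero,one,plus,times,ord}"
begin

lift_definition zero_num :: num is Zero .
lift_definition one_num :: num is One .
lift_definition plus_num :: "num \<Rightarrow> num \<Rightarrow> num" is Add by (rule Th_Add)
lift_definition times_num :: "num \<Rightarrow> num \<Rightarrow> num" is Mul by (rule Th_Mul)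
lift_definition less_num :: "num \<Rightarrow> num \<Rightarrow> bool" is "\<lambda>t u. (t \<^bold>< u) \<in> Th"
  using Th_Less Th_sym by blast
definition less_eq_num :: "num \<Rightarrow> num \<Rightarrow> bool" where "x \<le> y \<longleftrightarrow> x < y \<or> x = (y :: num)"

instance ..

end

text \<open>The sets of the model come from set variables. Variables with the same members yield the
  same set, in keeping with the absence of primitive equality between sets.\<close>

definition num_set :: "nat \<Rightarrow> num set" where
  "num_set X = {abs_num t | t. (t \<^bold>\<in> X) \<in> Th}"

lemma mem_num_set: "abs_num t \<in> num_set X \<longleftrightarrow> (t \<^bold>\<in> X) \<in> Th"
  unfolding num_set_def by (auto simp: num.abs_eq_iff intro: Th_Mem Th_sym Th_refl)

lemma abs_num_surj: "\<exists>t. x = abs_num t"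
  by (metis Quotient3_abs_rep Quotient3_num)

lemma eval_abs_num: "eval (\<lambda>i. abs_num (\<sigma> i)) t = abs_num (subst_tm \<sigma> t)"
  by (induction t) (auto simp: zero_num.abs_eq one_num.abs_eq plus_num.abs_eq times_num.abs_eq)

lemma case_nat_comp: "case_nat (f t) (\<lambda>i. f (\<sigma> i)) = (\<lambda>i. f (case_nat t \<sigma> i))"
  by (auto simp: fun_eq_iff split: nat.split)

text \<open>Environments are represented by substitutions, since every element is the class of a
  term; the quantifier cases then become the Henkin conditions on \<open>Th\<close>.\<close>

lemma truth:
  "sat UNIV (range num_set) (\<lambda>i. abs_num (\<sigma> i)) (\<lambda>X. num_set (\<rho> X)) \<phi> \<longleftrightarrow> subst \<sigma> \<rho> \<phi> \<in> Th"
proof (induction \<phi> arbitrary: \<sigma> \<rho>)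
  case (AllN \<phi>)
  have "sat UNIV (range num_set) (\<lambda>i. abs_num (\<sigma> i)) (\<lambda>X. num_set (\<rho> X)) (AllN \<phi>) \<longleftrightarrow>
      (\<forall>t. sat UNIV (range num_set) (case_nat (abs_num t) (\<lambda>i. abs_num (\<sigma> i))) (\<lambda>X. num_set (\<rho> X)) \<phi>)"
    by (metis sat.simps(6) UNIV_I abs_num_surj)
  then show ?case
    by (simp only: case_nat_comp AllN.IH subst.simps Th_AllN instN_subst)
next
  case (AllS \<phi>)
  have "sat UNIV (range num_set) (\<lambda>i. abs_num (\<sigma> i)) (\<lambda>X. num_set (\<rho> X)) (AllS \<phi>) \<longleftrightarrow>
      (\<forall>X. sat UNIV (range num_set) (\<lambda>i. abs_num (\<sigma> i)) (case_nat (num_set X) (\<lambda>X. num_set (\<rho> X))) \<phi>)"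
    by auto
  then show ?case
    by (simp only: case_nat_comp AllS.IH subst.simps Th_AllS instS_subst)
qed (auto simp: Th_Bot Th_Imp eval_abs_num num.abs_eq_iff less_num.abs_eq mem_num_set)

lemma sat_num_iff:
  assumes "closed \<phi>" "range s \<subseteq> range num_set"
  shows "sat UNIV (range num_set) e s \<phi> \<longleftrightarrow> \<phi> \<in> Th"
proof -
  have "\<forall>i. \<exists>t. e i = abs_num t" "\<forall>X. \<exists>Y. s X = num_set Y"
    using abs_num_surj assms(2) by blast+
  then obtain \<sigma> \<rho> where "\<forall>i. e i = abs_num (\<sigma> i)" "\<forall>X. s X = num_set (\<rho> X)" by metis
  then have "e = (\<lambda>i. abs_num (\<sigma> i))" "s = (\<lambda>X. num_set (\<rho> X))" by auto
  then show ?thesis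
    using truth[of \<sigma> \<rho> \<phi>] assms(1) by simp
qed

interpretation num: model UNIV "range num_set" "\<lambda>i. abs_num (from_nat i)" num_set
proof
  show "range (\<lambda>i. abs_num (from_nat i)) = UNIV"
    using abs_num_surj by (metis surjI surj_def from_nat_to_nat)
  show "valid UNIV (range num_set) \<phi>" if "\<phi> \<in> RCA0" for \<phi>
    using that Th(2) sat_num_iff[OF closed_RCA0[OF that]] by (auto simp: valid_def)
qed auto

section \<open>The ordered ring generated by the term model\<close>

lemma num_basic:
  fixes x y :: num
  shows "x + 1 \<noteq> 0" "x + 1 = y + 1 \<longleftrightarrow> x = y" "x + 0 = x" "x + (y + 1) = (x + y) + 1"
    "x * 0 = 0" "x * (y + 1) = x * y + x" "\<not> x < 0" "x < y + 1 \<longleftrightarrow> x < y \<or> x = y"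
proof -
  show "x + 1 = y + 1 \<longleftrightarrow> x = y" using num.basic_axioms_hold(2)[of x y] by auto
qed (rule num.basic_axioms_hold; simp)+

text \<open>The source of the algebraic laws below: the basic axioms describe addition and
  multiplication only by recursion on the right argument.\<close>

lemma num_induct:
  fixes P :: "num \<Rightarrow> bool"
  assumes "num.D0 1 (\<lambda>e. P (e 0))" "P 0" "\<And>x. P x \<Longrightarrow> P (x + 1)"
  shows "P x"
  by (rule num.induction[OF num.S1_D0[OF assms(1)]]) (use assms in auto)

lemma num_add_0_left: "0 + x = (x :: num)"
  by (rule num_induct[of "\<lambda>x. 0 + x = x"]) ((intro num.D0I; simp), auto simp: num_basic)

lemma num_add_Suc_left: "(x + 1) + y = (x + y) + (1 :: num)"
  by (rule num_induct[of "\<lambda>y. (x + 1) + y = (x + y) + 1"])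
    ((intro num.D0I; simp), auto simp: num_basic)

lemma num_add_commute: "x + y = y + (x :: num)"
  by (rule num_induct[of "\<lambda>y. x + y = y + x"])
    ((intro num.D0I; simp), auto simp: num_basic num_add_0_left num_add_Suc_left)

lemma num_add_assoc: "(x + y) + z = x + (y + (z :: num))"
  by (rule num_induct[of "\<lambda>z. (x + y) + z = x + (y + z)"])
    ((intro num.D0I; simp), auto simp: num_basic)

lemma num_add_cancel: "x + z = y + z \<longleftrightarrow> x = (y :: num)"
  by (rule num_induct[of "\<lambda>z. x + z = y + z \<longleftrightarrow> x = y"])
    (unfold iff_conv_conj_imp, (intro num.D0I; simp), auto simp: num_basic)

lemma num_distrib: "x * (y + z) = x * y + x * (z :: num)"
  by (rule num_induct[of "\<lambda>z. x * (y + z) = x * y + x * z"])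
    ((intro num.D0I; simp), auto simp: num_basic simp flip: num_add_assoc)

lemma num_mult_assoc: "(x * y) * z = x * (y * (z :: num))"
  by (rule num_induct[of "\<lambda>z. (x * y) * z = x * (y * z)"])
    ((intro num.D0I; simp), auto simp: num_basic num_distrib[of _ "_ * _"])

lemma num_mult_0_left: "0 * x = (0 :: num)"
  by (rule num_induct[of "\<lambda>x. 0 * x = 0"]) ((intro num.D0I; simp), auto simp: num_basic)

instantiation num :: comm_monoid_add
begin
instance by standard (auto simp: num_add_assoc num_add_0_left intro: num_add_commute)
end

lemma num_mult_Suc_left: "(x + 1) * y = x * y + (y :: num)"
  by (rule num_induct[of "\<lambda>y. (x + 1) * y = x * y + y"])
    ((intro num.D0I; simp), auto simp: num_basic ac_simps)

lemma num_mult_commute: "x * y = y * (x :: num)"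
  by (rule num_induct[of "\<lambda>y. x * y = y * x"])
    ((intro num.D0I; simp), auto simp: num_basic num_mult_0_left num_mult_Suc_left)

instantiation num :: comm_semiring_1
begin
instance
proof
  fix x y z :: num
  show "1 * x = x"
    using num_basic(6)[of x 0] by (simp add: num_basic num_mult_commute[of 1])
  show "(x + y) * z = x * z + y * z" by (metis num_distrib num_mult_commute)
  show "(0 :: num) \<noteq> 1" using num_basic(1)[of 0] by simp
qed (auto simp: num_mult_assoc num_mult_0_left num_basic intro: num_mult_commute)
end

lemma num_zero_or_pos: "x = 0 \<or> 0 < (x :: num)"
  by (rule num_induct[of "\<lambda>x. x = 0 \<or> 0 < x"]) ((intro num.D0I; simp), auto simp: num_basic)

lemma num_less_add: "x < x + (z + 1 :: num)"
  by (rule num_induct[of "\<lambda>z. x < x + (z + 1)"])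
    ((intro num.D0I; simp), auto simp: num_basic simp flip: add.assoc)

text \<open>Reduces the order to addition, after which transitivity, trichotomy and cancellation are
  matters of algebra.\<close>

lemma num_less_iff: "x < y \<longleftrightarrow> (\<exists>z :: num. y = x + (z + 1))"
proof
  have "\<exists>z\<in>UNIV. x < y \<longrightarrow> y = x + (z + 1)"
  proof (rule num.induction[of "\<lambda>y. \<exists>z\<in>UNIV. x < y \<longrightarrow> y = x + (z + 1)"])
    show "num.S1 1 (\<lambda>e. \<exists>z\<in>UNIV. x < e 0 \<longrightarrow> e 0 = x + (z + 1))"
      by (rule num.S1_ex, intro num.D0I; simp)
  next
    fix y assume "\<exists>z\<in>UNIV. x < y \<longrightarrow> y = x + (z + 1)"
    then obtain z where "x < y \<longrightarrow> y = x + (z + 1)" by auto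
    \<comment> \<open>If \<open>x < y\<close>, the old difference grows by one; the remaining case
      is \<open>x = y\<close>, with \<open>z = 0\<close>.\<close>
    then have "x < y + 1 \<longrightarrow> y + 1 = x + ((if x < y then z + 1 else 0) + 1)"
      by (auto simp: num_basic)
    then show "\<exists>z\<in>UNIV. x < y + 1 \<longrightarrow> y + 1 = x + (z + 1)" by (rule bexI) simp
  qed (auto simp: num_basic)
  then show "x < y \<Longrightarrow> \<exists>z. y = x + (z + 1)" by auto
qed (auto intro: num_less_add)

lemma num_trichotomy: "x < y \<or> x = y \<or> y < (x :: num)"
proof (rule num_induct[of "\<lambda>y. x < y \<or> x = y \<or> y < x"])
  fix y assume "x < y \<or> x = y \<or> y < x"
  moreover have "x = y + 1 \<or> y + 1 < x" if less: "y < x"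
  proof -
    obtain z where z: "x = y + (z + 1)" using less unfolding num_less_iff by blast
    then consider "z = 0" | z' where "z = z' + 1"
      using num_zero_or_pos[of z] by (auto simp: num_less_iff[of 0])
    then show ?thesis
    proof cases
      case 2
      then have "x = (y + 1) + (z' + 1)" using z by (simp add: ac_simps)
      then show ?thesis using num_less_iff by blast
    qed (use z in simp)
  qed
  ultimately show "x < y + 1 \<or> x = y + 1 \<or> y + 1 < x" by (auto simp: num_basic)
next
  show "num.D0 1 (\<lambda>e. x < e 0 \<or> x = e 0 \<or> e 0 < x)" by (intro num.D0I; simp)
qed (use num_zero_or_pos in auto)

lemma num_irrefl: "\<not> x < (x :: num)"
proof
  assume "x < x"
  then obtain z where "x = x + (z + 1)" unfolding num_less_iff by blast
  then have "0 + x = (z + 1) + x" by (simp add: ac_simps)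
  then show False using num_add_cancel num_basic(1) by metis
qed

lemma num_less_trans: "x < y \<Longrightarrow> y < z \<Longrightarrow> x < (z :: num)"
  unfolding num_less_iff by (metis add.assoc)

instantiation num :: linorder
begin
instance
proof
  fix x y z :: num
  show "x < y \<longleftrightarrow> x \<le> y \<and> \<not> y \<le> x" "x \<le> x" "x \<le> y \<Longrightarrow> y \<le> z \<Longrightarrow> x \<le> z"
    "x \<le> y \<Longrightarrow> y \<le> x \<Longrightarrow> x = y" "x \<le> y \<or> y \<le> x"
    unfolding less_eq_num_def by (metis num_irrefl num_less_trans num_trichotomy)+
qed
end

lemma num_add_less_cancel: "x + z < y + z \<longleftrightarrow> x < (y :: num)"
proof
  assume "x + z < y + z"
  then obtain w where "y + z = x + z + (w + 1)" using num_less_iff by blast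
  then have "y + z = (x + (w + 1)) + z" by (simp add: ac_simps)
  then show "x < y" using num_add_cancel num_less_iff by blast
next
  assume "x < y"
  then obtain w where "y = x + (w + 1)" using num_less_iff by blast
  then have "y + z = (x + z) + (w + 1)" by (simp add: ac_simps)
  then show "x + z < y + z" using num_less_iff by blast
qed

lemma num_add_le_cancel: "x + z \<le> y + z \<longleftrightarrow> x \<le> (y :: num)"
  by (simp add: less_eq_num_def num_add_less_cancel num_add_cancel)

lifting_forget num.lifting

\<comment> \<open>The ring of differences: \<open>(a, b)\<close> stands for a - b. The model
  reappears as its nonnegative part, and negative elements become available in congruences.\<close>
quotient_type zring = "num \<times> num" / "\<lambda>(a, b) (c, d). a + d = c + b"
  morphisms Rep_zring Abs_zring
proof (rule equivpI)
  show "transp (\<lambda>(a, b) (c, d :: num). a + d = c + b)"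
  proof (rule transpI, clarify)
    fix a b c d e f :: num
    assume "a + d = c + b" "c + f = e + d"
    then have "(a + f) + (c + d) = (e + b) + (c + d)"
      by (metis add.assoc add.commute add.left_commute)
    then show "a + f = e + b" by (simp add: num_add_cancel)
  qed
qed (auto intro!: reflpI sympI)

instantiation zring :: "{zero,one,plus,times,uminus,minus,ord,abs,sgn}"
begin

lift_definition zero_zring :: zring is "(0, 0)" .
lift_definition one_zring :: zring is "(1, 0)" .
lift_definition plus_zring :: "zring \<Rightarrow> zring \<Rightarrow> zring" is "\<lambda>(a, b) (c, d). (a + c, b + d)"
  by clarsimp (metis add.assoc add.left_commute)
lift_definition uminus_zring :: "zring \<Rightarrow> zring" is "\<lambda>(a, b). (b, a)"
  by (clarsimp simp: add.commute)
lift_definition minus_zring :: "zring \<Rightarrow> zring \<Rightarrow> zring" is "\<lambda>(a, b) (c, d). (a + d, b + c)"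
  by clarsimp (metis add.assoc add.left_commute add.commute)
lift_definition times_zring :: "zring \<Rightarrow> zring \<Rightarrow> zring" is "\<lambda>(a, b) (c, d). (a * c + b * d, a * d + b * c)"
proof (clarsimp)
  fix a b a' b' c d c' d' :: num
  assume ab: "a + b' = a' + b" and cd: "c + d' = c' + d"
  \<comment> \<open>Mixed products such as \<open>a' * c\<close> are added to both sides, so that
    each hypothesis can be applied to a whole factor; they are cancelled afterwards.\<close>
  have "(a + b') * c + (a' + b) * d + a' * (c + d') + b' * (c' + d)
      = (a' + b) * c + (a + b') * d + a' * (c' + d) + b' * (c + d')"
    by (simp add: ab cd)
  then have "(a * c + b * d + (a' * d' + b' * c')) + (b' * c + a' * d + (a' * c + b' * d))
      = (a' * c' + b' * d' + (a * d + b * c)) + (b' * c + a' * d + (a' * c + b' * d))"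
    by (simp add: algebra_simps)
  then show "a * c + b * d + (a' * d' + b' * c') = a' * c' + b' * d' + (a * d + b * c)"
    by (simp only: num_add_cancel)
qed
lift_definition less_eq_zring :: "zring \<Rightarrow> zring \<Rightarrow> bool" is "\<lambda>(a, b) (c, d). a + d \<le> c + b"
proof (clarsimp)
  fix a b a' b' c d c' d' :: num
  assume ab: "a + b' = a' + b" and cd: "c + d' = c' + d"
  have "a + d \<le> c + b \<longleftrightarrow> (a + d) + (b' + d') \<le> (c + b) + (b' + d')"
    by (simp only: num_add_le_cancel)
  also have "\<dots> \<longleftrightarrow> (a + b') + (d + d') \<le> (c + d') + (b + b')" by (simp add: ac_simps)
  also have "\<dots> \<longleftrightarrow> (a' + d') + (b + d) \<le> (c' + b') + (b + d)" by (simp add: ab cd ac_simps)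
  also have "\<dots> \<longleftrightarrow> a' + d' \<le> c' + b'" by (simp only: num_add_le_cancel)
  finally show "(a + d \<le> c + b) = (a' + d' \<le> c' + b')" .
qed
definition less_zring :: "zring \<Rightarrow> zring \<Rightarrow> bool" where "x < y \<longleftrightarrow> x \<le> y \<and> \<not> y \<le> (x :: zring)"
definition abs_zring :: "zring \<Rightarrow> zring" where "\<bar>x\<bar> = (if x < 0 then - x else (x :: zring))"
definition sgn_zring :: "zring \<Rightarrow> zring" where "sgn x = (if x = (0 :: zring) then 0 else if 0 < x then 1 else - 1)"

instance ..

end

instance zring :: comm_ring_1
proof
  fix x y z :: zring
  show "(x + y) + z = x + (y + z)" by transfer (clarsimp simp: ac_simps)
  show "x + y = y + x" by transfer (clarsimp simp: ac_simps)
  show "0 + x = x" by transfer clarsimp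
  show "- x + x = 0" by transfer (clarsimp simp: ac_simps)
  show "x - y = x + - y" by transfer (clarsimp simp: ac_simps)
  show "(x * y) * z = x * (y * z)" by transfer (clarsimp simp: algebra_simps)
  show "x * y = y * x" by transfer (clarsimp simp: ac_simps)
  show "1 * x = x" by transfer clarsimp
  show "(x + y) * z = x * z + y * z" by transfer (clarsimp simp: algebra_simps)
  show "(0 :: zring) \<noteq> 1" by transfer simp
qed

lift_definition of_num :: "num \<Rightarrow> zring" is "\<lambda>a. (a, 0)" .

lemma of_num_simps:
  "of_num 0 = 0" "of_num 1 = 1" "of_num (x + y) = of_num x + of_num y"
  "of_num (x * y) = of_num x * of_num y" "of_num x = of_num y \<longleftrightarrow> x = y"
  by (transfer; simp)+

lemma of_num_le: "of_num x \<le> of_num y \<longleftrightarrow> x \<le> y"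
  by transfer simp

lemma zring_order:
  "x \<le> x" "x \<le> y \<Longrightarrow> y \<le> z \<Longrightarrow> x \<le> z" "x \<le> y \<Longrightarrow> y \<le> x \<Longrightarrow> x = y" "x \<le> y \<or> y \<le> x"
  "x \<le> y \<Longrightarrow> z + x \<le> z + (y :: zring)"
proof -
  show "x \<le> x" by transfer clarsimp
  show "x \<le> y \<Longrightarrow> y \<le> z \<Longrightarrow> x \<le> z"
  proof (transfer, clarify)
    fix a b c d e f :: num
    assume "a + d \<le> c + b" "c + f \<le> e + d"
    then have "(a + d) + f \<le> (c + b) + f" "(c + f) + b \<le> (e + d) + b"
      by (simp_all only: num_add_le_cancel)
    then have "(a + f) + d \<le> (e + b) + d" by (metis add.assoc add.commute order_trans)
    then show "a + f \<le> e + b" by (simp only: num_add_le_cancel)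
  qed
  show "x \<le> y \<Longrightarrow> y \<le> x \<Longrightarrow> x = y" by transfer (clarsimp simp: ac_simps)
  show "x \<le> y \<or> y \<le> x" by transfer (clarsimp, metis linear)
  show "x \<le> y \<Longrightarrow> z + x \<le> z + y"
  proof (transfer, clarify)
    fix a b c d e f :: num
    assume "a + d \<le> c + b"
    then have "(a + d) + (e + f) \<le> (c + b) + (e + f)" by (simp only: num_add_le_cancel)
    then show "e + a + (f + d) \<le> e + c + (f + b)" by (simp add: ac_simps)
  qed
qed

instance zring :: ordered_ab_group_add
  by standard (use zring_order in \<open>auto simp: less_zring_def\<close>)

lemma zring_nonneg: "0 \<le> x \<longleftrightarrow> (\<exists>n. x = of_num n)"
proof
  assume "0 \<le> x"
  then show "\<exists>n. x = of_num n"
  proof (transfer, clarsimp)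
    fix a b :: num assume "b \<le> a"
    then have "a = b \<or> (\<exists>z. a = b + (z + 1))" using num_less_iff by (auto simp: le_less)
    then show "\<exists>n. a = n + b" by (metis add.commute add_0)
  qed
next
  show "\<exists>n. x = of_num n \<Longrightarrow> 0 \<le> x"
    using of_num_le[of 0] num_zero_or_pos by (auto simp: of_num_simps less_eq_num_def)
qed

lemma zring_pos: "0 < x \<longleftrightarrow> (\<exists>n. x = of_num (n + 1))"
proof
  assume "0 < x"
  then obtain n where n: "x = of_num n" using zring_nonneg by (auto simp: less_le)
  then have "n \<noteq> 0" using \<open>0 < x\<close> by (auto simp: of_num_simps)
  then have "0 < n" using num_zero_or_pos by auto
  then show "\<exists>n. x = of_num (n + 1)" using n num_less_iff[of 0 n] by auto
next
  assume "\<exists>n. x = of_num (n + 1)"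
  moreover from this have "x \<noteq> 0" using of_num_simps(1,5) num_basic(1) by metis
  ultimately show "0 < x" using zring_nonneg by (auto simp: less_le)
qed

instance zring :: linordered_idom
proof
  fix x y z :: zring
  show "x \<le> y \<or> y \<le> x" by (rule zring_order)
  have pos: "0 < a * b" if a: "0 < a" and b: "0 < b" for a b :: zring
  proof -
    obtain m n where "a = of_num (m + 1)" "b = of_num (n + 1)" using a b unfolding zring_pos by blast
    then have "a * b = of_num ((m * n + m + n) + 1)" by (simp add: of_num_simps algebra_simps)
    then show ?thesis using zring_pos by blast
  qed
  show "x < y \<Longrightarrow> 0 < z \<Longrightarrow> z * x < z * y"
    using pos[of z "y - x"] by (simp add: algebra_simps)
  show "\<bar>x\<bar> = (if x < 0 then - x else x)" by (rule abs_zring_def)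
  show "sgn x = (if x = 0 then 0 else if 0 < x then 1 else - 1)" by (rule sgn_zring_def)
qed

lemma of_num_less: "of_num x < of_num y \<longleftrightarrow> x < y"
  by (simp add: less_le of_num_le of_num_simps)

lemma eval_of_num: "eval (\<lambda>i. of_num (e i)) t = of_num (eval e t)"
  by (induction t) (auto simp: of_num_simps)

text \<open>\<open>of_num\<close> is an isomorphism onto the nonnegative part, and sets are carried
  over as images.\<close>

lemma sat_of_num:
  "sat {0..} ((`) of_num ` S) (\<lambda>i. of_num (e i)) (\<lambda>X. of_num ` s X) \<phi> \<longleftrightarrow> sat UNIV S e s \<phi>"
proof (induction \<phi> arbitrary: e s)
  case (AllN \<phi>)
  have "{0..} = range of_num" by (auto simp: zring_nonneg)
  then show ?case using AllN by (simp add: case_nat_comp)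
next
  case (AllS \<phi>)
  then show ?case by (simp add: case_nat_comp)
next
  case (Mem t X)
  then show ?case by (auto simp: eval_of_num of_num_simps)
qed (auto simp: eval_of_num of_num_simps of_num_less)

definition zring_sets :: "zring set set" where
  "zring_sets = (`) of_num ` range num_set"

lemma valid_zring_iff:
  assumes "closed \<phi>"
  shows "valid {0..} zring_sets \<phi> \<longleftrightarrow> \<phi> \<in> Th"
proof -
  have "sat {0..} zring_sets e s \<phi> \<longleftrightarrow> \<phi> \<in> Th" if "range e \<subseteq> {0..}" "range s \<subseteq> zring_sets" for e s
  proof -
    have "\<forall>i. \<exists>n. e i = of_num n" using that by (auto simp: image_subset_iff simp flip: zring_nonneg)
    moreover have "\<forall>X. \<exists>Y\<in>range num_set. s X = of_num ` Y"
      using that(2) unfolding zring_sets_def by (metis imageE rangeI subsetD)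
    ultimately obtain f g where fg: "\<forall>i. e i = of_num (f i)" "\<forall>X. s X = of_num ` g X" "\<forall>X. g X \<in> range num_set"
      by metis
    then have "e = (\<lambda>i. of_num (f i))" "s = (\<lambda>X. of_num ` g X)" by auto
    then have "sat {0..} zring_sets e s \<phi> \<longleftrightarrow> sat UNIV (range num_set) f g \<phi>"
      by (simp add: zring_sets_def sat_of_num)
    also have "\<dots> \<longleftrightarrow> \<phi> \<in> Th"
      using fg(3) by (intro sat_num_iff assms) auto
    finally show ?thesis .
  qed
  \<comment> \<open>Some environment must exist for validity to imply membership in
    \<open>Th\<close>.\<close>
  moreover have "range (\<lambda>_::nat. 0 :: zring) \<subseteq> {0..}"
    "range (\<lambda>_::nat. of_num ` num_set 0) \<subseteq> zring_sets" by (auto simp: zring_sets_def)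
  ultimately show ?thesis unfolding valid_def by blast
qed

section \<open>Arithmetic in a model of RCA\<close>

lemma (in model) D0_cong: "D0 m P \<Longrightarrow> (\<And>e. range e \<subseteq> D \<Longrightarrow> P e = Q e) \<Longrightarrow> D0 m Q"
  by (simp add: D0_def)

definition beta_mod :: "'a::linordered_idom \<Rightarrow> 'a \<Rightarrow> 'a" where
  "beta_mod b i = 1 + (i + 1) * b"

text \<open>The entry as a remainder, expressed by divisibility in the ring and thus open to
  congruence arguments. Agreement with the quotient form of \<open>beta\<close> is shown in
  \<open>entry_iff\<close>.\<close>

definition entry :: "'a::linordered_idom \<Rightarrow> 'a \<Rightarrow> 'a \<Rightarrow> 'a \<Rightarrow> bool" where
  "entry a b i y \<longleftrightarrow> 0 \<le> y \<and> y < beta_mod b i \<and> beta_mod b i dvd a - y"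

locale arith = model "{0..}" S p s
  for S :: "'a::linordered_idom set set" and p s
begin

text \<open>The axiom characterizing \<open>x < y + 1\<close> is applied to the difference
  \<open>y - x\<close> and 0, so the result covers negative ring elements as well.\<close>

lemma discrete: "x < y \<Longrightarrow> x + 1 \<le> (y :: 'a)"
  using basic_axioms_hold(8)[of "y - x" 0] by (force simp: not_le[symmetric])

lemma pos_ge_1: "0 < x \<Longrightarrow> 1 \<le> (x :: 'a)"
  using discrete[of 0 x] by simp

lemma less_add_1: "x < y + 1 \<longleftrightarrow> x \<le> (y :: 'a)"
  using discrete[of y x] by (auto simp: not_le[symmetric])

lemma dvd_small: "m dvd x \<Longrightarrow> \<bar>x\<bar> < m \<Longrightarrow> x = (0 :: 'a)"
proof (rule ccontr)
  assume "m dvd x" "\<bar>x\<bar> < m" "x \<noteq> 0"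
  then obtain k where k: "x = m * k" by auto
  then have "1 \<le> \<bar>k\<bar>" using \<open>x \<noteq> 0\<close> pos_ge_1 by auto
  then have "\<bar>m\<bar> * 1 \<le> \<bar>m\<bar> * \<bar>k\<bar>" by (intro mult_left_mono) auto
  moreover have "0 < m" using abs_ge_zero \<open>\<bar>x\<bar> < m\<close> by (rule le_less_trans)
  ultimately show False using k \<open>\<bar>x\<bar> < m\<close> by (simp add: abs_mult)
qed

lemma dvd_le: "m dvd x \<Longrightarrow> 0 < x \<Longrightarrow> m \<le> (x :: 'a)"
  using dvd_small[of m x] by force

lemma D0_le: "Tm m t \<Longrightarrow> Tm m u \<Longrightarrow> D0 m (\<lambda>e. t e \<le> u e)"
  using D0_not[OF D0_less] by (simp add: not_less)

lemma D0_ball_lt: "Tm m t \<Longrightarrow> D0 (Suc m) (\<lambda>e. P (e 0) (\<lambda>i. e (Suc i))) \<Longrightarrow> D0 m (\<lambda>e. \<forall>x\<in>{0..<t e}. P x e)"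
  by (drule (1) D0_all) (simp add: Ball_def imp_conjL)

lemma D0_bex_lt: "Tm m t \<Longrightarrow> D0 (Suc m) (\<lambda>e. P (e 0) (\<lambda>i. e (Suc i))) \<Longrightarrow> D0 m (\<lambda>e. \<exists>x\<in>{0..<t e}. P x e)"
  by (drule (1) D0_ex) (simp add: Bex_def conj_assoc)

lemma Tm_Suc: "Tm m t \<Longrightarrow> Tm m (\<lambda>e. t e + 1)"
  by (intro Tm_add Tm_const one_D)

lemma D0_ball_le: "Tm m t \<Longrightarrow> D0 (Suc m) (\<lambda>e. P (e 0) (\<lambda>i. e (Suc i))) \<Longrightarrow> D0 m (\<lambda>e. \<forall>x\<in>{0..t e}. P x e)"
  by (drule D0_ball_lt[OF Tm_Suc]) (simp_all add: Ball_def less_add_1)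

lemma D0_bex_le: "Tm m t \<Longrightarrow> D0 (Suc m) (\<lambda>e. P (e 0) (\<lambda>i. e (Suc i))) \<Longrightarrow> D0 m (\<lambda>e. \<exists>x\<in>{0..t e}. P x e)"
  by (drule D0_bex_lt[OF Tm_Suc]) (simp_all add: Bex_def less_add_1)

text \<open>Makes divisibility a bounded predicate. If \<open>x\<close> or \<open>y\<close> is 0,
  the quotient 0 is chosen, as an arbitrary one may be out of range.\<close>

lemma dvd_iff_bounded: "0 \<le> x \<Longrightarrow> 0 \<le> y \<Longrightarrow> x dvd y \<longleftrightarrow> (\<exists>k\<in>{0..y}. y = x * (k :: 'a))"
proof
  assume "0 \<le> x" "0 \<le> y" "x dvd y"
  then obtain k where k: "y = x * k" by auto
  show "\<exists>k\<in>{0..y}. y = x * k"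
  proof (cases "x = 0 \<or> y = 0")
    case True
    then show ?thesis using k \<open>0 \<le> y\<close> by (intro bexI[of _ 0]) auto
  next
    case False
    then have "0 < x" "0 < y" using \<open>0 \<le> x\<close> \<open>0 \<le> y\<close> by auto
    then have "0 < k" using k by (simp add: zero_less_mult_iff)
    moreover have "1 * k \<le> x * k" using \<open>0 < x\<close> \<open>0 < k\<close> pos_ge_1 by (intro mult_right_mono) auto
    ultimately show ?thesis using k by (intro bexI[of _ k]) auto
  qed
qed auto

lemma D0_dvd_var: "D0 2 (\<lambda>e. e 0 dvd e 1)"
  by (rule D0_cong[of _ "\<lambda>e. \<exists>k\<in>{0..e 1}. e 1 = e 0 * k"], (intro D0I D0_bex_le; simp))
    (auto simp: dvd_iff_bounded image_subset_iff)

lemma D0_dvd: "Tm m t \<Longrightarrow> Tm m u \<Longrightarrow> D0 m (\<lambda>e. t e dvd u e)"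
  using D0_comp2[OF D0_dvd_var] .

lemmas bounded_intros = D0I D0_le D0_ball_lt D0_bex_lt D0_ball_le D0_bex_le D0_dvd

section \<open>Least elements, collection and division\<close>

lemma induct [consumes 1]:
  "0 \<le> x \<Longrightarrow> S1 1 (\<lambda>e. P (e 0)) \<Longrightarrow> P 0 \<Longrightarrow> (\<And>x. 0 \<le> x \<Longrightarrow> P x \<Longrightarrow> P (x + 1)) \<Longrightarrow> P x"
  using induction[of P x] by auto

lemmas induct0 [consumes 1] = induct[OF _ S1_D0]

text \<open>Without a least element, bounded induction would show that nothing below
  \<open>y\<close> satisfies \<open>P\<close>, for all \<open>y\<close> up to
  \<open>x + 1\<close>.\<close>

lemma least:
  assumes "D0 1 (\<lambda>e. P (e 0))" "0 \<le> x" "P x"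
  shows "\<exists>y. 0 \<le> y \<and> y \<le> x \<and> P y \<and> (\<forall>z\<in>{0..<y}. \<not> P z)"
proof (rule ccontr)
  assume *: "\<not> ?thesis"
  have "y \<le> x + 1 \<longrightarrow> (\<forall>z\<in>{0..<y}. \<not> P z)" if "0 \<le> y" for y
    using that
  proof (induction rule: induct0)
    show "D0 1 (\<lambda>e. e 0 \<le> x + 1 \<longrightarrow> (\<forall>z\<in>{0..<e 0}. \<not> P z))"
      by (intro bounded_intros D0_comp1[OF assms(1)]; use assms in simp)
  next
    fix y assume y: "0 \<le> y" "y \<le> x + 1 \<longrightarrow> (\<forall>z\<in>{0..<y}. \<not> P z)"
    show "y + 1 \<le> x + 1 \<longrightarrow> (\<forall>z\<in>{0..<y + 1}. \<not> P z)"
    proof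
      assume "y + 1 \<le> x + 1"
      then have "\<not> P y" and "\<forall>z\<in>{0..<y}. \<not> P z" using * y by auto
      then show "\<forall>z\<in>{0..<y + 1}. \<not> P z" by (auto simp: less_add_1 le_less)
    qed
  qed auto
  from this[of "x + 1"] assms show False by auto
qed

text \<open>Sigma-1 induction on the length of an initial segment of the range of \<open>u\<close>;
  \<open>t\<close> is the one unbounded quantifier, and the alternative \<open>n < x\<close> makes
  the formula trivial beyond \<open>n\<close>.\<close>

lemma collection:
  assumes "D0 2 (\<lambda>e. R (e 0) (e 1))" "0 \<le> n" "\<forall>u\<in>{0..<n}. \<exists>v\<in>{0..}. R u v"
  shows "\<exists>t\<in>{0..}. \<forall>u\<in>{0..<n}. \<exists>v\<in>{0..t}. R u v"
proof -
  have "\<exists>t\<in>{0..}. n < x \<or> (\<forall>u\<in>{0..<x}. \<exists>v\<in>{0..t}. R u v)" if "0 \<le> x" for x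
    using that
  proof (induction rule: induct)
    show "S1 1 (\<lambda>e. \<exists>t\<in>{0..}. n < e 0 \<or> (\<forall>u\<in>{0..<e 0}. \<exists>v\<in>{0..t}. R u v))"
      by (rule S1_ex, intro bounded_intros D0_comp2[OF assms(1)]; use assms in simp)
  next
    fix x assume x: "0 \<le> x" "\<exists>t\<in>{0..}. n < x \<or> (\<forall>u\<in>{0..<x}. \<exists>v\<in>{0..t}. R u v)"
    then obtain t where t: "0 \<le> t" "n < x \<or> (\<forall>u\<in>{0..<x}. \<exists>v\<in>{0..t}. R u v)" by auto
    show "\<exists>t\<in>{0..}. n < x + 1 \<or> (\<forall>u\<in>{0..<x + 1}. \<exists>v\<in>{0..t}. R u v)"
    proof (cases "n < x + 1")
      case False
      then have "x \<in> {0..<n}" using x less_add_1[of n x] by auto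
      then obtain v where v: "v \<in> {0..}" "R x v" using assms(3) by blast
      have "\<exists>w\<in>{0..max t v}. R u w" if "u \<in> {0..<x + 1}" for u
      proof (cases "u = x")
        case True
        then show ?thesis using v by (intro bexI[of _ v]) auto
      next
        case neq: False
        then have "u \<in> {0..<x}" using that by (auto simp: less_add_1)
        moreover have "\<not> n < x" using False by auto
        ultimately obtain w where "w \<in> {0..t}" "R u w" using t by blast
        then show ?thesis by (intro bexI[of _ w]) auto
      qed
      then show ?thesis using t by (intro bexI[of _ "max t v"]) auto
    qed auto
  qed auto
  from this[OF assms(2)] show ?thesis by auto
qed

lemma division_nonneg:
  assumes "0 < m" "0 \<le> a"
  shows "\<exists>r\<in>{0..<m}. m dvd a - (r :: 'a)"
proof -
  have "\<exists>r\<in>{0..<m}. \<exists>q\<in>{0..a}. a = q * m + r"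
    using assms(2)
  proof (induction rule: induct0)
    show "D0 1 (\<lambda>e. \<exists>r\<in>{0..<m}. \<exists>q\<in>{0..e 0}. e 0 = q * m + r)"
      by (intro bounded_intros; use assms in simp)
  next
    fix a assume "0 \<le> a" "\<exists>r\<in>{0..<m}. \<exists>q\<in>{0..a}. a = q * m + r"
    then obtain r q where *: "r \<in> {0..<m}" "q \<in> {0..a}" "a = q * m + r" by auto
    show "\<exists>r\<in>{0..<m}. \<exists>q\<in>{0..a + 1}. a + 1 = q * m + r"
    proof (cases "r + 1 < m")
      case True
      have "\<exists>q\<in>{0..a + 1}. a + 1 = q * m + (r + 1)" using * by (intro bexI[of _ q]) auto
      moreover have "r + 1 \<in> {0..<m}" using * True by auto
      ultimately show ?thesis by blast
    next
      case False
      then have "r + 1 = m" using * discrete[of r m] by auto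
      then have "a + 1 = (q + 1) * m" using * by (simp add: algebra_simps)
      then have "\<exists>q\<in>{0..a + 1}. a + 1 = q * m + 0"
        using * pos_ge_1[OF assms(1)] by (intro bexI[of _ "q + 1"]) auto
      moreover have "0 \<in> {0..<m}" using assms by auto
      ultimately show ?thesis by blast
    qed
  qed (use assms in auto)
  then obtain r q where "r \<in> {0..<m}" "a = q * m + r" by blast
  then show ?thesis by (intro bexI[of _ r]) auto
qed

lemma division:
  assumes "0 < m"
  shows "\<exists>r\<in>{0..<m}. m dvd a - (r :: 'a)"
proof (cases "0 \<le> a")
  case False
  \<comment> \<open>Subtracting the multiple \<open>a * m\<close> keeps the remainder and makes a
    negative \<open>a\<close> nonnegative.\<close>
  have "0 \<le> a - a * m"
  proof -
    have "(- a) * 1 \<le> (- a) * m" using False assms pos_ge_1 by (intro mult_left_mono) auto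
    then show ?thesis by simp
  qed
  then obtain r where "r \<in> {0..<m}" "m dvd (a - a * m) - r" using division_nonneg assms by blast
  moreover have "a - r = ((a - a * m) - r) + a * m" by simp
  ultimately show ?thesis by (metis dvd_add dvd_triv_right)
qed (use assms division_nonneg in auto)

section \<open>Goedel's beta function\<close>

lemma beta_mod_pos: "0 \<le> b \<Longrightarrow> 0 \<le> i \<Longrightarrow> 0 < beta_mod b (i :: 'a)"
  unfolding beta_mod_def by (simp add: add_pos_nonneg)

lemma entry_nonneg: "entry a b i y \<Longrightarrow> 0 \<le> (y :: 'a)"
  by (simp add: entry_def)

lemma entry_iff:
  assumes "0 \<le> a" "0 \<le> b" "0 \<le> i"
  shows "entry a b i y \<longleftrightarrow> 0 \<le> y \<and> y < beta_mod b i \<and> (\<exists>q\<in>{0..}. a = q * beta_mod b i + (y :: 'a))"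
proof -
  have "\<exists>q\<in>{0..}. a = q * beta_mod b i + y" if y: "y < beta_mod b i" "beta_mod b i dvd a - y"
  proof -
    obtain k where k: "a - y = beta_mod b i * k" using y(2) by auto
    have "\<not> k + 1 \<le> 0"
    proof
      assume "k + 1 \<le> 0"
      then have "beta_mod b i * (k + 1) \<le> 0" using beta_mod_pos assms by (simp add: mult_le_0_iff less_imp_le)
      then show False using k y assms by (simp add: algebra_simps)
    qed
    then have "0 \<le> k" using discrete[of k 0] by force
    then show ?thesis using k by (intro bexI[of _ k]) (auto simp: algebra_simps)
  qed
  then show ?thesis unfolding entry_def by auto
qed

lemma entry_le: "0 \<le> a \<Longrightarrow> 0 \<le> b \<Longrightarrow> 0 \<le> i \<Longrightarrow> entry a b i y \<Longrightarrow> y \<le> (a :: 'a)"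
  using entry_iff[of a b i y] beta_mod_pos[of b i] by auto

lemma entry_bounded:
  assumes "0 \<le> a" "0 \<le> b" "0 \<le> i" "0 \<le> y"
  shows "entry a b i y \<longleftrightarrow> y < beta_mod b i \<and> (\<exists>q\<in>{0..a}. a = q * beta_mod b i + (y :: 'a))"
proof -
  have "q \<le> a" if "0 \<le> q" "a = q * beta_mod b i + y" for q
  proof -
    have "q * 1 \<le> q * beta_mod b i"
      using beta_mod_pos[of b i] assms that pos_ge_1 by (intro mult_left_mono) auto
    then show ?thesis using that assms by simp
  qed
  then show ?thesis using assms by (auto simp: entry_iff)
qed

lemma entry_unique: "entry a b i y \<Longrightarrow> entry a b i z \<Longrightarrow> y = (z :: 'a)"
proof -
  assume "entry a b i y" "entry a b i z"
  then have "beta_mod b i dvd (a - z) - (a - y)" "\<bar>y - z\<bar> < beta_mod b i"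
    unfolding entry_def by (blast intro: dvd_diff, force)
  then show ?thesis using dvd_small[of "beta_mod b i" "y - z"] by simp
qed

lemma entry_exists: "0 \<le> b \<Longrightarrow> 0 \<le> i \<Longrightarrow> \<exists>y. entry a b i (y :: 'a)"
  using division[OF beta_mod_pos, of b i a] by (auto simp: entry_def)

lemma D0_entry_var: "D0 4 (\<lambda>e. entry (e 0) (e 1) (e 2) (e 3))"
  by (rule D0_cong[of _ "\<lambda>e. e 3 < beta_mod (e 1) (e 2) \<and> (\<exists>q\<in>{0..e 0}. e 0 = q * beta_mod (e 1) (e 2) + e 3)"],
      unfold beta_mod_def, (intro bounded_intros; simp))
    (auto simp: entry_bounded image_subset_iff beta_mod_def[symmetric])

lemmas D0_entry = D0_comp4[OF D0_entry_var]

text \<open>Plays the role of the factorial; Sigma-1 induction supplies some common multiple without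
  a function being defined by recursion.\<close>

lemma common_multiple:
  assumes "0 \<le> n"
  shows "\<exists>c>0. \<forall>i\<in>{0..<n}. i + 1 dvd (c :: 'a)"
proof -
  have "\<exists>c\<in>{0..}. 0 < c \<and> (\<forall>i\<in>{0..<n}. i + 1 dvd c)"
    using assms
  proof (induction rule: induct)
    show "S1 1 (\<lambda>e. \<exists>c\<in>{0..}. 0 < c \<and> (\<forall>i\<in>{0..<e 0}. i + 1 dvd c))"
      by (rule S1_ex, intro bounded_intros; simp)
  next
    fix x :: 'a assume "0 \<le> x" "\<exists>c\<in>{0..}. 0 < c \<and> (\<forall>i\<in>{0..<x}. i + 1 dvd c)"
    then obtain c where c: "0 < c" "\<forall>i\<in>{0..<x}. i + 1 dvd c" by auto
    have "i + 1 dvd c * (x + 1)" if "i \<in> {0..<x + 1}" for i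
      using that c(2) by (cases "i = x") (auto simp: less_add_1)
    moreover have "0 < c * (x + 1)" using c \<open>0 \<le> x\<close> by simp
    ultimately show "\<exists>c\<in>{0..}. 0 < c \<and> (\<forall>i\<in>{0..<x + 1}. i + 1 dvd c)"
      by (intro bexI[of _ "c * (x + 1)"]) auto
  qed (auto intro!: bexI[of _ 1])
  then show ?thesis by auto
qed

text \<open>Let \<open>b = (j - i) * e\<close>. Modulo \<open>beta_mod b j\<close>, the number
  \<open>(j + 1) * b\<close> is -1 and \<open>beta_mod b i\<close> is \<open>- (j - i) * b\<close>.
  Multiplying the latter by \<open>- e * (j + 1)\<^sup>2\<close> gives the square of
  \<open>(j + 1) * b\<close>, that is 1.\<close>

lemma beta_mod_coprime:
  assumes "0 \<le> i" "i < j" "j < n" "\<forall>i\<in>{0..<n}. i + 1 dvd (b :: 'a)"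
  shows "\<exists>x. beta_mod b j dvd x * beta_mod b i - 1"
proof -
  \<comment> \<open>The hypothesis speaks of divisors of the form \<open>i + 1\<close>, so the
    divisor \<open>j - i\<close> is found at \<open>j - i - 1\<close>.\<close>
  have "j - i - 1 \<in> {0..<n}" using assms discrete[of i j] by auto
  then have "j - i dvd b" using assms(4)[rule_format, of "j - i - 1"] by simp
  then obtain e where e: "b = (j - i) * e" by auto
  have "- (e * (j + 1)\<^sup>2) * beta_mod b i - 1
      = beta_mod b j * (- (e * (j + 1)\<^sup>2)) + ((j - i) * e) * b * (j + 1)\<^sup>2 - 1"
    by (simp add: beta_mod_def algebra_simps power2_eq_square)
  also have "\<dots> = beta_mod b j * (b * (j + 1) - 1 - e * (j + 1)\<^sup>2)"
    unfolding e[symmetric] by (simp add: beta_mod_def algebra_simps power2_eq_square)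
  finally show ?thesis by (metis dvd_triv_left)
qed

lemma inverse_mod_mult:
  assumes "m dvd x * M - 1" "m dvd y * N - (1 :: 'a)"
  shows "m dvd (x * y) * (M * N) - 1"
proof -
  have "(x * y) * (M * N) - 1 = (x * M - 1) * (y * N) + (y * N - 1)" by (simp add: algebra_simps)
  then show ?thesis using dvd_add[OF dvd_mult2[OF assms(1), of "y * N"] assms(2)] by metis
qed

text \<open>Invertibility has to occur in an induction formula, so it is rephrased with bounded
  nonnegative witnesses and without subtraction; the inverse is reduced modulo
  \<open>m\<close>.\<close>

lemma inverse_mod_iff_bounded:
  assumes "1 < m" "0 \<le> M"
  shows "(\<exists>x. m dvd x * M - 1) \<longleftrightarrow> (\<exists>u\<in>{0..m}. \<exists>v\<in>{0..u * M}. u * M = 1 + v * (m :: 'a))"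
proof
  assume "\<exists>x. m dvd x * M - 1"
  then obtain x where x: "m dvd x * M - 1" by auto
  obtain u where u: "u \<in> {0..<m}" "m dvd x - u" using division assms by force
  have "m dvd (x * M - 1) - (x - u) * M" using dvd_diff[OF x dvd_mult2[OF u(2), of M]] .
  then have "m dvd u * M - 1" by (simp add: algebra_simps)
  then obtain k where k: "u * M - 1 = m * k" by auto
  have uM: "0 \<le> u * M" using u assms by simp
  have "\<not> k + 1 \<le> 0"
  proof
    assume "k + 1 \<le> 0"
    then have "m * (k + 1) \<le> 0" using assms by (simp add: mult_le_0_iff)
    then show False using k uM assms by (simp add: algebra_simps)
  qed
  then have "0 \<le> k" using discrete[of k 0] by force
  moreover have "1 * k \<le> m * k" using assms \<open>0 \<le> k\<close> by (intro mult_right_mono) auto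
  ultimately have "k \<in> {0..u * M}" using k by (auto simp: algebra_simps)
  then have "\<exists>v\<in>{0..u * M}. u * M = 1 + v * m"
    using k by (intro bexI[of _ k]) (auto simp: algebra_simps)
  moreover have "u \<in> {0..m}" using u by auto
  ultimately show "\<exists>u\<in>{0..m}. \<exists>v\<in>{0..u * M}. u * M = 1 + v * m" by blast
next
  assume "\<exists>u\<in>{0..m}. \<exists>v\<in>{0..u * M}. u * M = 1 + v * m"
  then obtain u v where "u * M = 1 + v * m" by auto
  then have "u * M - 1 = v * m" by simp
  then show "\<exists>x. m dvd x * M - 1" by (metis dvd_triv_right)
qed

text \<open>Chinese remaindering by Sigma-1 induction on the number \<open>k\<close> of positions
  treated. The induction carries, besides the code \<open>a\<close>, a common multiple
  \<open>M\<close> of the moduli treated so far that is invertible modulo each remaining one. As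
  \<open>G\<close> is a relation, the entries are chosen along the way.\<close>

lemma beta_code:
  assumes G: "D0 2 (\<lambda>e. G (e 0) (e 1))" and "0 \<le> n" "0 \<le> B"
    and total: "\<And>i. 0 \<le> i \<Longrightarrow> i < n \<Longrightarrow> \<exists>y\<in>{0..<B}. G i y"
  shows "\<exists>a\<ge>0. \<exists>b\<ge>0. \<forall>i\<in>{0..<n}. \<exists>y\<in>{0..<B}. G i y \<and> entry a b i y"
proof -
  obtain c where c: "0 < c" "\<forall>i\<in>{0..<n}. i + 1 dvd c" using common_multiple assms by blast
  \<comment> \<open>The factor \<open>c\<close> makes the moduli invertible modulo each other; the
    factor \<open>B + 1\<close> makes every modulus exceed the values to be coded.\<close>
  define b where "b = c * (B + 1)"
  have "0 < b" using c \<open>0 \<le> B\<close> by (simp add: b_def)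
  have dvd_b: "\<forall>i\<in>{0..<n}. i + 1 dvd b" using c by (auto simp: b_def)
  have "1 * (B + 1) \<le> b" unfolding b_def using c pos_ge_1 \<open>0 \<le> B\<close> by (intro mult_right_mono) auto
  then have "B \<le> b" by simp
  have b_le: "b < beta_mod b i" if "0 \<le> i" for i
    using that \<open>0 < b\<close> by (simp add: beta_mod_def algebra_simps add_pos_nonneg)
  let ?inv = "\<lambda>M j. \<exists>u\<in>{0..beta_mod b j}. \<exists>v\<in>{0..u * M}. u * M = 1 + v * beta_mod b j"
  have inv: "?inv M j \<longleftrightarrow> (\<exists>x. beta_mod b j dvd x * M - 1)" if "0 \<le> j" "0 \<le> M" for j M
    using b_le[OF that(1)] pos_ge_1[OF \<open>0 < b\<close>] that by (subst inverse_mod_iff_bounded) auto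
  have "\<exists>z\<in>{0..}. \<exists>a\<in>{0..z}. \<exists>M\<in>{0..z}. n < k \<or> (\<forall>i\<in>{0..<k}. \<exists>y\<in>{0..<B}. G i y \<and> entry a b i y) \<and>
      (\<forall>i\<in>{0..<k}. beta_mod b i dvd M) \<and> (\<forall>j\<in>{0..<n}. k \<le> j \<longrightarrow> ?inv M j)" if "0 \<le> k" for k
    using that
  proof (induction rule: induct)
    show "S1 1 (\<lambda>e. \<exists>z\<in>{0..}. \<exists>a\<in>{0..z}. \<exists>M\<in>{0..z}. n < e 0 \<or> (\<forall>i\<in>{0..<e 0}. \<exists>y\<in>{0..<B}. G i y \<and> entry a b i y) \<and>
      (\<forall>i\<in>{0..<e 0}. beta_mod b i dvd M) \<and> (\<forall>j\<in>{0..<n}. e 0 \<le> j \<longrightarrow> ?inv M j))"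
      by (rule S1_ex, unfold beta_mod_def, intro bounded_intros D0_entry D0_comp2[OF G]; use assms \<open>0 < b\<close> in simp)
  next
    have "?inv 1 j" if "j \<in> {0..<n}" for j
      using that by (subst inv) (auto intro: exI[of _ 1])
    then show "\<exists>z\<in>{0..}. \<exists>a\<in>{0..z}. \<exists>M\<in>{0..z}. n < 0 \<or> (\<forall>i\<in>{0..<0}. \<exists>y\<in>{0..<B}. G i y \<and> entry a b i y) \<and>
      (\<forall>i\<in>{0..<0}. beta_mod b i dvd M) \<and> (\<forall>j\<in>{0..<n}. 0 \<le> j \<longrightarrow> ?inv M j)"
      by (intro bexI[of _ 1] bexI[of _ "1 :: 'a"]) auto
  next
    fix k assume "0 \<le> k" and IH: "\<exists>z\<in>{0..}. \<exists>a\<in>{0..z}. \<exists>M\<in>{0..z}. n < k \<or> (\<forall>i\<in>{0..<k}. \<exists>y\<in>{0..<B}. G i y \<and> entry a b i y) \<and>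
      (\<forall>i\<in>{0..<k}. beta_mod b i dvd M) \<and> (\<forall>j\<in>{0..<n}. k \<le> j \<longrightarrow> ?inv M j)"
    show "\<exists>z\<in>{0..}. \<exists>a\<in>{0..z}. \<exists>M\<in>{0..z}. n < k + 1 \<or> (\<forall>i\<in>{0..<k + 1}. \<exists>y\<in>{0..<B}. G i y \<and> entry a b i y) \<and>
      (\<forall>i\<in>{0..<k + 1}. beta_mod b i dvd M) \<and> (\<forall>j\<in>{0..<n}. k + 1 \<le> j \<longrightarrow> ?inv M j)"
    proof (cases "n < k + 1")
      case True
      then show ?thesis by (intro bexI[of _ 0]) auto
    next
      case False
      then have "k < n" by (simp add: less_add_1)
      then obtain a M where aM: "0 \<le> a" "0 \<le> M" "\<forall>i\<in>{0..<k}. \<exists>y\<in>{0..<B}. G i y \<and> entry a b i y"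
        "\<forall>i\<in>{0..<k}. beta_mod b i dvd M" "\<forall>j\<in>{0..<n}. k \<le> j \<longrightarrow> ?inv M j"
        using IH by auto
      obtain y where y: "y \<in> {0..<B}" "G k y" using total \<open>0 \<le> k\<close> \<open>k < n\<close> by blast
      obtain x where x: "beta_mod b k dvd x * M - 1" using aM(5) inv \<open>0 \<le> k\<close> \<open>k < n\<close> aM(2) by force
      have pos: "0 < beta_mod b k" using \<open>0 \<le> k\<close> \<open>0 < b\<close> by (simp add: beta_mod_pos)
      \<comment> \<open>As \<open>x\<close> inverts \<open>M\<close> modulo the new modulus, adding
        \<open>M * w\<close> to \<open>a\<close> produces the remainder \<open>y\<close> there.
        Earlier remainders survive because \<open>M\<close> is a multiple of their moduli.\<close>
      obtain w where w: "w \<in> {0..<beta_mod b k}" "beta_mod b k dvd x * (y - a) - w"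
        using division[OF pos] by blast
      let ?a = "a + M * w" and ?M = "M * beta_mod b k"
      have entry_k: "entry ?a b k y"
      proof -
        have "?a - y = (x * M - 1) * (y - a) - M * (x * (y - a) - w)" by (simp add: algebra_simps)
        then have "beta_mod b k dvd ?a - y" using x w by simp
        then show ?thesis using y b_le[OF \<open>0 \<le> k\<close>] \<open>B \<le> b\<close> by (auto simp: entry_def)
      qed
      have entry_i: "entry ?a b i y" if "i \<in> {0..<k}" "entry a b i y" for i y
      proof -
        have "beta_mod b i dvd (a - y) + M * w"
          using aM(4) that by (intro dvd_add) (auto simp: entry_def)
        also have "(a - y) + M * w = ?a - y" by simp
        finally show ?thesis using that(2) by (simp add: entry_def)
      qed
      have c1: "\<exists>y\<in>{0..<B}. G i y \<and> entry ?a b i y" if "i \<in> {0..<k + 1}" for i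
      proof (cases "i = k")
        case True
        then show ?thesis using y entry_k by auto
      next
        case False
        then have "i \<in> {0..<k}" using that by (auto simp: less_add_1)
        then show ?thesis using aM(3) entry_i by blast
      qed
      have c2: "beta_mod b i dvd ?M" if "i \<in> {0..<k + 1}" for i
        using aM(4) that by (cases "i = k") (auto simp: less_add_1)
      have c3: "?inv ?M j" if "j \<in> {0..<n}" "k + 1 \<le> j" for j
      proof -
        have "k < j" using that(2) discrete by (metis less_add_one order_less_le_trans)
        have "0 \<le> j" "k \<le> j" using that(1) \<open>k < j\<close> by auto
        then have "\<exists>u. beta_mod b j dvd u * M - 1"
          using aM(5) that(1) inv[OF \<open>0 \<le> j\<close> aM(2)] by blast
        then obtain u where "beta_mod b j dvd u * M - 1" by blast
        moreover have "j < n" using that(1) by simp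
        from beta_mod_coprime[OF \<open>0 \<le> k\<close> \<open>k < j\<close> this dvd_b]
        obtain v where "beta_mod b j dvd v * beta_mod b k - 1" by blast
        ultimately have "beta_mod b j dvd (u * v) * ?M - 1" by (rule inverse_mod_mult)
        moreover have "0 \<le> ?M" using aM(2) pos by simp
        ultimately show ?thesis using inv[OF \<open>0 \<le> j\<close>] by blast
      qed
      have "0 \<le> ?a" "0 \<le> ?M" using aM pos w by auto
      moreover have "(\<forall>i\<in>{0..<k + 1}. \<exists>y\<in>{0..<B}. G i y \<and> entry ?a b i y) \<and>
          (\<forall>i\<in>{0..<k + 1}. beta_mod b i dvd ?M) \<and> (\<forall>j\<in>{0..<n}. k + 1 \<le> j \<longrightarrow> ?inv ?M j)"
        by (intro conjI ballI impI c1 c2 c3)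
      moreover have "?a \<in> {0..max ?a ?M}" "?M \<in> {0..max ?a ?M}" "max ?a ?M \<in> {0..}"
        using calculation(1,2) by auto
      ultimately show ?thesis by blast
    qed
  qed
  from this[OF \<open>0 \<le> n\<close>] obtain a where "0 \<le> a" "\<forall>i\<in>{0..<n}. \<exists>y\<in>{0..<B}. G i y \<and> entry a b i y"
    by auto
  with \<open>0 < b\<close> show ?thesis using less_imp_le by blast
qed

text \<open>The moduli of the old code may be too small for \<open>y\<close>, so the whole sequence
  is coded afresh; old entries are at most \<open>a\<close>, hence all values lie below
  \<open>a + y + 1\<close>.\<close>

lemma beta_append:
  assumes "0 \<le> a" "0 \<le> b" "0 \<le> n" "0 \<le> (y :: 'a)"
  shows "\<exists>a'\<ge>0. \<exists>b'\<ge>0. (\<forall>i\<in>{0..<n}. \<forall>w. entry a b i w \<longleftrightarrow> entry a' b' i w) \<and> entry a' b' n y"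
proof -
  let ?G = "\<lambda>(i :: 'a) (w :: 'a). i < n \<and> entry a b i w \<or> i = n \<and> w = y"
  have "\<exists>a'\<ge>0. \<exists>b'\<ge>0. \<forall>i\<in>{0..<n + 1}. \<exists>w\<in>{0..<a + y + 1}. ?G i w \<and> entry a' b' i w"
  proof (rule beta_code[of ?G])
    show "D0 2 (\<lambda>e. ?G (e 0) (e 1))" by (intro bounded_intros D0_entry; use assms in simp)
    fix i assume i: "0 \<le> i" "i < n + 1"
    show "\<exists>w\<in>{0..<a + y + 1}. ?G i w"
    proof (cases "i = n")
      case False
      obtain w where w: "entry a b i w" using entry_exists assms i by blast
      then have "w \<le> a" "0 \<le> w" using entry_le entry_nonneg assms i by blast+
      then show ?thesis using w False i assms by (intro bexI[of _ w]) (auto simp: less_add_1)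
    qed (use assms in \<open>auto simp: less_add_1 intro!: bexI[of _ y]\<close>)
  qed (use assms in auto)
  then obtain a' b' where ab: "0 \<le> a'" "0 \<le> b'"
    and *: "\<forall>i\<in>{0..<n + 1}. \<exists>w\<in>{0..<a + y + 1}. ?G i w \<and> entry a' b' i w" by blast
  have "entry a b i w \<longleftrightarrow> entry a' b' i w" if "i \<in> {0..<n}" for i w
  proof -
    have "i \<in> {0..<n + 1}" using that by (auto simp: less_add_1)
    then obtain v where "?G i v" "entry a' b' i v" using * by blast
    then have "entry a b i v" "entry a' b' i v" using that by auto
    then show ?thesis by (metis entry_unique)
  qed
  moreover have "entry a' b' n y" using *[rule_format, of n] assms by auto
  ultimately show ?thesis using ab by blast
qed

end

section \<open>Powers of two\<close>

text \<open>A bounded definition of the powers of two, so that no exponentiation is needed to define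
  the colouring.\<close>

definition is_pow2 :: "'a::linordered_idom \<Rightarrow> bool" where
  "is_pow2 q \<longleftrightarrow> 0 < q \<and> (\<forall>d\<in>{0..q}. d dvd q \<longrightarrow> d = 1 \<or> 2 dvd d)"

definition low_pow2 :: "'a::linordered_idom \<Rightarrow> 'a \<Rightarrow> bool" where
  "low_pow2 z l \<longleftrightarrow> is_pow2 l \<and> l dvd z \<and> (\<forall>q\<in>{0..z}. is_pow2 q \<and> q dvd z \<longrightarrow> q \<le> l)"

context arith
begin

lemma D0_is_pow2_var: "D0 1 (\<lambda>e. is_pow2 (e 0))"
  unfolding is_pow2_def by (intro bounded_intros; simp)

lemmas D0_pow2 = D0_comp1[OF D0_is_pow2_var]

lemma D0_low_pow2_var: "D0 2 (\<lambda>e. low_pow2 (e 0) (e 1))"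
  unfolding low_pow2_def by (intro bounded_intros D0_pow2; simp)

lemmas D0_low_pow2 = D0_comp2[OF D0_low_pow2_var]

lemma even_or_odd: "2 dvd x \<or> 2 dvd x - (1 :: 'a)"
proof -
  obtain r where r: "r \<in> {0..<2}" "2 dvd x - r" using division[of 2 x] by auto
  then have "r = 0 \<or> r = 1" using discrete[of 0 r] less_add_1[of r 1] by (cases "0 < r") auto
  then show ?thesis using r by auto
qed

text \<open>If \<open>2 * x = d * e\<close> with \<open>d\<close> odd, then \<open>e\<close> is
  even, being the difference of \<open>d * e\<close> and \<open>(d - 1) * e\<close>; the factor 2
  can be cancelled.\<close>

lemma odd_dvd_double:
  assumes "d dvd 2 * x" "\<not> 2 dvd d"
  shows "d dvd (x :: 'a)"
proof -
  obtain e where e: "2 * x = d * e" using assms(1) by auto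
  obtain q where "d - 1 = 2 * q" using even_or_odd[of d] assms(2) by auto
  then have "e = d * e - 2 * q * e" by (simp add: algebra_simps)
  also have "\<dots> = 2 * (x - q * e)" using e by (simp add: algebra_simps)
  finally have "2 * x = 2 * (d * (x - q * e))" using e by (metis mult.left_commute)
  then have "x = d * (x - q * e)" by (simp only: mult_cancel_left) simp
  then show ?thesis by (metis dvd_triv_left)
qed

lemma is_pow2_pos: "is_pow2 q \<Longrightarrow> 0 < q"
  by (simp add: is_pow2_def)

lemma is_pow2_1: "is_pow2 (1 :: 'a)"
  unfolding is_pow2_def using pos_ge_1 by (force simp: less_le)

lemma is_pow2_double: "is_pow2 q \<Longrightarrow> is_pow2 (2 * (q :: 'a))"
proof -
  assume q: "is_pow2 q"
  have "d = 1 \<or> 2 dvd d" if "0 \<le> d" "d dvd 2 * q" for d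
  proof (cases "2 dvd d")
    case False
    then have "d dvd q" using odd_dvd_double that by blast
    moreover from this have "d \<le> q" using dvd_le is_pow2_pos[OF q] by blast
    ultimately show ?thesis using q that by (auto simp: is_pow2_def)
  qed auto
  then show ?thesis using is_pow2_pos[OF q] by (auto simp: is_pow2_def)
qed

lemma is_pow2_half: "is_pow2 q \<Longrightarrow> q \<noteq> 1 \<Longrightarrow> \<exists>r. q = 2 * r \<and> is_pow2 (r :: 'a)"
proof -
  assume q: "is_pow2 q" "q \<noteq> 1"
  then have "2 dvd q" unfolding is_pow2_def by force
  then obtain r where r: "q = 2 * r" by auto
  then have "0 < r" using is_pow2_pos q(1) by force
  moreover have "d = 1 \<or> 2 dvd d" if "0 \<le> d" "d \<le> r" "d dvd r" for d
    using q(1) that r \<open>0 < r\<close> by (auto simp: is_pow2_def)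
  ultimately show ?thesis using r by (auto simp: is_pow2_def)
qed

text \<open>Both powers are halved until the smaller one is 1. The induction runs over a bound for
  the smaller power and keeps the larger one below the fixed \<open>r\<close>, so its formula is
  bounded.\<close>

lemma is_pow2_dvd:
  assumes "is_pow2 q" "is_pow2 r" "q \<le> (r :: 'a)"
  shows "q dvd r"
proof -
  have "0 \<le> q" "0 \<le> r" using assms is_pow2_pos less_imp_le by blast+
  from this(1) have "\<forall>q'\<in>{0..q}. \<forall>r'\<in>{0..r}. is_pow2 q' \<and> is_pow2 r' \<and> q' \<le> r' \<longrightarrow> q' dvd r'"
  proof (induction rule: induct0)
    show "D0 1 (\<lambda>e. \<forall>q'\<in>{0..e 0}. \<forall>r'\<in>{0..r}. is_pow2 q' \<and> is_pow2 r' \<and> q' \<le> r' \<longrightarrow> q' dvd r')"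
      by (intro bounded_intros D0_pow2; use \<open>0 \<le> r\<close> in simp)
  next
    fix x :: 'a
    assume "0 \<le> x" and IH: "\<forall>q'\<in>{0..x}. \<forall>r'\<in>{0..r}. is_pow2 q' \<and> is_pow2 r' \<and> q' \<le> r' \<longrightarrow> q' dvd r'"
    have "q' dvd r'" if "0 \<le> q'" "q' \<le> x + 1" "0 \<le> r'" "r' \<le> r" "is_pow2 q'" "is_pow2 r'" "q' \<le> r'" for q' r'
    proof (cases "q' = 1")
      case False
      from is_pow2_half[OF that(5) this] obtain q'' where q'': "q' = 2 * q''" "is_pow2 q''" by blast
      have "r' \<noteq> 1" using is_pow2_pos[OF q''(2)] q''(1) that(7) pos_ge_1[of q''] by auto
      from is_pow2_half[OF that(6) this] obtain r'' where r'': "r' = 2 * r''" "is_pow2 r''" by blast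
      have "1 \<le> q''" "1 \<le> r''" using pos_ge_1 is_pow2_pos q'' r'' by auto
      then have "q'' \<in> {0..x}" "r'' \<in> {0..r}" "q'' \<le> r''" using that q'' r'' by auto
      then have "q'' dvd r''" using IH q'' r'' by blast
      then show ?thesis using q'' r'' by simp
    qed simp
    then show "\<forall>q'\<in>{0..x + 1}. \<forall>r'\<in>{0..r}. is_pow2 q' \<and> is_pow2 r' \<and> q' \<le> r' \<longrightarrow> q' dvd r'" by auto
  qed (auto simp: is_pow2_def)
  then show ?thesis using assms \<open>0 \<le> q\<close> \<open>0 \<le> r\<close> by auto
qed

text \<open>The maximum is found as a least upper bound \<open>y\<close>, by the least number
  principle: \<open>y - 1\<close> is not an upper bound, so some power of two dividing
  \<open>z\<close> exceeds it and must equal \<open>y\<close>.\<close>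

lemma low_pow2_exists: "0 < z \<Longrightarrow> \<exists>l\<in>{0..z}. low_pow2 z (l :: 'a)"
proof -
  assume z: "0 < z"
  let ?Q = "\<lambda>x. \<forall>q\<in>{0..z}. is_pow2 q \<and> q dvd z \<longrightarrow> q \<le> x"
  have "D0 1 (\<lambda>e. ?Q (e 0))" by (intro bounded_intros D0_pow2; use z in simp)
  moreover have "0 \<le> z" "?Q z" using z by auto
  ultimately have "\<exists>y. 0 \<le> y \<and> y \<le> z \<and> ?Q y \<and> (\<forall>x\<in>{0..<y}. \<not> ?Q x)" by (rule least)
  then obtain y where y: "0 \<le> y" "y \<le> z" "?Q y" "\<forall>x\<in>{0..<y}. \<not> ?Q x" by blast
  have "1 \<le> y" using y(3) is_pow2_1 pos_ge_1[OF z] by auto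
  then have "\<not> ?Q (y - 1)" using y(4) by auto
  then obtain q where q: "q \<in> {0..z}" "is_pow2 q" "q dvd z" "y - 1 < q" by (auto simp: not_le)
  then have "q = y" using y(3) discrete[of "y - 1" q] by (auto intro: antisym)
  then show ?thesis using q y unfolding low_pow2_def by blast
qed

lemma low_pow2_unique: "low_pow2 z l \<Longrightarrow> low_pow2 z k \<Longrightarrow> 0 < z \<Longrightarrow> l = (k :: 'a)"
  unfolding low_pow2_def by (metis antisym atLeastAtMost_iff dvd_le less_imp_le is_pow2_pos)

text \<open>\<open>h\<close> and \<open>z\<close> are divisible by the same powers of two. One that
  divides \<open>h\<close> is at most \<open>P\<close>, hence divides \<open>P\<close> and
  \<open>z - h\<close>. One that divides \<open>z\<close> cannot exceed \<open>P\<close>, as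
  otherwise \<open>P\<close> would divide \<open>z\<close> and so \<open>h\<close>, although
  \<open>0 < h < P\<close>.\<close>

lemma low_pow2_add:
  assumes "0 < h" "h < P" "is_pow2 P" "P dvd z - h" "0 < z"
  shows "low_pow2 z l \<longleftrightarrow> low_pow2 h (l :: 'a)"
proof -
  have iff: "q dvd z \<longleftrightarrow> q dvd h" if "is_pow2 q" for q
  proof
    assume "q dvd h"
    then have "q \<le> P" using dvd_le assms by force
    then have "q dvd (z - h) + h" using is_pow2_dvd[OF that assms(3)] assms(4) \<open>q dvd h\<close> dvd_trans dvd_add by blast
    then show "q dvd z" by simp
  next
    assume q: "q dvd z"
    have "q \<le> P"
    proof (rule ccontr)
      assume "\<not> q \<le> P"
      then have "P dvd q" using is_pow2_dvd[OF assms(3) that] by auto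
      then have "P dvd z - (z - h)" using q assms(4) dvd_trans dvd_diff by blast
      then show False using dvd_le assms by force
    qed
    then have "q dvd z - (z - h)" using is_pow2_dvd[OF that assms(3)] assms(4) q dvd_trans dvd_diff by blast
    then show "q dvd h" by simp
  qed
  have "q \<in> {0..x}" if "q dvd x" "0 < x" "is_pow2 q" for q x :: 'a
    using dvd_le[OF that(1,2)] less_imp_le[OF is_pow2_pos[OF that(3)]] by simp
  then show ?thesis unfolding low_pow2_def using iff assms by blast
qed

end

section \<open>The semantics of the coded notions\<close>

context arith
begin

text \<open>This and the following predicates keep the quantifier structure of the coded formulas,
  with ranges over the nonnegative elements, so that the translations can be read off from the
  satisfaction clauses.\<close>

definition incr :: "'a \<Rightarrow> 'a \<Rightarrow> 'a \<Rightarrow> bool" where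
  "incr a b q \<longleftrightarrow> (\<forall>i\<in>{0..}. i < q \<longrightarrow>
    (\<forall>u\<in>{0..}. \<forall>v\<in>{0..}. entry a b i u \<and> entry a b (i + 1) v \<longrightarrow> u < v))"

definition ssum :: "'a \<Rightarrow> 'a \<Rightarrow> 'a \<Rightarrow> 'a \<Rightarrow> 'a \<Rightarrow> bool" where
  "ssum a b i j z \<longleftrightarrow> (\<exists>c\<in>{0..}. \<exists>d\<in>{0..}. entry c d i 0 \<and>
    (\<forall>l\<in>{0..}. i \<le> l \<and> l \<le> j \<longrightarrow>
      (\<forall>u\<in>{0..}. \<forall>v\<in>{0..}. entry c d l u \<and> entry a b l v \<longrightarrow> entry c d (l + 1) (u + v))) \<and>
    entry c d (j + 1) z)"

definition power_two :: "'a \<Rightarrow> 'a \<Rightarrow> bool" where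
  "power_two t y \<longleftrightarrow> (\<exists>a\<in>{0..}. \<exists>b\<in>{0..}. entry a b 0 1 \<and>
    (\<forall>i\<in>{0..}. i < t \<longrightarrow> (\<forall>u\<in>{0..}. entry a b i u \<longrightarrow> entry a b (i + 1) (u + u))) \<and> entry a b t y)"

definition exponents :: "'a \<Rightarrow> 'a \<Rightarrow> 'a \<Rightarrow> 'a \<Rightarrow> bool" where
  "exponents n a b q \<longleftrightarrow> incr a b q \<and> (\<exists>c\<in>{0..}. \<exists>d\<in>{0..}.
    (\<forall>i\<in>{0..}. i \<le> q \<longrightarrow>
      (\<forall>t\<in>{0..}. \<forall>y\<in>{0..}. entry a b i t \<and> entry c d i y \<longrightarrow> power_two t y)) \<and> ssum c d 0 q n)"

definition enum :: "'a set \<Rightarrow> 'a \<Rightarrow> 'a \<Rightarrow> 'a \<Rightarrow> bool" where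
  "enum H a b j \<longleftrightarrow> incr a b j \<and>
    (\<forall>x\<in>{0..}. x \<in> H \<and> (\<exists>w\<in>{0..}. entry a b j w \<and> x \<le> w) \<longleftrightarrow> (\<exists>i\<in>{0..}. i \<le> j \<and> entry a b i x))"

definition adjacent_sum :: "'a set \<Rightarrow> 'a \<Rightarrow> bool" where
  "adjacent_sum H z \<longleftrightarrow>
    (\<exists>a\<in>{0..}. \<exists>b\<in>{0..}. \<exists>i\<in>{0..}. \<exists>j\<in>{0..}. i \<le> j \<and> enum H a b j \<and> ssum a b i j z)"

definition apart_set :: "'a set \<Rightarrow> bool" where
  "apart_set H \<longleftrightarrow> (\<forall>x\<in>{0..}. \<forall>y\<in>{0..}. x \<in> H \<and> y \<in> H \<and> x < y \<longrightarrow>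
    (\<exists>m\<in>{0..}. \<exists>l\<in>{0..}.
      (\<exists>a\<in>{0..}. \<exists>b\<in>{0..}. \<exists>q\<in>{0..}. exponents x a b q \<and> entry a b q m) \<and>
      (\<exists>a\<in>{0..}. \<exists>b\<in>{0..}. \<exists>q\<in>{0..}. exponents y a b q \<and> entry a b 0 l) \<and> m < l))"

definition pairing :: "'a \<Rightarrow> 'a \<Rightarrow> 'a" where
  "pairing i j = (i + j) * (i + j) + i"

definition coloring :: "'a set \<Rightarrow> 'a \<Rightarrow> bool" where
  "coloring c n \<longleftrightarrow>
    (\<forall>w\<in>{0..}. w \<in> c \<longrightarrow> (\<exists>z\<in>{0..}. \<exists>i\<in>{0..}. i < n \<and> w = pairing z i)) \<and>
    (\<forall>z\<in>{0..}. \<exists>i\<in>{0..}. pairing z i \<in> c) \<and>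
    (\<forall>z\<in>{0..}. \<forall>i\<in>{0..}. \<forall>k\<in>{0..}. pairing z i \<in> c \<and> pairing z k \<in> c \<longrightarrow> i = k)"

definition adjacent_hindman :: bool where
  "adjacent_hindman \<longleftrightarrow> (\<forall>n\<in>{0..}. \<forall>c\<in>S. coloring c n \<longrightarrow>
    (\<exists>H\<in>S. (\<forall>x\<in>{0..}. \<exists>y\<in>{0..}. x < y \<and> y \<in> H) \<and> 0 \<notin> H \<and> apart_set H \<and>
      (\<exists>i\<in>{0..}. \<forall>z\<in>{0..}. adjacent_sum H z \<longrightarrow> pairing z i \<in> c)))"

section \<open>From coded formulas to predicates\<close>

abbreviation sat0 where "sat0 \<equiv> sat {0..} S"

lemma eval_nonneg: "range e \<subseteq> {0..} \<Longrightarrow> 0 \<le> (eval e t :: 'a)"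
  using eval_D by auto

lemma range_case_nat: "range (case_nat x e) \<subseteq> D \<longleftrightarrow> x \<in> D \<and> range e \<subseteq> D"
proof
  assume "range (case_nat x e) \<subseteq> D"
  then have "case_nat x e i \<in> D" for i by blast
  from this[of 0] this[of "Suc i" for i] show "x \<in> D \<and> range e \<subseteq> D" by auto
qed (auto simp: image_subset_iff split: nat.split)

lemma case_nat_numeral: "case_nat x f (numeral n) = f (pred_numeral n)"
  by (simp add: numeral_eq_Suc)

lemma case_nat_add_numeral: "case_nat x f (i + numeral n) = f (i + pred_numeral n)"
  by (simp add: numeral_eq_Suc)

lemma le_simps: "a < b \<or> a = b \<longleftrightarrow> a \<le> b" "\<not> a < b \<and> a \<noteq> b \<longleftrightarrow> \<not> a \<le> (b :: 'a)"
  by auto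

lemma sat_beta:
  assumes "range e \<subseteq> {0..}"
  shows "sat0 e s' (beta a b i y) \<longleftrightarrow> entry (eval e a) (eval e b) (eval e i) (eval e y)"
  using eval_nonneg[OF assms] by (simp add: beta_def Let_def entry_iff beta_mod_def Bex_def)

lemmas sat_simps = range_case_nat case_nat_numeral case_nat_add_numeral le_simps sat_beta

lemma sat_pow2:
  "range e \<subseteq> {0..} \<Longrightarrow> sat0 e s' (pow2 t y) \<longleftrightarrow> power_two (eval e t) (eval e y)"
  unfolding pow2_def power_two_def by (simp add: sat_simps)

lemma sat_seq_sum:
  "range e \<subseteq> {0..} \<Longrightarrow> sat0 e s' (seq_sum a b i j z) \<longleftrightarrow>
    ssum (eval e a) (eval e b) (eval e i) (eval e j) (eval e z)"
  unfolding seq_sum_def ssum_def by (simp add: sat_simps) blast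

lemma sat_seq_incr:
  "range e \<subseteq> {0..} \<Longrightarrow> sat0 e s' (seq_incr a b q) \<longleftrightarrow> incr (eval e a) (eval e b) (eval e q)"
  unfolding seq_incr_def incr_def by (simp add: sat_simps)

lemma sat_binary_exponents:
  "range e \<subseteq> {0..} \<Longrightarrow> sat0 e s' (binary_exponents n a b q) \<longleftrightarrow>
    exponents (eval e n) (eval e a) (eval e b) (eval e q)"
  unfolding binary_exponents_def exponents_def
  by (simp add: sat_simps sat_seq_incr sat_pow2 sat_seq_sum) blast

lemma sat_Con: "sat0 e s' (\<phi> \<^bold>\<and> \<psi>) \<longleftrightarrow> sat0 e s' \<phi> \<and> sat0 e s' \<psi>"
  by simp

lemma sat_AllN_Iff:
  "sat0 e s' (AllN (\<phi> \<^bold>\<longleftrightarrow> \<psi>)) \<longleftrightarrow> (\<forall>x\<in>{0..}. sat0 (case_nat x e) s' \<phi> \<longleftrightarrow> sat0 (case_nat x e) s' \<psi>)"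
  by auto

lemma sat_enumerates:
  "range e \<subseteq> {0..} \<Longrightarrow> sat0 e s' (enumerates H a b j) \<longleftrightarrow> enum (s' H) (eval e a) (eval e b) (eval e j)"
  unfolding enumerates_def enum_def sat_Con sat_AllN_Iff by (simp add: sat_simps sat_seq_incr)

lemma sat_mem_AS:
  "range e \<subseteq> {0..} \<Longrightarrow> sat0 e s' (mem_AS z H) \<longleftrightarrow> adjacent_sum (s' H) (eval e z)"
  unfolding mem_AS_def adjacent_sum_def by (simp add: sat_simps sat_enumerates sat_seq_sum)

lemma sat_apart: "range e \<subseteq> {0..} \<Longrightarrow> sat0 e s' (apart H) \<longleftrightarrow> apart_set (s' H)"
  unfolding apart_def apart_set_def mu_eq_def lambda_eq_def
  by (simp add: sat_simps sat_binary_exponents)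

lemma sat_maps_into:
  "range e \<subseteq> {0..} \<Longrightarrow> sat0 e s' (maps_into c k) \<longleftrightarrow> coloring (s' c) (eval e k)"
  unfolding maps_into_def coloring_def pairing_def pair_def by (simp add: sat_simps) blast

lemma sat_AHT: "range e \<subseteq> {0..} \<Longrightarrow> sat0 e s' AHT \<longleftrightarrow> adjacent_hindman"
  unfolding AHT_def AHT_colours_def adjacent_hindman_def unbounded_def
  by (simp add: sat_simps sat_maps_into sat_apart sat_mem_AS, simp add: pairing_def pair_def) blast

end

section \<open>Apartness and adjacent sums\<close>

context arith
begin

text \<open>Entries are bounded by the code, so statements about all entries at a position can be
  quantified boundedly in induction formulas.\<close>

lemma entry_mem: "0 \<le> a \<Longrightarrow> 0 \<le> b \<Longrightarrow> 0 \<le> i \<Longrightarrow> entry a b i u \<Longrightarrow> u \<in> {0..(a :: 'a)}"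
  by (auto intro: entry_le entry_nonneg)

lemma power_two_obtain:
  assumes "power_two t y"
  obtains a b where "0 \<le> a" "0 \<le> b" "entry a b 0 1" "entry a b t y"
    "\<And>i u. 0 \<le> i \<Longrightarrow> i < t \<Longrightarrow> entry a b i u \<Longrightarrow> entry a b (i + 1) (u + u)"
proof -
  obtain a b where ab: "a \<in> {0..}" "b \<in> {0..}" "entry a b 0 1" "entry a b t y"
    "\<forall>i\<in>{0..}. i < t \<longrightarrow> (\<forall>u\<in>{0..}. entry a b i u \<longrightarrow> entry a b (i + 1) (u + u))"
    using assms unfolding power_two_def by blast
  show thesis
  proof (rule that)
    fix i u assume "0 \<le> i" "i < t" "entry a b i u"
    then show "entry a b (i + 1) (u + u)" using ab(5) entry_nonneg by (metis atLeast_iff)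
  qed (use ab in auto)
qed

lemma ssum_obtain:
  assumes "ssum a b i j z"
  obtains c d where "0 \<le> c" "0 \<le> d" "entry c d i 0" "entry c d (j + 1) z"
    "\<And>l u v. 0 \<le> l \<Longrightarrow> i \<le> l \<Longrightarrow> l \<le> j \<Longrightarrow> entry c d l u \<Longrightarrow> entry a b l v \<Longrightarrow> entry c d (l + 1) (u + v)"
proof -
  obtain c d where cd: "c \<in> {0..}" "d \<in> {0..}" "entry c d i 0" "entry c d (j + 1) z"
    "\<forall>l\<in>{0..}. i \<le> l \<and> l \<le> j \<longrightarrow>
      (\<forall>u\<in>{0..}. \<forall>v\<in>{0..}. entry c d l u \<and> entry a b l v \<longrightarrow> entry c d (l + 1) (u + v))"
    using assms unfolding ssum_def by blast
  show thesis
  proof (rule that)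
    fix l u v assume "0 \<le> l" "i \<le> l" "l \<le> j" "entry c d l u" "entry a b l v"
    then show "entry c d (l + 1) (u + v)" using cd(5) entry_nonneg by (metis atLeast_iff)
  qed (use cd in auto)
qed

lemma incrD: "incr a b q \<Longrightarrow> 0 \<le> i \<Longrightarrow> i < q \<Longrightarrow> entry a b i u \<Longrightarrow> entry a b (i + 1) v \<Longrightarrow> u < v"
  unfolding incr_def using entry_nonneg by (metis atLeast_iff)

text \<open>Connects the coded sequence 1, 2, 4, ... with the definition by divisors, by induction
  along the sequence.\<close>

lemma power_two_pow2:
  assumes "power_two t y" "0 \<le> t"
  shows "is_pow2 (y :: 'a)"
proof -
  obtain a b where ab: "0 \<le> a" "0 \<le> b" "entry a b 0 1" "entry a b t y"
    and step: "\<And>i u. 0 \<le> i \<Longrightarrow> i < t \<Longrightarrow> entry a b i u \<Longrightarrow> entry a b (i + 1) (u + u)"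
    using power_two_obtain[OF assms(1)] by metis
  have "i \<le> t \<longrightarrow> (\<forall>u\<in>{0..a}. entry a b i u \<longrightarrow> is_pow2 u)" if "0 \<le> i" for i
    using that
  proof (induction rule: induct0)
    show "D0 1 (\<lambda>e. e 0 \<le> t \<longrightarrow> (\<forall>u\<in>{0..a}. entry a b (e 0) u \<longrightarrow> is_pow2 u))"
      by (intro bounded_intros D0_entry D0_pow2; use assms ab in simp)
  next
    show "0 \<le> t \<longrightarrow> (\<forall>u\<in>{0..a}. entry a b 0 u \<longrightarrow> is_pow2 u)"
      using ab(3) entry_unique is_pow2_1 by metis
  next
    fix i assume i: "0 \<le> i" and IH: "i \<le> t \<longrightarrow> (\<forall>u\<in>{0..a}. entry a b i u \<longrightarrow> is_pow2 u)"
    have "is_pow2 v" if "i + 1 \<le> t" "entry a b (i + 1) v" for v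
    proof -
      obtain u where u: "entry a b i u" using entry_exists ab i by blast
      then have "u \<in> {0..a}" using entry_mem[OF ab(1,2) i] by blast
      moreover have "i < t" "i \<le> t" using that(1) less_add_1[of i i] by auto
      ultimately have "is_pow2 u" "entry a b (i + 1) (u + u)" using IH u step i by auto
      then show ?thesis using is_pow2_double entry_unique that(2) by (metis mult_2)
    qed
    then show "i + 1 \<le> t \<longrightarrow> (\<forall>u\<in>{0..a}. entry a b (i + 1) u \<longrightarrow> is_pow2 u)" by auto
  qed
  from this[of t] assms(2) ab(4) entry_mem[OF ab(1,2) assms(2) ab(4)] show ?thesis by blast
qed

text \<open>The two witnesses may be different codes. They agree up to \<open>t\<close>, so
  \<open>y\<close> is also the entry at \<open>t\<close> of the longer sequence, and all entries
  after it are multiples of \<open>2 * y\<close>.\<close>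

lemma power_two_less_dvd:
  assumes "power_two t y" "power_two t' y'" "0 \<le> t" "t < t'"
  shows "2 * y dvd (y' :: 'a)"
proof -
  obtain a b where ab: "0 \<le> a" "0 \<le> b" "entry a b 0 1" "entry a b t y"
    and step: "\<And>i u. 0 \<le> i \<Longrightarrow> i < t \<Longrightarrow> entry a b i u \<Longrightarrow> entry a b (i + 1) (u + u)"
    using power_two_obtain[OF assms(1)] by metis
  obtain a' b' where ab': "0 \<le> a'" "0 \<le> b'" "entry a' b' 0 1" "entry a' b' t' y'"
    and step': "\<And>i u. 0 \<le> i \<Longrightarrow> i < t' \<Longrightarrow> entry a' b' i u \<Longrightarrow> entry a' b' (i + 1) (u + u)"
    using power_two_obtain[OF assms(2)] by metis
  have agree: "i \<le> t \<longrightarrow> (\<forall>u\<in>{0..a}. entry a b i u \<longrightarrow> entry a' b' i u)" if "0 \<le> i" for i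
    using that
  proof (induction rule: induct0)
    show "D0 1 (\<lambda>e. e 0 \<le> t \<longrightarrow> (\<forall>u\<in>{0..a}. entry a b (e 0) u \<longrightarrow> entry a' b' (e 0) u))"
      by (intro bounded_intros D0_entry; use assms ab ab' in simp)
  next
    show "0 \<le> t \<longrightarrow> (\<forall>u\<in>{0..a}. entry a b 0 u \<longrightarrow> entry a' b' 0 u)"
      using ab(3) ab'(3) entry_unique by metis
  next
    fix i assume i: "0 \<le> i" and IH: "i \<le> t \<longrightarrow> (\<forall>u\<in>{0..a}. entry a b i u \<longrightarrow> entry a' b' i u)"
    have "entry a' b' (i + 1) v" if "i + 1 \<le> t" "entry a b (i + 1) v" for v
    proof -
      obtain u where u: "entry a b i u" using entry_exists ab i by blast
      then have "u \<in> {0..a}" using entry_mem[OF ab(1,2) i] by blast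
      moreover have "i < t" "i \<le> t" using that(1) less_add_1[of i i] by auto
      ultimately have "entry a' b' (i + 1) (u + u)" "entry a b (i + 1) (u + u)"
        using IH u step step' i assms(4) by auto
      then show ?thesis using entry_unique that(2) by metis
    qed
    then show "i + 1 \<le> t \<longrightarrow> (\<forall>u\<in>{0..a}. entry a b (i + 1) u \<longrightarrow> entry a' b' (i + 1) u)" by auto
  qed
  have "y \<in> {0..a}" using entry_mem[OF ab(1,2) assms(3) ab(4)] .
  then have t: "entry a' b' t y" using agree[OF assms(3)] ab(4) by blast
  have "t < i \<and> i \<le> t' \<longrightarrow> (\<forall>u\<in>{0..a'}. entry a' b' i u \<longrightarrow> 2 * y dvd u)" if "0 \<le> i" for i
    using that
  proof (induction rule: induct0)
    show "D0 1 (\<lambda>e. t < e 0 \<and> e 0 \<le> t' \<longrightarrow> (\<forall>u\<in>{0..a'}. entry a' b' (e 0) u \<longrightarrow> 2 * y dvd u))"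
      by (intro bounded_intros D0_entry; use assms ab ab' \<open>y \<in> {0..a}\<close> in simp)
  next
    fix i assume i: "0 \<le> i" and IH: "t < i \<and> i \<le> t' \<longrightarrow> (\<forall>u\<in>{0..a'}. entry a' b' i u \<longrightarrow> 2 * y dvd u)"
    have "2 * y dvd v" if "t < i + 1" "i + 1 \<le> t'" "entry a' b' (i + 1) v" for v
    proof -
      obtain u where u: "entry a' b' i u" using entry_exists ab' i by blast
      then have "u \<in> {0..a'}" using entry_mem[OF ab'(1,2) i] by blast
      have "i < t'" using that(2) less_add_1[of i i] by auto
      then have v: "v = 2 * u" using step' u i that(3) entry_unique by (metis mult_2)
      show ?thesis
      proof (cases "t < i")
        case True
        then have "2 * y dvd u" using IH u \<open>u \<in> {0..a'}\<close> \<open>i < t'\<close> by auto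
        then show ?thesis unfolding v by (rule dvd_mult)
      next
        case False
        then have "t = i" using that(1) less_add_1[of t i] by auto
        then have "u = y" using entry_unique t u by blast
        then show ?thesis using v by simp
      qed
    qed
    then show "t < i + 1 \<and> i + 1 \<le> t' \<longrightarrow> (\<forall>u\<in>{0..a'}. entry a' b' (i + 1) u \<longrightarrow> 2 * y dvd u)" by auto
  qed (use assms in auto)
  moreover have "0 \<le> t'" using assms by auto
  moreover from this have "y' \<in> {0..a'}" using entry_mem[OF ab'(1,2) _ ab'(4)] by blast
  ultimately show ?thesis using assms(4) ab'(4) by blast
qed

text \<open>Exposes the hidden sequences: \<open>(c, d)\<close> codes the powers of two and
  \<open>(g, h)\<close> their partial sums. The increase of the exponents survives as the fact that
  twice a power divides the next one.\<close>

lemma exponents_obtain: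
  assumes "exponents n a b q" "0 \<le> a" "0 \<le> b" "0 \<le> q"
  obtains c d g h where "0 \<le> c" "0 \<le> d" "0 \<le> g" "0 \<le> h" "entry g h 0 0" "entry g h (q + 1) n"
    "\<And>i t y. 0 \<le> i \<Longrightarrow> i \<le> q \<Longrightarrow> entry a b i t \<Longrightarrow> entry c d i y \<Longrightarrow> power_two t y"
    "\<And>i y z. 0 \<le> i \<Longrightarrow> i < q \<Longrightarrow> entry c d i y \<Longrightarrow> entry c d (i + 1) z \<Longrightarrow> 2 * y dvd z"
    "\<And>i u v. 0 \<le> i \<Longrightarrow> i \<le> q \<Longrightarrow> entry g h i u \<Longrightarrow> entry c d i v \<Longrightarrow> entry g h (i + 1) (u + v)"
proof -
  obtain c d where cd: "c \<in> {0..}" "d \<in> {0..}" "ssum c d 0 q n" and pow':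
    "\<forall>i\<in>{0..}. i \<le> q \<longrightarrow> (\<forall>t\<in>{0..}. \<forall>y\<in>{0..}. entry a b i t \<and> entry c d i y \<longrightarrow> power_two t y)"
    using assms(1) unfolding exponents_def by blast
  have pow: "power_two t y" if "0 \<le> i" "i \<le> q" "entry a b i t" "entry c d i y" for i t y
    using pow' that entry_nonneg by (metis atLeast_iff)
  have incr: "incr a b q" using assms(1) by (simp add: exponents_def)
  obtain g h where "0 \<le> g" "0 \<le> h" "entry g h 0 0" "entry g h (q + 1) n"
    "\<And>i u v. 0 \<le> i \<Longrightarrow> i \<le> q \<Longrightarrow> entry g h i u \<Longrightarrow> entry c d i v \<Longrightarrow> entry g h (i + 1) (u + v)"
    using ssum_obtain[OF cd(3)] by metis
  moreover have "2 * y dvd z" if "0 \<le> i" "i < q" "entry c d i y" "entry c d (i + 1) z" for i y z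
  proof -
    from entry_exists[OF assms(3) that(1)] obtain t where t: "entry a b i t" by blast
    have "0 \<le> i + 1" "i + 1 \<le> q" "i \<le> q" using that discrete[of i q] by auto
    moreover obtain t' where t': "entry a b (i + 1) t'" using entry_exists assms(3) calculation(1) by blast
    moreover have "t < t'"
      using incrD[OF incr that(1,2) t t'] .
    moreover have "0 \<le> t" using entry_nonneg t by blast
    ultimately show ?thesis using power_two_less_dvd pow that t by metis
  qed
  moreover have "0 \<le> c" "0 \<le> d" using cd by auto
  ultimately show thesis using that[of c d g h] pow by blast
qed

text \<open>The lowest power divides all the others, hence every partial sum.\<close>

lemma lambda_dvd:
  assumes "exponents n a b q" "entry a b 0 l" "0 \<le> a" "0 \<le> b" "0 \<le> q"
  shows "\<exists>y. power_two l y \<and> y dvd (n :: 'a)"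
proof -
  obtain c d g h where *: "0 \<le> c" "0 \<le> d" "0 \<le> g" "0 \<le> h" "entry g h 0 0" "entry g h (q + 1) n"
    "\<And>i t y. 0 \<le> i \<Longrightarrow> i \<le> q \<Longrightarrow> entry a b i t \<Longrightarrow> entry c d i y \<Longrightarrow> power_two t y"
    and double: "\<And>i y z. 0 \<le> i \<Longrightarrow> i < q \<Longrightarrow> entry c d i y \<Longrightarrow> entry c d (i + 1) z \<Longrightarrow> 2 * y dvd z"
    and sum: "\<And>i u v. 0 \<le> i \<Longrightarrow> i \<le> q \<Longrightarrow> entry g h i u \<Longrightarrow> entry c d i v \<Longrightarrow> entry g h (i + 1) (u + v)"
    by (rule exponents_obtain[OF assms(1,3-5)]) (rule that)
  obtain y where y: "entry c d 0 y" using entry_exists * by blast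
  have "0 \<le> y" using entry_nonneg y by blast
  have dvd1: "i \<le> q \<longrightarrow> (\<forall>u\<in>{0..c}. entry c d i u \<longrightarrow> y dvd u)" if "0 \<le> i" for i
    using that
  proof (induction rule: induct0)
    show "D0 1 (\<lambda>e. e 0 \<le> q \<longrightarrow> (\<forall>u\<in>{0..c}. entry c d (e 0) u \<longrightarrow> y dvd u))"
      by (intro bounded_intros D0_entry; use assms * \<open>0 \<le> y\<close> in simp)
  next
    fix i assume i: "0 \<le> i" and IH: "i \<le> q \<longrightarrow> (\<forall>u\<in>{0..c}. entry c d i u \<longrightarrow> y dvd u)"
    have "y dvd v" if "i + 1 \<le> q" "entry c d (i + 1) v" for v
    proof -
      obtain u where u: "entry c d i u" using entry_exists *(2) i by blast
      have "u \<in> {0..c}" using entry_mem[OF *(1,2) i u] .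
      moreover have "i < q" "i \<le> q" using that(1) less_add_1[of i i] by auto
      ultimately have "y dvd u" "2 * u dvd v" using IH double i u that by auto
      then show ?thesis using dvd_trans dvd_mult by metis
    qed
    then show "i + 1 \<le> q \<longrightarrow> (\<forall>u\<in>{0..c}. entry c d (i + 1) u \<longrightarrow> y dvd u)" by auto
  qed (use entry_unique[OF y] in auto)
  have "i \<le> q + 1 \<longrightarrow> (\<forall>u\<in>{0..g}. entry g h i u \<longrightarrow> y dvd u)" if "0 \<le> i" for i
    using that
  proof (induction rule: induct0)
    show "D0 1 (\<lambda>e. e 0 \<le> q + 1 \<longrightarrow> (\<forall>u\<in>{0..g}. entry g h (e 0) u \<longrightarrow> y dvd u))"
      by (intro bounded_intros D0_entry; use assms * \<open>0 \<le> y\<close> in simp)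
  next
    show "0 \<le> q + 1 \<longrightarrow> (\<forall>u\<in>{0..g}. entry g h 0 u \<longrightarrow> y dvd u)"
      using *(5) entry_unique by (metis dvd_0_right)
  next
    fix i assume i: "0 \<le> i" and IH: "i \<le> q + 1 \<longrightarrow> (\<forall>u\<in>{0..g}. entry g h i u \<longrightarrow> y dvd u)"
    have "y dvd w" if "i + 1 \<le> q + 1" "entry g h (i + 1) w" for w
    proof -
      obtain u v where uv: "entry g h i u" "entry c d i v" using entry_exists *(2,4) i by blast
      have "u \<in> {0..g}" "v \<in> {0..c}"
        using entry_mem[OF *(3,4) i uv(1)] entry_mem[OF *(1,2) i uv(2)] .
      moreover have "i \<le> q" "i \<le> q + 1" using that(1) by auto
      ultimately have "y dvd u" "y dvd v" "entry g h (i + 1) (u + v)" using IH dvd1 sum i uv by auto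
      then show ?thesis using entry_unique[OF that(2)] by (metis dvd_add)
    qed
    then show "i + 1 \<le> q + 1 \<longrightarrow> (\<forall>u\<in>{0..g}. entry g h (i + 1) u \<longrightarrow> y dvd u)" by auto
  qed
  from this[of "q + 1"] have "y dvd n"
    using assms(5) *(6) entry_mem[OF *(3,4) _ *(6)] by auto
  then show ?thesis using *(7) assms y by blast
qed

text \<open>A partial sum \<open>u\<close> stays below twice its last power \<open>v\<close>: if
  \<open>2 * v\<close> divides the next power \<open>v'\<close>, then
  \<open>u < 2 * v \<le> v'\<close>, so \<open>u + v' < 2 * v'\<close>.\<close>

lemma mu_less:
  assumes "exponents n a b q" "entry a b q m" "0 \<le> a" "0 \<le> b" "0 \<le> q"
  shows "\<exists>y. power_two m y \<and> n < 2 * (y :: 'a)"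
proof -
  obtain c d g h where *: "0 \<le> c" "0 \<le> d" "0 \<le> g" "0 \<le> h" "entry g h 0 0" "entry g h (q + 1) n"
    and pow: "\<And>i t y. 0 \<le> i \<Longrightarrow> i \<le> q \<Longrightarrow> entry a b i t \<Longrightarrow> entry c d i y \<Longrightarrow> power_two t y"
    and double: "\<And>i y z. 0 \<le> i \<Longrightarrow> i < q \<Longrightarrow> entry c d i y \<Longrightarrow> entry c d (i + 1) z \<Longrightarrow> 2 * y dvd z"
    and sum: "\<And>i u v. 0 \<le> i \<Longrightarrow> i \<le> q \<Longrightarrow> entry g h i u \<Longrightarrow> entry c d i v \<Longrightarrow> entry g h (i + 1) (u + v)"
    by (rule exponents_obtain[OF assms(1,3-5)]) (rule that)
  have pos: "0 < y" if "0 \<le> i" "i \<le> q" "entry c d i y" for i y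
  proof -
    from entry_exists[OF assms(4) that(1)] obtain t where "entry a b i t" by blast
    then show ?thesis using pow[OF that(1,2) _ that(3)] power_two_pow2 is_pow2_pos entry_nonneg by blast
  qed
  \<comment> \<open>Partial sums are shifted by one: position \<open>i + 1\<close> holds the sum of
    the powers at positions 0 to \<open>i\<close>.\<close>
  have "i \<le> q \<longrightarrow> (\<forall>u\<in>{0..g}. \<forall>v\<in>{0..c}. entry g h (i + 1) u \<and> entry c d i v \<longrightarrow> u < 2 * v)" if "0 \<le> i" for i
    using that
  proof (induction rule: induct0)
    show "D0 1 (\<lambda>e. e 0 \<le> q \<longrightarrow> (\<forall>u\<in>{0..g}. \<forall>v\<in>{0..c}. entry g h (e 0 + 1) u \<and> entry c d (e 0) v \<longrightarrow> u < 2 * v))"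
      by (intro bounded_intros D0_entry; use assms * in simp)
  next
    have "u < 2 * v" if "entry g h (0 + 1) u" "entry c d 0 v" for u v
      using sum[OF _ _ *(5) that(2)] that(1) entry_unique pos[of 0 v] that(2) assms(5)
      by (metis add_0 mult_2 less_add_same_cancel1 order_refl)
    then show "0 \<le> q \<longrightarrow> (\<forall>u\<in>{0..g}. \<forall>v\<in>{0..c}. entry g h (0 + 1) u \<and> entry c d 0 v \<longrightarrow> u < 2 * v)" by blast
  next
    fix i assume i: "0 \<le> i"
      and IH: "i \<le> q \<longrightarrow> (\<forall>u\<in>{0..g}. \<forall>v\<in>{0..c}. entry g h (i + 1) u \<and> entry c d i v \<longrightarrow> u < 2 * v)"
    have "u' < 2 * v'" if "i + 1 \<le> q" "entry g h (i + 1 + 1) u'" "entry c d (i + 1) v'" for u' v'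
    proof -
      have i1: "0 \<le> i + 1" using i by simp
      obtain u v where uv: "entry g h (i + 1) u" "entry c d i v" using entry_exists *(2,4) i i1 by blast
      have "u \<in> {0..g}" "v \<in> {0..c}"
        using entry_mem[OF *(3,4) i1 uv(1)] entry_mem[OF *(1,2) i uv(2)] .
      moreover have "i < q" "i \<le> q" using that(1) less_add_1[of i i] by auto
      ultimately have "u < 2 * v" "2 * v dvd v'" using IH uv double i that by auto
      moreover have "u' = u + v'" using sum[OF i1 that(1) uv(1) that(3)] that(2) entry_unique by blast
      moreover have "2 * v \<le> v'" using dvd_le calculation(2) pos i1 that by blast
      ultimately show ?thesis by simp
    qed
    then show "i + 1 \<le> q \<longrightarrow> (\<forall>u\<in>{0..g}. \<forall>v\<in>{0..c}. entry g h (i + 1 + 1) u \<and> entry c d (i + 1) v \<longrightarrow> u < 2 * v)"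
      by blast
  qed
  moreover obtain y where y: "entry c d q y" using entry_exists *(2) assms(5) by blast
  moreover have "y \<in> {0..c}" using entry_mem[OF *(1,2) assms(5) y] .
  moreover have "n \<in> {0..g}" using entry_mem[OF *(3,4) _ *(6)] assms(5) by simp
  ultimately have "n < 2 * y" using *(6) assms(5) by blast
  then show ?thesis using pow assms y by blast
qed

text \<open>The separating power is twice the highest power of two in \<open>x\<close>; it divides
  the lowest one in \<open>y\<close>, as mu(x) < lambda(y). Later arguments use apartness in this
  form.\<close>

lemma apart_set_pow2:
  assumes "apart_set H" "0 \<le> x" "x \<in> H" "y \<in> H" "x < y"
  shows "\<exists>P. is_pow2 P \<and> x < P \<and> P dvd (y :: 'a)"
proof -
  have "0 \<le> y" using assms by simp
  then obtain m l a b q a' b' q' where *: "0 \<le> m" "0 \<le> l" "m < l" "0 \<le> a" "0 \<le> b" "0 \<le> q" "exponents x a b q" "entry a b q m"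
    "0 \<le> a'" "0 \<le> b'" "0 \<le> q'" "exponents y a' b' q'" "entry a' b' 0 l"
    using assms unfolding apart_set_def by (metis atLeast_iff)
  obtain u where u: "power_two m u" "x < 2 * u" using mu_less * by blast
  obtain v where v: "power_two l v" "v dvd y" using lambda_dvd * by blast
  have "2 * u dvd v" using power_two_less_dvd u v * by blast
  then show ?thesis using u v power_two_pow2 is_pow2_double * dvd_trans by blast
qed

section \<open>Enumerating initial segments and summing from a given element\<close>

lemma enum_exists:
  assumes "H \<in> S" "0 \<le> x" "x \<in> H"
  shows "\<exists>a\<ge>0. \<exists>b\<ge>0. \<exists>j\<ge>0. enum H a b j \<and> entry a b j (x :: 'a)"
proof -
  \<comment> \<open>\<open>(a, b)\<close> lists the elements of \<open>H\<close> below
    \<open>N\<close> in positions below \<open>l\<close>. Passing to \<open>N + 1\<close> keeps the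
    code or appends \<open>N\<close>. Order is recorded for all pairs of positions, not only for
    neighbours.\<close>
  let ?E = "\<lambda>N a b l. (\<forall>i\<in>{0..<l}. \<exists>y\<in>{0..<N}. y \<in> H \<and> entry a b i y) \<and>
    (\<forall>i\<in>{0..<l}. \<forall>k\<in>{0..<i}. \<forall>u\<in>{0..<N}. \<forall>v\<in>{0..<N}. entry a b k u \<and> entry a b i v \<longrightarrow> u < v) \<and>
    (\<forall>y\<in>{0..<N}. y \<in> H \<longrightarrow> (\<exists>i\<in>{0..<l}. entry a b i y))"
  have "\<exists>z\<in>{0..}. \<exists>a\<in>{0..z}. \<exists>b\<in>{0..z}. \<exists>l\<in>{0..z}. ?E N a b l" if "0 \<le> N" for N
    using that
  proof (induction rule: induct)
    show "S1 1 (\<lambda>e. \<exists>z\<in>{0..}. \<exists>a\<in>{0..z}. \<exists>b\<in>{0..z}. \<exists>l\<in>{0..z}. ?E (e 0) a b l)"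
      by (rule S1_ex, intro bounded_intros D0_entry; use assms in simp)
  next
    show "\<exists>z\<in>{0..}. \<exists>a\<in>{0..z}. \<exists>b\<in>{0..z}. \<exists>l\<in>{0..z}. ?E 0 a b l"
      by (intro bexI[of _ 0]) auto
  next
    fix N assume N: "0 \<le> N" and "\<exists>z\<in>{0..}. \<exists>a\<in>{0..z}. \<exists>b\<in>{0..z}. \<exists>l\<in>{0..z}. ?E N a b l"
    then obtain z a b l where "a \<in> {0..z}" "b \<in> {0..z}" "l \<in> {0..z}" and E: "?E N a b l" by blast
    then have abl: "0 \<le> a" "0 \<le> b" "0 \<le> l" by auto
    from E have E1: "\<forall>i\<in>{0..<l}. \<exists>y\<in>{0..<N}. y \<in> H \<and> entry a b i y"
      and E2: "\<forall>i\<in>{0..<l}. \<forall>k\<in>{0..<i}. \<forall>u\<in>{0..<N}. \<forall>v\<in>{0..<N}. entry a b k u \<and> entry a b i v \<longrightarrow> u < v"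
      and E3: "\<forall>y\<in>{0..<N}. y \<in> H \<longrightarrow> (\<exists>i\<in>{0..<l}. entry a b i y)" by blast+
    have "\<exists>a\<ge>0. \<exists>b\<ge>0. \<exists>l\<ge>0. ?E (N + 1) a b l"
    proof (cases "N \<in> H")
      case False
      have "u \<in> {0..<N}" if "i \<in> {0..<l}" "entry a b i u" for i u
        using E1 that entry_unique by metis
      then have "\<forall>i\<in>{0..<l}. \<forall>k\<in>{0..<i}. \<forall>u\<in>{0..<N + 1}. \<forall>v\<in>{0..<N + 1}. entry a b k u \<and> entry a b i v \<longrightarrow> u < v"
        using E2 by (meson atLeastLessThan_iff less_trans)
      moreover have "\<forall>i\<in>{0..<l}. \<exists>y\<in>{0..<N + 1}. y \<in> H \<and> entry a b i y"
        using E1 by (meson atLeastLessThan_iff less_add_one less_trans)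
      moreover have "\<forall>y\<in>{0..<N + 1}. y \<in> H \<longrightarrow> (\<exists>i\<in>{0..<l}. entry a b i y)"
        using E3 False by (auto simp: less_add_1 le_less)
      ultimately show ?thesis using abl by blast
    next
      case True
      obtain a' b' where ab': "0 \<le> a'" "0 \<le> b'" "entry a' b' l N"
        and old: "\<And>i w. i \<in> {0..<l} \<Longrightarrow> entry a' b' i w \<longleftrightarrow> entry a b i w"
        using beta_append[OF abl N] by blast
      have below: "u \<in> {0..<N}" if "i \<in> {0..<l}" "entry a' b' i u" for i u
        using E1 that entry_unique old by metis
      have split: "i \<in> {0..<l + 1} \<longleftrightarrow> i = l \<or> i \<in> {0..<l}" for i
        using abl by (auto simp: less_add_1 le_less)
      have "\<exists>y\<in>{0..<N + 1}. y \<in> H \<and> entry a' b' i y" if i: "i \<in> {0..<l + 1}" for i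
      proof (cases "i = l")
        case True
        then show ?thesis using ab' N \<open>N \<in> H\<close> by (intro bexI[of _ N]) auto
      next
        case False
        then have "i \<in> {0..<l}" using i split by blast
        then obtain y where "y \<in> {0..<N}" "y \<in> H" "entry a' b' i y" using E1 old by blast
        then show ?thesis by (intro bexI[of _ y]) auto
      qed
      moreover have "u < v" if "i \<in> {0..<l + 1}" "k \<in> {0..<i}" "entry a' b' k u" "entry a' b' i v" for i k u v
      proof (cases "i = l")
        case True
        then have "v = N" using that(4) ab'(3) entry_unique by blast
        then show ?thesis using below True that by auto
      next
        case False
        then have i: "i \<in> {0..<l}" using that(1) split by blast
        then have k: "k \<in> {0..<l}" using that(2) by auto
        show ?thesis using E2 i that(2-4) below[OF i that(4)] below[OF k that(3)] old[OF i] old[OF k] by blast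
      qed
      moreover have "\<exists>i\<in>{0..<l + 1}. entry a' b' i y" if "y \<in> {0..<N + 1}" "y \<in> H" for y
      proof (cases "y = N")
        case True
        then show ?thesis using ab'(3) split by blast
      next
        case False
        then have "y \<in> {0..<N}" using that(1) by (auto simp: less_add_1)
        then show ?thesis using E3 that(2) old split by blast
      qed
      moreover have "0 \<le> l + 1" using abl by simp
      ultimately show ?thesis using ab'(1,2) by blast
    qed
    then obtain a b l where "0 \<le> a" "0 \<le> b" "0 \<le> l" "?E (N + 1) a b l" by blast
    moreover from this have "a \<in> {0..a + b + l}" "b \<in> {0..a + b + l}" "l \<in> {0..a + b + l}" "a + b + l \<in> {0..}"
      by auto
    ultimately show "\<exists>z\<in>{0..}. \<exists>a\<in>{0..z}. \<exists>b\<in>{0..z}. \<exists>l\<in>{0..z}. ?E (N + 1) a b l" by blast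
  qed
  moreover have "0 \<le> x + 1" using assms by simp
  ultimately obtain z a b l where "a \<in> {0..z}" "b \<in> {0..z}" "l \<in> {0..z}" and E: "?E (x + 1) a b l" by blast
  then have abl: "0 \<le> a" "0 \<le> b" "0 \<le> l" by auto
  from E have E1: "\<forall>i\<in>{0..<l}. \<exists>y\<in>{0..<x + 1}. y \<in> H \<and> entry a b i y"
    and E2: "\<forall>i\<in>{0..<l}. \<forall>k\<in>{0..<i}. \<forall>u\<in>{0..<x + 1}. \<forall>v\<in>{0..<x + 1}. entry a b k u \<and> entry a b i v \<longrightarrow> u < v"
    and E3: "\<forall>y\<in>{0..<x + 1}. y \<in> H \<longrightarrow> (\<exists>i\<in>{0..<l}. entry a b i y)" by blast+
  have below: "u \<in> {0..<x + 1} \<and> u \<in> H" if "i \<in> {0..<l}" "entry a b i u" for i u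
    using E1 that entry_unique by metis
  have mono: "u < v" if "i \<in> {0..<l}" "k \<in> {0..<i}" "entry a b k u" "entry a b i v" for i k u v
  proof -
    have "k \<in> {0..<l}" using that by auto
    then show ?thesis using E2 that below by blast
  qed
  obtain i where i: "i \<in> {0..<l}" "entry a b i x" using E3 assms by auto
  \<comment> \<open>\<open>enumerates\<close> includes its last index. As the largest listed
    element, \<open>x\<close> occupies that position.\<close>
  define j where "j = l - 1"
  have j: "j \<in> {0..<l}" "0 \<le> j" using i pos_ge_1[of l] by (auto simp: j_def)
  have le_j: "k \<in> {0..<l} \<longleftrightarrow> 0 \<le> k \<and> k \<le> j" for k using less_add_1[of k j] by (simp add: j_def)
  have "i = j"
  proof (rule ccontr)
    assume "i \<noteq> j"
    then have "i \<in> {0..<j}" using i le_j by (auto simp: le_less)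
    moreover obtain w where w: "entry a b j w" using entry_exists abl j by blast
    ultimately have "x < w" using mono j i by blast
    then show False using below[OF j(1) w] by (auto simp: less_add_1)
  qed
  then have bj: "entry a b j x" using i by simp
  have "incr a b j"
    unfolding incr_def
  proof (intro ballI impI)
    fix k u v assume "k \<in> {0..}" "k < j" and uv: "entry a b k u \<and> entry a b (k + 1) v"
    then have k: "0 \<le> k + 1" "k + 1 \<le> j" "k \<in> {0..<k + 1}" using discrete by auto
    then have "k + 1 \<in> {0..<l}" using le_j by blast
    then show "u < v" using mono k(3) uv by blast
  qed
  moreover have "y \<in> H \<and> (\<exists>w\<in>{0..}. entry a b j w \<and> y \<le> w) \<longleftrightarrow> (\<exists>i\<in>{0..}. i \<le> j \<and> entry a b i y)"
    if "y \<in> {0..}" for y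
  proof
    assume "y \<in> H \<and> (\<exists>w\<in>{0..}. entry a b j w \<and> y \<le> w)"
    then obtain w where "y \<in> H" "entry a b j w" "y \<le> w" by blast
    moreover from this have "w = x" using entry_unique bj by blast
    ultimately have "y \<in> H" "y \<in> {0..<x + 1}" using that by (auto simp: less_add_1)
    then obtain i where "i \<in> {0..<l}" "entry a b i y" using E3 by blast
    then show "\<exists>i\<in>{0..}. i \<le> j \<and> entry a b i y" using le_j by auto
  next
    assume "\<exists>i\<in>{0..}. i \<le> j \<and> entry a b i y"
    then obtain i where "i \<in> {0..<l}" "entry a b i y" using le_j by auto
    then have "y \<in> H" "y \<le> x" using below by (auto simp: less_add_1)
    then show "y \<in> H \<and> (\<exists>w\<in>{0..}. entry a b j w \<and> y \<le> w)" using bj assms by auto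
  qed
  ultimately have "enum H a b j" unfolding enum_def by blast
  then show ?thesis using abl j bj by blast
qed

lemma enum_mem: "enum H a b j \<Longrightarrow> 0 \<le> i \<Longrightarrow> i \<le> j \<Longrightarrow> entry a b i y \<Longrightarrow> y \<in> H"
  unfolding enum_def using entry_nonneg by (metis atLeast_iff)

lemma enum_less:
  assumes "enum H a b j" "0 \<le> a" "0 \<le> b" "0 \<le> i" "i < k" "k \<le> j" "entry a b i x" "entry a b k y"
  shows "x < (y :: 'a)"
proof -
  have "i < l \<and> l \<le> j \<longrightarrow> (\<forall>y\<in>{0..a}. entry a b l y \<longrightarrow> x < y)" if "0 \<le> l" for l
    using that
  proof (induction rule: induct0)
    show "D0 1 (\<lambda>e. i < e 0 \<and> e 0 \<le> j \<longrightarrow> (\<forall>y\<in>{0..a}. entry a b (e 0) y \<longrightarrow> x < y))"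
      by (intro bounded_intros D0_entry; use assms entry_nonneg in simp)
  next
    fix l assume l: "0 \<le> l" and IH: "i < l \<and> l \<le> j \<longrightarrow> (\<forall>y\<in>{0..a}. entry a b l y \<longrightarrow> x < y)"
    have "x < v" if "i < l + 1" "l + 1 \<le> j" "entry a b (l + 1) v" for v
    proof -
      obtain u where u: "entry a b l u" using entry_exists assms(3) l by blast
      have "l < j" using that(2) less_add_1[of l l] by auto
      then have "u < v" using incrD[OF _ l _ u that(3)] assms(1) unfolding enum_def by blast
      moreover have "u \<in> {0..a}" using entry_mem[OF assms(2,3) l u] .
      moreover have "i = l \<or> i < l" using that(1) less_add_1[of i l] by auto
      ultimately show ?thesis
        using IH u \<open>l < j\<close> assms(7) entry_unique by (metis less_imp_le less_trans)
    qed
    then show "i < l + 1 \<and> l + 1 \<le> j \<longrightarrow> (\<forall>y\<in>{0..a}. entry a b (l + 1) y \<longrightarrow> x < y)" by blast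
  qed (use assms in auto)
  from this[of k] show ?thesis
    using assms entry_mem[OF assms(2,3) _ assms(8)] by auto
qed

text \<open>Some power of two above \<open>x\<close> is supplied by the caller: it will be the power
  separating \<open>x\<close> from a later element of a solution.\<close>

lemma least_pow2_above:
  assumes "is_pow2 P" "x < P"
  shows "\<exists>Q. is_pow2 Q \<and> x < Q \<and> (\<forall>R. is_pow2 R \<and> x < R \<longrightarrow> Q \<le> (R :: 'a))"
proof -
  have "x < 0 \<or> 0 \<le> x" by auto
  then show ?thesis
  proof
    assume "x < 0"
    then show ?thesis using is_pow2_1 is_pow2_pos pos_ge_1 by (metis less_trans zero_less_one)
  next
    assume x: "0 \<le> x"
    have "D0 1 (\<lambda>e. is_pow2 (e 0) \<and> x < e 0)" by (intro bounded_intros D0_pow2; use x in simp)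
    moreover have "0 \<le> P" using assms is_pow2_pos less_imp_le by blast
    ultimately have "\<exists>Q. 0 \<le> Q \<and> Q \<le> P \<and> (is_pow2 Q \<and> x < Q) \<and> (\<forall>z\<in>{0..<Q}. \<not> (is_pow2 z \<and> x < z))"
      using assms by (intro least) auto
    then obtain Q where "is_pow2 Q" "x < Q" "\<forall>z\<in>{0..<Q}. \<not> (is_pow2 z \<and> x < z)" by blast
    moreover from this(3) have "Q \<le> R" if "is_pow2 R" "x < R" for R
      using that is_pow2_pos[OF that(1)] by (metis atLeastLessThan_iff less_imp_le not_le)
    ultimately show ?thesis by blast
  qed
qed

text \<open>The summands run from \<open>x\<close> to an element of \<open>H\<close> beyond
  \<open>T\<close>. The least power of two above \<open>x\<close> divides every power separating
  \<open>x\<close> from a later element, hence every later summand, so one fixed \<open>P\<close>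
  serves as a parameter of the induction.\<close>

lemma adjacent_sum_beyond:
  assumes H: "H \<in> S" "\<forall>x\<in>{0..}. \<exists>y\<in>{0..}. x < y \<and> y \<in> H" "apart_set H"
    and x: "0 \<le> x" "x \<in> H" and "0 \<le> T"
  shows "\<exists>z\<ge>T. adjacent_sum H z \<and> (\<exists>P. is_pow2 P \<and> x < P \<and> P dvd z - (x :: 'a))"
proof -
  obtain y where y: "y \<in> H" "x + T < y" "0 \<le> y" using H(2) x(1) \<open>0 \<le> T\<close> by (metis add_nonneg_nonneg atLeast_iff)
  then have "x < y" "T < y" using x \<open>0 \<le> T\<close> by (auto intro: le_less_trans[rotated])
  obtain P0 where "is_pow2 P0" "x < P0" using apart_set_pow2[OF H(3) x y(1) \<open>x < y\<close>] by blast
  then obtain P where P: "is_pow2 P" "x < P" and P_least: "\<And>R. is_pow2 R \<Longrightarrow> x < R \<Longrightarrow> P \<le> R"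
    using least_pow2_above by blast
  have P_dvd: "P dvd w" if w: "w \<in> H" "x < w" for w
  proof -
    obtain R where R: "is_pow2 R" "x < R" "R dvd w" using apart_set_pow2[OF H(3) x w] by blast
    then have "P dvd R" using is_pow2_dvd P P_least by blast
    then show ?thesis using R dvd_trans by blast
  qed
  obtain a b j where abj: "0 \<le> a" "0 \<le> b" "0 \<le> j" "enum H a b j" "entry a b j y"
    using enum_exists H(1) y by blast
  obtain i where i: "0 \<le> i" "i \<le> j" "entry a b i x"
    using abj x \<open>x < y\<close> y(3) unfolding enum_def by (metis atLeast_iff less_imp_le)
  \<comment> \<open>\<open>(c, d)\<close> codes the partial sums from position \<open>i\<close> to
    \<open>k\<close>, with total \<open>w\<close>. The last two clauses carry the divisibility by
    \<open>P\<close> and a lower bound for \<open>w\<close>, which makes the final sum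
    large.\<close>
  let ?F = "\<lambda>k c d w. entry c d i 0 \<and> (\<forall>l\<in>{0..k}. i \<le> l \<longrightarrow>
      (\<forall>u\<in>{0..c}. \<forall>v\<in>{0..a}. entry c d l u \<and> entry a b l v \<longrightarrow> entry c d (l + 1) (u + v))) \<and>
    entry c d (k + 1) w \<and> (\<exists>v\<in>{0..w}. w = x + v \<and> P dvd v) \<and> (\<forall>v\<in>{0..a}. entry a b k v \<longrightarrow> v \<le> w)"
  have "\<exists>z\<in>{0..}. j < i + r \<or> (\<exists>c\<in>{0..z}. \<exists>d\<in>{0..z}. \<exists>w\<in>{0..z}. ?F (i + r) c d w)" if "0 \<le> r" for r
    using that
  proof (induction rule: induct)
    have "0 \<le> P" using P is_pow2_pos less_imp_le by blast
    show "S1 1 (\<lambda>e. \<exists>z\<in>{0..}. j < i + e 0 \<or> (\<exists>c\<in>{0..z}. \<exists>d\<in>{0..z}. \<exists>w\<in>{0..z}. ?F (i + e 0) c d w))"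
      by (rule S1_ex, intro bounded_intros D0_entry; use abj i x \<open>0 \<le> P\<close> in simp)
  next
    \<comment> \<open>The code (0, 0) is an arbitrary start: only the empty sum 0 at position
      \<open>i\<close> matters, and the next append puts \<open>x\<close> at
      \<open>i + 1\<close>.\<close>
    obtain c d where cd: "0 \<le> c" "0 \<le> d" "entry c d i 0"
      using beta_append[of 0 0 i 0] i(1) by auto
    have "0 \<le> i + 1" using i by simp
    obtain c' d' where cd': "0 \<le> c'" "0 \<le> d'" "entry c' d' (i + 1) x"
      and old: "\<And>l w. l \<in> {0..<i + 1} \<Longrightarrow> entry c d l w \<longleftrightarrow> entry c' d' l w"
      using beta_append[OF cd(1,2) \<open>0 \<le> i + 1\<close> x(1)] by blast
    have bt0: "entry c' d' i 0" using old[of i] cd(3) i(1) by simp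
    have "entry c' d' (l + 1) (u + v)" if "l \<in> {0..i + 0}" "i \<le> l" "entry c' d' l u" "entry a b l v" for l u v
    proof -
      have "l = i" using that by auto
      then have "u = 0" "v = x" using that bt0 i entry_unique by blast+
      then show ?thesis using cd' \<open>l = i\<close> by simp
    qed
    then have "\<forall>l\<in>{0..i + 0}. i \<le> l \<longrightarrow>
        (\<forall>u\<in>{0..c'}. \<forall>v\<in>{0..a}. entry c' d' l u \<and> entry a b l v \<longrightarrow> entry c' d' (l + 1) (u + v))" by blast
    moreover have "entry c' d' (i + 0 + 1) x" using cd'(3) by simp
    moreover have "\<exists>v\<in>{0..x}. x = x + v \<and> P dvd v" using x by (intro bexI[of _ 0]) auto
    moreover have "\<forall>v\<in>{0..a}. entry a b (i + 0) v \<longrightarrow> v \<le> x" using entry_unique[OF i(3)] by auto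
    ultimately have "?F (i + 0) c' d' x" using bt0 by blast
    moreover have "c' \<in> {0..c' + d' + x}" "d' \<in> {0..c' + d' + x}" "x \<in> {0..c' + d' + x}" "c' + d' + x \<in> {0..}"
      using cd' x by auto
    ultimately show "\<exists>z\<in>{0..}. j < i + 0 \<or> (\<exists>c\<in>{0..z}. \<exists>d\<in>{0..z}. \<exists>w\<in>{0..z}. ?F (i + 0) c d w)"
      by blast
  next
    fix r assume r: "0 \<le> r" and IH: "\<exists>z\<in>{0..}. j < i + r \<or> (\<exists>c\<in>{0..z}. \<exists>d\<in>{0..z}. \<exists>w\<in>{0..z}. ?F (i + r) c d w)"
    define k where "k = i + r"
    have k: "0 \<le> k" "i \<le> k" "i + (r + 1) = k + 1" using r i by (auto simp: k_def)
    show "\<exists>z\<in>{0..}. j < i + (r + 1) \<or> (\<exists>c\<in>{0..z}. \<exists>d\<in>{0..z}. \<exists>w\<in>{0..z}. ?F (i + (r + 1)) c d w)"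
    proof (cases "j < k + 1")
      case True
      then show ?thesis using k(3) by (intro bexI[of _ 0]) auto
    next
      case False
      then have "\<not> j < k" "k < j" "k + 1 \<le> j" using discrete[of k j] by (auto simp: less_add_1)
      then obtain z c d w where "c \<in> {0..z}" "d \<in> {0..z}" "w \<in> {0..z}" and F: "?F k c d w"
        using IH[folded k_def] by blast
      then have cdw: "0 \<le> c" "0 \<le> d" "0 \<le> w" by auto
      have k1: "0 \<le> k + 1" "0 \<le> k + 1 + 1" using k by auto
      obtain h where h: "entry a b (k + 1) h" using entry_exists abj(2) k1 by blast
      have "h \<in> H" using enum_mem[OF abj(4) k1(1) \<open>k + 1 \<le> j\<close> h] .
      have "x < h" using enum_less[OF abj(4,1,2) i(1) _ \<open>k + 1 \<le> j\<close> i(3) h] k less_add_1 by blast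
      have "0 \<le> w + h" using cdw entry_nonneg[OF h] by simp
      obtain c' d' where cd': "0 \<le> c'" "0 \<le> d'" "entry c' d' (k + 1 + 1) (w + h)"
        and old: "\<And>l w. l \<in> {0..<k + 1 + 1} \<Longrightarrow> entry c d l w \<longleftrightarrow> entry c' d' l w"
        using beta_append[OF cdw(1,2) k1(2) \<open>0 \<le> w + h\<close>] by blast
      have "entry c' d' (l + 1) (u + v)" if l: "l \<in> {0..k + 1}" "i \<le> l" "entry c' d' l u" "entry a b l v" for l u v
      proof (cases "l = k + 1")
        case True
        then have "entry c d (k + 1) u" using l(3) old[of "k + 1"] k by simp
        then have "u = w" using F entry_unique by blast
        moreover have "v = h" using True l(4) h entry_unique by blast
        ultimately show ?thesis using True cd' by simp
      next
        case False
        then have l': "l \<in> {0..k}" using l(1) less_add_1[of l k] by auto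
        then have "l \<in> {0..<k + 1 + 1}" "l + 1 \<in> {0..<k + 1 + 1}" by (auto simp: less_add_1)
        moreover from this have "entry c d l u" using old l(3) by blast
        moreover have "0 \<le> l" using l' by simp
        moreover have "u \<in> {0..c}" "v \<in> {0..a}"
          using entry_mem[OF cdw(1,2) \<open>0 \<le> l\<close> \<open>entry c d l u\<close>] entry_mem[OF abj(1,2) \<open>0 \<le> l\<close> l(4)] .
        ultimately show ?thesis using F l' l(2,4) old by blast
      qed
      then have "\<forall>l\<in>{0..k + 1}. i \<le> l \<longrightarrow>
          (\<forall>u\<in>{0..c'}. \<forall>v\<in>{0..a}. entry c' d' l u \<and> entry a b l v \<longrightarrow> entry c' d' (l + 1) (u + v))" by blast
      moreover have "entry c' d' i 0" using F old[of i] i k less_add_1[of i "k + 1"] by auto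
      moreover have "\<exists>v\<in>{0..w + h}. w + h = x + v \<and> P dvd v"
      proof -
        obtain v where "v \<in> {0..w}" "w = x + v" "P dvd v" using F by blast
        then show ?thesis
          using P_dvd[OF \<open>h \<in> H\<close> \<open>x < h\<close>] entry_nonneg[OF h] x by (intro bexI[of _ "v + h"]) auto
      qed
      moreover have "\<forall>v\<in>{0..a}. entry a b (k + 1) v \<longrightarrow> v \<le> w + h"
        using entry_unique[OF h] cdw by auto
      ultimately have "?F (k + 1) c' d' (w + h)" using cd'(3) by blast
      moreover have "c' \<in> {0..c' + d' + (w + h)}" "d' \<in> {0..c' + d' + (w + h)}"
        "w + h \<in> {0..c' + d' + (w + h)}" "c' + d' + (w + h) \<in> {0..}"
        using cd' \<open>0 \<le> w + h\<close> by auto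
      ultimately show ?thesis unfolding k(3) by blast
    qed
  qed
  moreover have "0 \<le> j - i" "i + (j - i) = j" using i by auto
  ultimately have "\<exists>z\<in>{0..}. j < j \<or> (\<exists>c\<in>{0..z}. \<exists>d\<in>{0..z}. \<exists>w\<in>{0..z}. ?F j c d w)" by metis
  then obtain z c d w where "c \<in> {0..z}" "d \<in> {0..z}" "w \<in> {0..z}" and F: "?F j c d w" by blast
  then have cdw: "0 \<le> c" "0 \<le> d" "0 \<le> w" by auto
  have "entry c d (l + 1) (u + v)" if "0 \<le> l" "i \<le> l" "l \<le> j" "entry c d l u" "entry a b l v" for l u v
    using F that entry_mem[OF cdw(1,2) that(1,4)] entry_mem[OF abj(1,2) that(1,5)] by auto
  then have "ssum a b i j w"
    unfolding ssum_def using F cdw by (intro bexI[of _ c] bexI[of _ d]) auto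
  then have "adjacent_sum H w" unfolding adjacent_sum_def using abj i by (metis atLeast_iff)
  moreover have "T \<le> w"
    using F abj(5) entry_mem[OF abj(1,2,3,5)] \<open>T < y\<close> by (meson less_imp_le order_trans)
  moreover have "P dvd w - x" using F by auto
  ultimately show ?thesis using P by blast
qed

end

section \<open>From the Adjacent Hindman Theorem to bounding\<close>

context arith
begin

section \<open>Injectivity of the pairing\<close>

lemma square_ge: "0 \<le> x \<Longrightarrow> x \<le> x * (x :: 'a)"
  using pos_ge_1[of x] mult_right_mono[of 1 x x] by (cases "x = 0") auto

lemma pairing_nonneg: "0 \<le> i \<Longrightarrow> 0 \<le> j \<Longrightarrow> 0 \<le> pairing i (j :: 'a)"
  by (simp add: pairing_def)

lemma pairing_ge: "0 \<le> i \<Longrightarrow> 0 \<le> j \<Longrightarrow> i \<le> pairing i j \<and> j \<le> pairing i (j :: 'a)"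
  using square_ge[of "i + j"] by (simp add: pairing_def)

text \<open>The code of a pair with sum \<open>m\<close> is at least the square of \<open>m\<close>
  and less than that of \<open>m + 1\<close>, so it determines the sum.\<close>

lemma pairing_sum_le:
  assumes "0 \<le> i" "0 \<le> j" "0 \<le> k" "0 \<le> l" "pairing i j = pairing k (l :: 'a)"
  shows "k + l \<le> i + j"
proof (rule ccontr)
  assume "\<not> k + l \<le> i + j"
  then have "i + j + 1 \<le> k + l" using discrete by auto
  then have "(i + j + 1) * (i + j + 1) \<le> (k + l) * (k + l)" using assms by (intro mult_mono) auto
  moreover have "pairing i j < (i + j + 1) * (i + j + 1)"
    using assms by (simp add: pairing_def algebra_simps add_pos_nonneg)
  ultimately show False using assms by (simp add: pairing_def)
qed

lemma pairing_inj:
  assumes "0 \<le> i" "0 \<le> j" "0 \<le> k" "0 \<le> l" "pairing i j = pairing k (l :: 'a)"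
  shows "i = k \<and> j = l"
proof -
  have "i + j = k + l" using pairing_sum_le[of i j k l] pairing_sum_le[of k l i j] assms by simp
  then show ?thesis using assms(5) by (simp add: pairing_def)
qed

text \<open>The combinatorial content of AHT in the form used for both bounding results: a colour
  that recurs cofinally in \<open>t\<close>, for cofinally many \<open>x\<close>. As
  \<open>C\<close> may admit several colours, the least one is taken.\<close>

theorem stable_pigeonhole:
  assumes AHT: adjacent_hindman
    and C: "D0 3 (\<lambda>e. C (e 0) (e 1) (e 2))" and n: "0 \<le> n"
    and total: "\<And>x t. 0 \<le> x \<Longrightarrow> 0 \<le> t \<Longrightarrow> \<exists>i\<in>{0..<n}. C x t i"
  shows "\<exists>i\<in>{0..<n}. \<forall>x0\<in>{0..}. \<exists>x\<in>{x0..}. \<forall>t0\<in>{0..}. \<exists>t\<in>{t0..}. C x t (i :: 'a)"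
proof -
  have "0 < n" using total[of 0 0] by auto
  \<comment> \<open>0 gets colour 0 separately: the bounded search for its low power finds nothing,
    since powers of two are positive.\<close>
  let ?Col = "\<lambda>z i. i < n \<and> (z = 0 \<and> i = 0 \<or>
    (\<exists>l\<in>{0..z}. low_pow2 z l \<and> C l z i \<and> (\<forall>k\<in>{0..<i}. \<not> C l z k)))"
  \<comment> \<open>Both components are at most the code of the pair, so the graph of the colouring
    is a bounded set of numbers.\<close>
  have "D0 1 (\<lambda>e. \<exists>z\<in>{0..e 0}. \<exists>i\<in>{0..e 0}. e 0 = pairing z i \<and> ?Col z i)"
    unfolding pairing_def by (intro bounded_intros D0_low_pow2 D0_comp3[OF C]; use n in simp)
  then obtain c where "c \<in> S"
    and c: "\<forall>w\<in>{0..}. w \<in> c \<longleftrightarrow> (\<exists>z\<in>{0..w}. \<exists>i\<in>{0..w}. w = pairing z i \<and> ?Col z i)"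
    using comprehension[of "\<lambda>w. \<exists>z\<in>{0..w}. \<exists>i\<in>{0..w}. w = pairing z i \<and> ?Col z i"] by blast
  have pairing_c: "pairing z i \<in> c \<longleftrightarrow> ?Col z i" if zi: "0 \<le> z" "0 \<le> i" for z i
  proof
    assume "pairing z i \<in> c"
    then obtain z' i' where *: "z' \<in> {0..pairing z i}" "i' \<in> {0..pairing z i}"
        "pairing z i = pairing z' i'" "?Col z' i'"
      using c pairing_nonneg[OF zi] by (metis atLeast_iff)
    then have "z = z' \<and> i = i'" using pairing_inj[OF that] by auto
    then show "?Col z i" using *(4) by blast
  next
    assume "?Col z i"
    moreover have "z \<in> {0..pairing z i}" "i \<in> {0..pairing z i}" "pairing z i \<in> {0..}"
      using that pairing_ge pairing_nonneg by auto
    ultimately show "pairing z i \<in> c" using c by blast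
  qed
  have col_total: "\<exists>i\<in>{0..}. ?Col z i" if "0 \<le> z" for z
  proof (cases "z = 0")
    case True
    then show ?thesis using \<open>0 < n\<close> by (intro bexI[of _ 0]) auto
  next
    case False
    then have "0 < z" using that by simp
    then obtain l where l: "l \<in> {0..z}" "low_pow2 z l" using low_pow2_exists by blast
    obtain i where i: "i \<in> {0..<n}" "C l z i" using total[of l z] l that by auto
    have "D0 1 (\<lambda>e. C l z (e 0))" by (intro bounded_intros D0_comp3[OF C]; use l that in simp)
    moreover have "0 \<le> i" using i by simp
    ultimately have "\<exists>k. 0 \<le> k \<and> k \<le> i \<and> C l z k \<and> (\<forall>j\<in>{0..<k}. \<not> C l z j)"
      using i(2) by (rule least)
    then obtain k where "0 \<le> k" "k \<le> i" "C l z k" "\<forall>j\<in>{0..<k}. \<not> C l z j" by blast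
    moreover from this i have "k < n" "k \<in> {0..}" by auto
    ultimately show ?thesis using l by blast
  qed
  have no_low_pow2_0: "l \<notin> {0..0}" if "low_pow2 0 l" for l :: 'a
    using that is_pow2_pos unfolding low_pow2_def by force
  have col_unique: "i = k" if *: "0 \<le> z" "0 \<le> i" "0 \<le> k" "?Col z i" "?Col z k" for z i k
  proof (cases "z = 0")
    case True
    then show ?thesis using that(4,5) no_low_pow2_0 by blast
  next
    case False
    then have "0 < z" using that(1) by simp
    obtain l where l: "low_pow2 z l" "C l z i" "\<forall>k\<in>{0..<i}. \<not> C l z k" using *(4) False by blast
    obtain l' where l': "low_pow2 z l'" "C l' z k" "\<forall>k'\<in>{0..<k}. \<not> C l' z k'" using *(5) False by blast
    have "l = l'" using low_pow2_unique l l' \<open>0 < z\<close> by blast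
    then have "\<not> k < i" "\<not> i < k" using l l' that(2,3) by auto
    then show ?thesis by simp
  qed
  have "coloring c n"
    unfolding coloring_def
  proof (intro conjI ballI impI)
    fix w assume "w \<in> {0..}" "w \<in> c"
    then obtain z i where "z \<in> {0..w}" "i \<in> {0..w}" "w = pairing z i" "?Col z i" using c by blast
    moreover from this have "z \<in> {0..}" "i \<in> {0..}" by auto
    ultimately show "\<exists>z\<in>{0..}. \<exists>i\<in>{0..}. i < n \<and> w = pairing z i" by blast
  next
    fix z :: 'a assume "z \<in> {0..}"
    then have "0 \<le> z" by simp
    then obtain i where "i \<in> {0..}" "?Col z i" using col_total by blast
    moreover from this(1) have "0 \<le> i" by simp
    ultimately show "\<exists>i\<in>{0..}. pairing z i \<in> c" using pairing_c \<open>0 \<le> z\<close> by blast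
  next
    fix z i k :: 'a assume "z \<in> {0..}" "i \<in> {0..}" "k \<in> {0..}" "pairing z i \<in> c \<and> pairing z k \<in> c"
    then have *: "0 \<le> z" "0 \<le> i" "0 \<le> k" and "pairing z i \<in> c" "pairing z k \<in> c" by auto
    then have "?Col z i" "?Col z k" using pairing_c by blast+
    then show "i = k" by (rule col_unique[OF *])
  qed
  moreover have "n \<in> {0..}" using n by simp
  ultimately have "\<exists>H\<in>S. (\<forall>x\<in>{0..}. \<exists>y\<in>{0..}. x < y \<and> y \<in> H) \<and> 0 \<notin> H \<and> apart_set H \<and>
      (\<exists>i\<in>{0..}. \<forall>z\<in>{0..}. adjacent_sum H z \<longrightarrow> pairing z i \<in> c)"
    using AHT \<open>c \<in> S\<close> unfolding adjacent_hindman_def by blast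
  then obtain H i where H: "H \<in> S" "\<forall>x\<in>{0..}. \<exists>y\<in>{0..}. x < y \<and> y \<in> H" "apart_set H"
    and i: "i \<in> {0..}" "\<forall>z\<in>{0..}. adjacent_sum H z \<longrightarrow> pairing z i \<in> c"
    by (elim bexE conjE) (rule that)
  have hom: "\<exists>l. low_pow2 x l \<and> (\<forall>t0\<in>{0..}. \<exists>t\<in>{t0..}. i < n \<and> C l t i)" if x: "0 < x" "x \<in> H" for x
  proof -
    obtain l where l: "low_pow2 x l" using low_pow2_exists x by blast
    have "\<exists>t\<in>{t0..}. i < n \<and> C l t i" if t0: "t0 \<in> {0..}" for t0
    proof -
      \<comment> \<open>Asking for sums from \<open>t0 + 1\<close> on makes \<open>z\<close>
        positive, as \<open>low_pow2_add\<close> requires.\<close>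
      have "0 \<le> t0 + 1" "0 \<le> x" using t0 x by auto
      then obtain z P where z: "t0 + 1 \<le> z" "adjacent_sum H z" "is_pow2 P" "x < P" "P dvd z - x"
        using adjacent_sum_beyond[OF H _ x(2)] by blast
      have "t0 < z" using z(1) by (metis less_add_one less_le_trans)
      then have "0 < z" using t0 by simp
      then have "pairing z i \<in> c" using i(2) z(2) by auto
      then have "?Col z i" using pairing_c i(1) \<open>0 < z\<close> by simp
      then obtain l' where "low_pow2 z l'" "C l' z i" "i < n" using \<open>0 < z\<close> by auto
      moreover from this have "l' = l"
        using low_pow2_add[OF x(1) z(4,3,5) \<open>0 < z\<close>] low_pow2_unique[OF _ l x(1)] by blast
      moreover have "z \<in> {t0..}" using \<open>t0 < z\<close> by simp
      ultimately show ?thesis by blast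
    qed
    then show ?thesis using l by blast
  qed
  have "\<exists>l\<in>{x0..}. \<forall>t0\<in>{0..}. \<exists>t\<in>{t0..}. i < n \<and> C l t i" if x0: "x0 \<in> {0..}" for x0
  proof -
    obtain x where x: "x0 < x" "x \<in> H" using H(2) x0 by blast
    then have "x \<in> {0..}" using x0 by auto
    then obtain y where y: "x < y" "y \<in> H" using H(2) by blast
    have "0 < x" "0 < y" using x y x0 by auto
    \<comment> \<open>The separating power exceeds \<open>x\<close>, hence \<open>x0\<close>, and
      divides \<open>y\<close>; so the low power of \<open>y\<close> is at least as large.\<close>
    obtain P where P: "is_pow2 P" "x < P" "P dvd y"
      using apart_set_pow2[OF H(3) _ x(2) y(2,1)] \<open>0 < x\<close> by auto
    obtain l where l: "low_pow2 y l" "\<forall>t0\<in>{0..}. \<exists>t\<in>{t0..}. i < n \<and> C l t i" using hom \<open>0 < y\<close> y by blast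
    have "P \<in> {0..y}" using dvd_le P(3) \<open>0 < y\<close> less_imp_le[OF is_pow2_pos[OF P(1)]] by simp
    then have "P \<le> l" using l(1) P unfolding low_pow2_def by blast
    then have "l \<in> {x0..}" using x P by auto
    then show ?thesis using l(2) by blast
  qed
  moreover from this[of 0] have "i < n" by force
  ultimately have "i \<in> {0..<n}" "\<forall>x0\<in>{0..}. \<exists>l\<in>{x0..}. \<forall>t0\<in>{0..}. \<exists>t\<in>{t0..}. C l t i"
    using i(1) by auto
  then show ?thesis by blast
qed

text \<open>The threshold of \<open>j\<close> is the least \<open>u\<close> with
  \<open>A j u\<close>. The maximal threshold is the least \<open>y\<close> at which all
  \<open>A j\<close> hold, and an index failing at \<open>y - 1\<close> attains it. The value
  \<open>t + 1\<close> covers the case that no common \<open>y\<close> exists up to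
  \<open>t\<close>.\<close>

lemma largest_threshold:
  assumes "D0 2 (\<lambda>e. A (e 0) (e 1))" "\<And>j u u'. A j u \<Longrightarrow> u \<le> u' \<Longrightarrow> A j u'" "0 < n" "0 \<le> (t :: 'a)"
  shows "\<exists>i\<in>{0..<n}. \<forall>j\<in>{0..<n}. \<forall>u\<in>{0..t}. A i u \<longrightarrow> A j u"
proof -
  let ?P = "\<lambda>y. y = t + 1 \<or> (\<forall>j\<in>{0..<n}. A j y)"
  have "D0 1 (\<lambda>e. ?P (e 0))" by (intro bounded_intros D0_comp2[OF assms(1)]; use assms in simp)
  moreover have "0 \<le> t + 1" "?P (t + 1)" using assms by auto
  ultimately have "\<exists>y. 0 \<le> y \<and> y \<le> t + 1 \<and> ?P y \<and> (\<forall>z\<in>{0..<y}. \<not> ?P z)" by (rule least)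
  then obtain y where y: "0 \<le> y" "y \<le> t + 1" "?P y" "\<forall>z\<in>{0..<y}. \<not> ?P z" by blast
  show ?thesis
  proof (cases "y = 0")
    case True
    then have "\<forall>j\<in>{0..<n}. A j 0" using y(3) assms(4) by auto
    then show ?thesis using assms(2,3) by (intro bexI[of _ 0]) auto
  next
    case False
    then have "y - 1 \<in> {0..<y}" using y(1) pos_ge_1[of y] by auto
    then obtain i where i: "i \<in> {0..<n}" "\<not> A i (y - 1)" using y(4) by blast
    have "A j u" if "j \<in> {0..<n}" "u \<in> {0..t}" "A i u" for j u
    proof -
      have "\<not> u \<le> y - 1" using assms(2) that(3) i(2) by blast
      then have "y \<le> u" using discrete[of "y - 1" u] by simp
      moreover have "A j y" using y(3) \<open>y \<le> u\<close> that(1,2) by auto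
      ultimately show ?thesis using assms(2) by blast
    qed
    then show ?thesis using i(1) by blast
  qed
qed

section \<open>Bounding from recurrent colours\<close>

lemma collection_Pi1:
  assumes AHT: adjacent_hindman
    and R: "D0 3 (\<lambda>e. R (e 0) (e 1) (e 2))" and n: "0 \<le> n"
    and total: "\<forall>y\<in>{0..<n}. \<exists>u\<in>{0..}. \<forall>v\<in>{0..}. R y u v"
  shows "\<exists>U\<in>{0..}. \<forall>y\<in>{0..<n}. \<exists>u\<in>{0..U}. \<forall>v\<in>{0..}. R y u (v :: 'a)"
proof (cases "n = 0")
  case False
  let ?A = "\<lambda>t j u. \<exists>u'\<in>{0..u}. \<forall>v\<in>{0..t}. R j u' v"
  let ?C = "\<lambda>t i. \<forall>j\<in>{0..<n}. \<forall>u\<in>{0..t}. ?A t i u \<longrightarrow> ?A t j u"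
  \<comment> \<open>The colour ignores the first argument, so a single colour recurring cofinally in
    \<open>t\<close> results.\<close>
  have "\<exists>i\<in>{0..<n}. \<forall>x0\<in>{0 :: 'a..}. \<exists>x\<in>{x0..}. \<forall>t0\<in>{0..}. \<exists>t\<in>{t0..}. ?C t i"
  proof (rule stable_pigeonhole[OF AHT, where C="\<lambda>_. ?C"])
    show "0 \<le> n" by (rule n)
    show "D0 3 (\<lambda>e. ?C (e 1) (e 2))" by (intro bounded_intros D0_comp3[OF R]; use n in simp)
    fix t :: 'a assume "0 \<le> t"
    then show "\<exists>i\<in>{0..<n}. ?C t i"
      using n False by (intro largest_threshold) ((intro bounded_intros D0_comp3[OF R]; simp), force, auto)
  qed
  then obtain i where i: "i \<in> {0..<n}" "\<forall>t0\<in>{0..}. \<exists>t\<in>{t0..}. ?C t i" by force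
  obtain U where U: "U \<in> {0..}" "\<forall>v\<in>{0..}. R i U v" using total i(1) by blast
  have "\<exists>u\<in>{0..U}. \<forall>v\<in>{0..}. R y u v" if y: "y \<in> {0..<n}" for y
  proof (rule ccontr)
    assume "\<not> ?thesis"
    \<comment> \<open>If each \<open>u \<le> U\<close> has a counterexample, Sigma-1 collection
      bounds them by one \<open>t0\<close>, and a recurrence of the colour beyond \<open>t0\<close>
      contradicts this.\<close>
    then have "\<forall>u\<in>{0..<U + 1}. \<exists>v\<in>{0..}. \<not> R y u v" by (auto simp: less_add_1)
    moreover have "D0 2 (\<lambda>e. \<not> R y (e 0) (e 1))" by (intro bounded_intros D0_comp3[OF R]; use y in simp)
    ultimately obtain t0 where t0: "t0 \<in> {0..}" "\<forall>u\<in>{0..<U + 1}. \<exists>v\<in>{0..t0}. \<not> R y u v"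
      using collection[of "\<lambda>u v. \<not> R y u v" "U + 1"] U(1) by auto
    \<comment> \<open>\<open>?C t i\<close> compares thresholds only up to \<open>t\<close>, so
      \<open>t\<close> must reach \<open>U\<close> as well.\<close>
    have "max t0 U \<in> {0..}" using U by auto
    then obtain t where t: "t \<in> {max t0 U..}" "?C t i" using i(2) by blast
    have "U \<in> {0..U}" "\<forall>v\<in>{0..t}. R i U v" using U by auto
    then have "?A t i U" by blast
    then have "?A t y U" using t y U(1) by auto
    then obtain u where u: "u \<in> {0..U}" "\<forall>v\<in>{0..t}. R y u v" by blast
    then have "u \<in> {0..<U + 1}" by (simp add: less_add_1)
    then obtain v where "v \<in> {0..t0}" "\<not> R y u v" using t0(2) by blast
    then show False using u(2) t(1) by auto
  qed
  then show ?thesis using U(1) by blast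
qed auto

theorem bounding_Sigma3:
  assumes AHT: adjacent_hindman
    and R: "D0 4 (\<lambda>e. R (e 0) (e 1) (e 2) (e 3))" and n: "0 \<le> n"
    and total: "\<forall>x\<in>{0..<n}. \<exists>y\<in>{0..}. \<forall>u\<in>{0..}. \<exists>v\<in>{0..}. R x y u v"
  shows "\<exists>Y\<in>{0..}. \<forall>x\<in>{0..<n}. \<exists>y\<in>{0..Y}. \<forall>u\<in>{0..}. \<exists>v\<in>{0..}. R x y u (v :: 'a)"
proof (cases "n = 0")
  case False
  let ?A = "\<lambda>r t j y. \<exists>y'\<in>{0..y}. \<forall>u\<in>{0..r}. \<exists>v\<in>{0..t}. R j y' u v"
  let ?C = "\<lambda>r t i. \<forall>j\<in>{0..<n}. \<forall>y\<in>{0..r}. ?A r t i y \<longrightarrow> ?A r t j y"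
  have "\<exists>i\<in>{0..<n}. \<forall>x0\<in>{0..}. \<exists>x\<in>{x0..}. \<forall>t0\<in>{0..}. \<exists>t\<in>{t0..}. ?C x t i"
  proof (rule stable_pigeonhole[OF AHT, where C="?C"])
    show "0 \<le> n" by (rule n)
    show "D0 3 (\<lambda>e. ?C (e 0) (e 1) (e 2))" by (intro bounded_intros D0_comp4[OF R]; use n in simp)
    fix r t :: 'a assume "0 \<le> r" "0 \<le> t"
    then show "\<exists>i\<in>{0..<n}. ?C r t i"
      using n False by (intro largest_threshold) ((intro bounded_intros D0_comp4[OF R]; simp), force, auto)
  qed
  then obtain i where i: "i \<in> {0..<n}"
    "\<forall>r0\<in>{0..}. \<exists>r\<in>{r0..}. \<forall>t0\<in>{0..}. \<exists>t\<in>{t0..}. ?C r t i" by blast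
  obtain Y where Y: "Y \<in> {0..}" "\<forall>u\<in>{0..}. \<exists>v\<in>{0..}. R i Y u v" using total i(1) by blast
  \<comment> \<open>The \<open>y\<close> found here may depend on \<open>r0\<close>; a single
    \<open>y\<close> for all \<open>u\<close> is extracted afterwards.\<close>
  have approx: "\<exists>y\<in>{0..Y}. \<forall>u\<in>{0..r0}. \<exists>v\<in>{0..}. R j y u v" if j: "j \<in> {0..<n}" and "r0 \<in> {0..}" for j r0
  proof -
    \<comment> \<open>\<open>r\<close> must reach \<open>Y\<close>, because \<open>?C r t i\<close>
      compares thresholds only up to \<open>r\<close>.\<close>
    have "max r0 Y \<in> {0..}" using Y by auto
    then obtain r where r: "r \<in> {max r0 Y..}" "\<forall>t0\<in>{0..}. \<exists>t\<in>{t0..}. ?C r t i" using i(2) by blast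
    have "0 \<le> r" using r(1) Y(1) by auto
    have "D0 2 (\<lambda>e. R i Y (e 0) (e 1))" by (intro bounded_intros D0_comp4[OF R]; use i Y in simp)
    moreover have "\<forall>u\<in>{0..<r + 1}. \<exists>v\<in>{0..}. R i Y u v" using Y(2) by auto
    \<comment> \<open>With \<open>r\<close> fixed, Sigma-1 collection gives a \<open>t0\<close> from
      which on \<open>Y\<close> counts as good for \<open>i\<close>.\<close>
    ultimately obtain t0 where t0: "t0 \<in> {0..}" "\<forall>u\<in>{0..<r + 1}. \<exists>v\<in>{0..t0}. R i Y u v"
      using collection[of "R i Y" "r + 1"] \<open>0 \<le> r\<close> by auto
    then obtain t where t: "t \<in> {t0..}" "?C r t i" using r(2) by blast
    have "\<exists>v\<in>{0..t}. R i Y u v" if "u \<in> {0..r}" for u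
    proof -
      have "u \<in> {0..<r + 1}" using that by (auto simp: less_add_1)
      then obtain v where "v \<in> {0..t0}" "R i Y u v" using t0(2) by blast
      then show ?thesis using t(1) by (intro bexI[of _ v]) auto
    qed
    moreover have "Y \<in> {0..Y}" using Y(1) by simp
    ultimately have "?A r t i Y" by blast
    moreover have "Y \<in> {0..r}" using Y(1) r(1) by auto
    ultimately obtain y where y: "y \<in> {0..Y}" "\<forall>u\<in>{0..r}. \<exists>v\<in>{0..t}. R j y u v" using t(2) j by blast
    have "\<exists>v\<in>{0..}. R j y u v" if "u \<in> {0..r0}" for u
    proof -
      have "u \<in> {0..r}" using that r(1) by auto
      then obtain v where "v \<in> {0..t}" "R j y u v" using y(2) by blast
      then show ?thesis by (intro bexI[of _ v]) auto
    qed
    then show ?thesis using y(1) by blast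
  qed
  have "\<exists>y\<in>{0..Y}. \<forall>u\<in>{0..}. \<exists>v\<in>{0..}. R j y u v" if j: "j \<in> {0..<n}" for j
  proof (rule ccontr)
    assume "\<not> ?thesis"
    \<comment> \<open>If every \<open>y \<le> Y\<close> failed at some \<open>u\<close>, Pi-1
      collection would bound these failures by one \<open>U\<close>, contrary to
      \<open>approx\<close> at \<open>U\<close>.\<close>
    then have "\<forall>y\<in>{0..<Y + 1}. \<exists>u\<in>{0..}. \<forall>v\<in>{0..}. \<not> R j y u v" by (auto simp: less_add_1)
    moreover have "D0 3 (\<lambda>e. \<not> R j (e 0) (e 1) (e 2))" by (intro bounded_intros D0_comp4[OF R]; use j in simp)
    ultimately have "\<exists>U\<in>{0..}. \<forall>y\<in>{0..<Y + 1}. \<exists>u\<in>{0..U}. \<forall>v\<in>{0..}. \<not> R j y u v"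
      using collection_Pi1[OF AHT, of "\<lambda>y u v. \<not> R j y u v" "Y + 1"] Y(1) by auto
    then obtain U where U: "U \<in> {0..}" "\<forall>y\<in>{0..<Y + 1}. \<exists>u\<in>{0..U}. \<forall>v\<in>{0..}. \<not> R j y u v" by blast
    obtain y where y: "y \<in> {0..Y}" "\<forall>u\<in>{0..U}. \<exists>v\<in>{0..}. R j y u v" using approx[OF j U(1)] by blast
    then have "y \<in> {0..<Y + 1}" by (auto simp: less_add_1)
    then show False using U(2) y(2) by blast
  qed
  then show ?thesis using Y(1) by blast
qed auto

lemma Tm_case_nat: "Tm m t \<Longrightarrow> (\<And>i. Tm m (F i)) \<Longrightarrow> Tm m (\<lambda>e. case_nat (t e) (\<lambda>i. F i e) i)"
  by (cases i) auto

text \<open>A Sigma-3 formula brings its own existential variable \<open>y'\<close>, so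
  \<open>y\<close> and \<open>y'\<close> are merged into one number by the pairing before
  \<open>bounding_Sigma3\<close> applies.\<close>

theorem valid_bounding:
  assumes AHT: adjacent_hindman and \<phi>: "\<phi> \<in> Sigma0 3"
  shows "valid {0..} S (bounding_axiom \<phi>)"
proof -
  obtain \<delta> where \<delta>: "\<delta> \<in> Delta00" "\<phi> = ExN (AllN (ExN \<delta>))"
    using \<phi> by (auto simp: numeral_3_eq_3)
  have "sat0 e s' (AllN
    (AllN (Var 0 \<^bold>< Var 1 \<^bold>\<longrightarrow> ExN (app \<phi> [Var 0, Var 1] 3))
      \<^bold>\<longrightarrow> ExN (AllN (Var 0 \<^bold>< Var 2 \<^bold>\<longrightarrow> ExN (Var 0 \<^bold>< Var 2 \<^bold>\<and> app \<phi> [Var 0, Var 1] 4)))))"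
    if e: "range e \<subseteq> {0..}" and s': "range s' \<subseteq> S" for e s'
  proof -
    let ?R = "\<lambda>x y y' u v. sat0 (case_nat v (case_nat u (case_nat y' (case_nat y (case_nat x e))))) s' \<delta>"
    let ?Q = "\<lambda>x w u v. \<exists>y\<in>{0..w}. \<exists>y'\<in>{0..w}. w = pairing y y' \<and> ?R x y y' u v"
    have D0_R: "D0 m (\<lambda>f. ?R (t1 f) (t2 f) (t3 f) (t4 f) (t5 f))"
      if "Tm m t1" "Tm m t2" "Tm m t3" "Tm m t4" "Tm m t5" for m t1 t2 t3 t4 t5
    proof -
      have "Tm m (\<lambda>_. e i)" for i using e by (intro Tm_const) auto
      then show ?thesis
        using that s' by (intro D0_sat[OF \<delta>(1), where F="\<lambda>i f. case_nat (t5 f) (case_nat (t4 f)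
          (case_nat (t3 f) (case_nat (t2 f) (case_nat (t1 f) e)))) i"] Tm_case_nat) auto
    qed
    have bound: "\<exists>b\<in>{0..}. \<forall>x\<in>{0..<n}. \<exists>y\<in>{0..<b}. \<exists>y'\<in>{0..}. \<forall>u\<in>{0..}. \<exists>v\<in>{0..}. ?R x y y' u v"
      if n: "0 \<le> n" and total: "\<forall>x\<in>{0..<n}. \<exists>y\<in>{0..}. \<exists>y'\<in>{0..}. \<forall>u\<in>{0..}. \<exists>v\<in>{0..}. ?R x y y' u v" for n
    proof -
      have "D0 4 (\<lambda>f. ?Q (f 0) (f 1) (f 2) (f 3))"
        unfolding pairing_def by (intro bounded_intros D0_R; simp)
      moreover have "\<forall>x\<in>{0..<n}. \<exists>w\<in>{0..}. \<forall>u\<in>{0..}. \<exists>v\<in>{0..}. ?Q x w u v"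
      proof
        fix x assume "x \<in> {0..<n}"
        then obtain y y' where y: "y \<in> {0..}" "y' \<in> {0..}" "\<forall>u\<in>{0..}. \<exists>v\<in>{0..}. ?R x y y' u v"
          using total by blast
        then have w: "y \<in> {0..pairing y y'}" "y' \<in> {0..pairing y y'}" "pairing y y' \<in> {0..}"
          using pairing_ge[of y y'] pairing_nonneg[of y y'] by auto
        show "\<exists>w\<in>{0..}. \<forall>u\<in>{0..}. \<exists>v\<in>{0..}. ?Q x w u v"
        proof (rule bexI[of _ "pairing y y'"], rule ballI)
          fix u :: 'a assume "u \<in> {0..}"
          then obtain v where v: "v \<in> {0..}" "?R x y y' u v" using y(3) by blast
          then have "?Q x (pairing y y') u v" using w(1,2) by blast
          then show "\<exists>v\<in>{0..}. ?Q x (pairing y y') u v" using v(1) by (rule bexI)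
        qed (rule w(3))
      qed
      ultimately have "\<exists>Y\<in>{0..}. \<forall>x\<in>{0..<n}. \<exists>w\<in>{0..Y}. \<forall>u\<in>{0..}. \<exists>v\<in>{0..}. ?Q x w u v"
        using bounding_Sigma3[OF AHT, of ?Q n] n by blast
      then obtain Y where Y: "Y \<in> {0..}" "\<forall>x\<in>{0..<n}. \<exists>w\<in>{0..Y}. \<forall>u\<in>{0..}. \<exists>v\<in>{0..}. ?Q x w u v" by blast
      have "\<exists>y\<in>{0..<Y + 1}. \<exists>y'\<in>{0..}. \<forall>u\<in>{0..}. \<exists>v\<in>{0..}. ?R x y y' u v" if "x \<in> {0..<n}" for x
      proof -
        obtain w where w: "w \<in> {0..Y}" "\<forall>u\<in>{0..}. \<exists>v\<in>{0..}. ?Q x w u v" using Y(2) \<open>x \<in> {0..<n}\<close> by blast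
        \<comment> \<open>The components of \<open>w\<close> are read off at \<open>u = 0\<close>;
          by injectivity of the pairing, the instances for all other \<open>u\<close> concern the
          same components.\<close>
        obtain v where "?Q x w 0 v" using bspec[OF w(2), of 0] by auto
        then obtain y y' where y: "y \<in> {0..w}" "y' \<in> {0..w}" "w = pairing y y'" by blast
        have "\<exists>v\<in>{0..}. ?R x y y' u v" if u: "u \<in> {0..}" for u
        proof -
          obtain v where "v \<in> {0..}" "?Q x w u v" using bspec[OF w(2) u] by (rule bexE)
          then obtain z z' where v: "v \<in> {0..}" "z \<in> {0..w}" "z' \<in> {0..w}" "w = pairing z z'" "?R x z z' u v"
            by (elim bexE conjE) (rule that)
          have "0 \<le> y" "0 \<le> y'" "0 \<le> z" "0 \<le> z'" using y(1,2) v(2,3) by auto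
          from pairing_inj[OF this trans[OF y(3)[symmetric] v(4)]]
          have "y = z" "y' = z'" by auto
          then have "?R x y y' u v" using v(5) by simp
          then show ?thesis using v(1) by (rule bexI)
        qed
        moreover have "y \<in> {0..<Y + 1}" "y' \<in> {0..}" using y w(1) by (auto simp: less_add_1)
        ultimately show ?thesis by blast
      qed
      moreover have "Y + 1 \<in> {0..}" using Y(1) by simp
      ultimately show ?thesis by blast
    qed
    have split: "(\<forall>x\<in>{0..}. x < n \<longrightarrow> G x) \<longleftrightarrow> (\<forall>x\<in>{0..<n}. G x)" "(\<exists>x\<in>{0..}. x < n \<and> G x) \<longleftrightarrow> (\<exists>x\<in>{0..<n}. G x)"
      for n :: 'a and G by auto
    show ?thesis
      by (simp add: \<delta>(2) sat_app2 sat_simps split) (use bound in blast)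
  qed
  then show ?thesis
    unfolding bounding_axiom_def valid_univ_closure by (simp add: valid_def)
qed

end

section \<open>The main theorem\<close>

interpretation zring: arith zring_sets "\<lambda>i. of_num (abs_num (from_nat i))" "\<lambda>X. of_num ` num_set X"
proof
  show "range (\<lambda>i. of_num (abs_num (from_nat i))) = {0..}"
  proof -
    have "range (\<lambda>i. of_num (abs_num (from_nat i))) = of_num ` range (\<lambda>i. abs_num (from_nat i))"
      by (simp only: image_image)
    also have "\<dots> = range of_num" by (simp only: num.range_p)
    finally show ?thesis by (auto simp: zring_nonneg)
  qed
  show "range (\<lambda>X. of_num ` num_set X) = zring_sets"
    by (simp add: zring_sets_def image_image)
  show "valid {0..} zring_sets \<phi>" if "\<phi> \<in> RCA0" for \<phi>
    using that Th(2) valid_zring_iff closed_RCA0 by blast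
qed auto

theorem corollary3:
  shows "\<forall>\<phi> \<in> BSigma0 3. RCA0 \<union> {AHT} \<turnstile> \<phi>"
proof (rule ccontr)
  assume "\<not> ?thesis"
  then obtain \<psi> where AHT: "AHT \<in> Th" and \<psi>: "\<psi> \<in> BSigma0 3" "\<psi> \<notin> Th"
    using Th(3) by blast
  have "valid {0..} zring_sets AHT" using AHT valid_zring_iff[OF closed_AHT] by simp
  then have "sat {0..} zring_sets (\<lambda>_. 0) (\<lambda>_. of_num ` num_set 0) AHT"
    by (rule valid_sat) (auto simp: zring_sets_def)
  then have "zring.adjacent_hindman" by (subst (asm) zring.sat_AHT) auto
  then have "valid {0..} zring_sets \<psi>"
    using \<psi>(1) zring.valid_bounding by (auto simp: BSigma0_def)
  moreover have "closed \<psi>" using \<psi>(1) by (auto simp: BSigma0_def bounding_axiom_def)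
  ultimately show False using \<psi>(2) valid_zring_iff by blast
qed

end
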